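(* Let $\mathfrak g$ be a simple complex Lie algebra with a fixed numeration of positive roots and a fixed monomial order, let $\lambda_1,\dots,\lambda_m$ be dominant weights, and let $S$ be the semigroup they generate. Suppose that the following two properties hold: $( * )$ for any signature $\sigma\in\Sigma^{(\lambda_1,\ldots,\lambda_m)}$ one can obtain a given decomposition $\sigma=\sigma_1+\ldots+\sigma_k$ into a sum of essential signatures of highest weights in $\{\lambda_1,\ldots,\lambda_m\}$ from any other such decomposition $\sigma=\tau_1+\ldots+\tau_l$ by applying admissible operations; $( ** )$ for any two weights $\lambda_i,\lambda_j$ any essential signature of highest weight $\lambda_i+\lambda_j$ is representable as a sum of essential signatures of highest weights in $\{\lambda_1,\ldots,\lambda_m\}$. Then $\Sigma(S)=\Sigma^{(\lambda_1,\ldots,\lambda_m)}$.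
   Context: Let $\mathfrak g=\mathfrak u^-\oplus\mathfrak t\oplus\mathfrak u$ be the triangular decomposition, $\Delta_+=\{\alpha_1,\dots,\alpha_N\}$ the positive roots in the fixed numeration, $e_{\pm\alpha}$ root vectors, $V(\lambda)$ the irreducible module of highest weight $\lambda$ with highest weight vector $v_\lambda$. A monomial order on $\mathbb Z_{\ge0}^N$ is a total order compatible with addition, with $0$ least. A signature is $\sigma=(\lambda;p_1,\dots,p_N)$ with $\lambda$ dominant (its highest weight) and $p_i\in\mathbb Z_{\ge0}$; $v(\sigma)=\frac{e_{-\alpha_1}^{p_1}}{p_1!}\cdots\frac{e_{-\alpha_N}^{p_N}}{p_N!}v_\lambda$. Signatures of the same highest weight are ordered by exponent tuples via the monomial order; $\sigma$ of highest weight $\lambda$ is essential if $v(\sigma)$ is not in the span of the $v(\tau)$ with $\tau<\sigma$ of highest weight $\lambda$. The essential signatures form a semigroup under componentwise addition. $\Sigma(S)$ is the semigroup of essential signatures with highest weight in $S$; $\Sigma^{(\lambda_1,\dots,\lambda_m)}$ is the semigroup generated by the essential signatures with highest weight in $\{\lambda_1,\dots,\lambda_m\}$. Admissible operations on a decomposition $\sigma=\sigma_1+\dots+\sigma_k$ into essential signatures of highest weights in $\{\lambda_1,\dots,\lambda_m\}$: (1) replacing a pair $\sigma_i,\sigma_j$ by a pair of essential signatures $\sigma_i',\sigma_j'$ of highest weights in $\{\lambda_1,\dots,\lambda_m\}$ with $\sigma_i+\sigma_j=\sigma'_i+\sigma'_j$; (2) replacing a pair $\sigma_i,\sigma_j$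 by one essential signature $\sigma'_s$ of highest weight in $\{\lambda_1,\dots,\lambda_m\}$ with $\sigma_i+\sigma_j=\sigma_s'$; (3) replacing a signature $\sigma_s$ by a pair of essential signatures $\sigma_i',\sigma_j'$ of highest weights in $\{\lambda_1,\dots,\lambda_m\}$ with $\sigma_s=\sigma_i'+\sigma_j'$. *)

theory Defs
  imports Complex_Main
    "HOL-Library.Multiset"
    "HOL-Library.Function_Algebras"
    "HOL-Library.Product_Plus"
begin

section \<open>Complex Lie algebras, roots and weights\<close>

locale complex_lie_algebra = vector_space scale
  for scale :: "complex \<Rightarrow> 'g::ab_group_add \<Rightarrow> 'g"  (infixr \<open>*s\<close> 75) +
  fixes bracket :: "'g \<Rightarrow> 'g \<Rightarrow> 'g"
  assumes bracket_add_left: "bracket (x + y) z = bracket x z + bracket y z"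
    and bracket_add_right: "bracket x (y + z) = bracket x y + bracket x z"
    and bracket_scale_left: "bracket (c *s x) y = c *s bracket x y"
    and bracket_scale_right: "bracket x (c *s y) = c *s bracket x y"
    and bracket_self: "bracket x x = 0"
    and jacobi: "bracket x (bracket y z) + bracket y (bracket z x) + bracket z (bracket x y) = 0"
begin

definition lie_ideal :: "'g set \<Rightarrow> bool" where
  "lie_ideal I \<longleftrightarrow> subspace I \<and> (\<forall>x. \<forall>y\<in>I. bracket x y \<in> I)"

definition abelian_subalgebra :: "'g set \<Rightarrow> bool" where
  "abelian_subalgebra A \<longleftrightarrow> subspace A \<and> (\<forall>x\<in>A. \<forall>y\<in>A. bracket x y = 0)"

definition ad_diagonalizable :: "'g \<Rightarrow> bool" where
  "ad_diagonalizable h \<longleftrightarrow> span {x. \<exists>c. bracket h x = c *s x} = UNIV"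

text \<open>The usual description of Cartan subalgebras of a semisimple complex Lie algebra: maximal
  abelian subalgebras all of whose elements are ad-semisimple.\<close>

definition cartan_subalgebra :: "'g set \<Rightarrow> bool" where
  "cartan_subalgebra T \<longleftrightarrow>
     abelian_subalgebra T \<and>
     (\<forall>A. abelian_subalgebra A \<and> T \<subseteq> A \<longrightarrow> A = T) \<and>
     (\<forall>h\<in>T. ad_diagonalizable h)"

text \<open>The dual space of \<open>T\<close>. A functional is extended by \<open>0\<close> outside \<open>T\<close>, so that two functionals
  are equal as HOL functions iff they agree on \<open>T\<close>; pointwise addition preserves this convention.\<close>

definition dual_space :: "'g set \<Rightarrow> ('g \<Rightarrow> complex) set" where
  "dual_space T = {lam. (\<forall>x\<in>T. \<forall>y\<in>T. lam (x + y) = lam x + lam y) \<and>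
     (\<forall>c. \<forall>x\<in>T. lam (c *s x) = c * lam x) \<and> (\<forall>x. x \<notin> T \<longrightarrow> lam x = 0)}"

definition root_space :: "'g set \<Rightarrow> ('g \<Rightarrow> complex) \<Rightarrow> 'g set" where
  "root_space T \<alpha> = {x. \<forall>h\<in>T. bracket h x = \<alpha> h *s x}"

definition roots :: "'g set \<Rightarrow> ('g \<Rightarrow> complex) set" where
  "roots T = {\<alpha> \<in> dual_space T. \<alpha> \<noteq> 0 \<and> root_space T \<alpha> \<noteq> {0}}"

text \<open>A system of positive roots consists of the roots that are positive on a fixed regular
  element \<open>H\<close> of the real form of \<open>T\<close> on which all roots are real-valued. It determines the
  triangular decomposition, whose nilpotent parts are the sums of the root spaces of the
  positive and of the negative roots.\<close>

definition positive_roots :: "'g set \<Rightarrow> ('g \<Rightarrow> complex) set \<Rightarrow> bool" where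
  "positive_roots T P \<longleftrightarrow> (\<exists>H\<in>T. (\<forall>\<alpha>\<in>roots T. \<alpha> H \<in> \<real> \<and> \<alpha> H \<noteq> 0) \<and>
     P = {\<alpha> \<in> roots T. Re (\<alpha> H) > 0})"

definition coroot :: "'g set \<Rightarrow> ('g \<Rightarrow> complex) \<Rightarrow> 'g" where
  "coroot T \<alpha> =
     (THE h. h \<in> span {bracket x y | x y. x \<in> root_space T \<alpha> \<and> y \<in> root_space T (- \<alpha>)} \<and>
             \<alpha> h = 2)"

text \<open>Weights are understood to be integral.\<close>

definition dominant_weights :: "'g set \<Rightarrow> ('g \<Rightarrow> complex) set \<Rightarrow> ('g \<Rightarrow> complex) set" where
  "dominant_weights T P = {lam \<in> dual_space T. \<forall>\<alpha>\<in>P. lam (coroot T \<alpha>) \<in> \<nat>}"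

end

locale simple_complex_lie_algebra = complex_lie_algebra +
  assumes finite_dimensional: "\<exists>B. finite B \<and> span B = UNIV"
    and non_abelian: "\<exists>x y. bracket x y \<noteq> 0"
    and no_proper_ideals: "lie_ideal I \<Longrightarrow> I = {0} \<or> I = UNIV"


section \<open>Irreducible modules of given highest weight\<close>

text \<open>The underlying space of the module is a subspace \<open>V\<close> of an ambient complex vector space;
  nothing is required of \<open>act\<close> outside \<open>V\<close>.\<close>

locale lie_module =
  complex_lie_algebra scale bracket + M: vector_space mscale
  for scale :: "complex \<Rightarrow> 'g::ab_group_add \<Rightarrow> 'g"  (infixr \<open>*s\<close> 75)
    and bracket :: "'g \<Rightarrow> 'g \<Rightarrow> 'g"
    and mscale :: "complex \<Rightarrow> 'v::ab_group_add \<Rightarrow> 'v"  (infixr \<open>*m\<close> 75) +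
  fixes V :: "'v set" and act :: "'g \<Rightarrow> 'v \<Rightarrow> 'v"
  assumes subspace_V: "M.subspace V"
    and act_closed: "v \<in> V \<Longrightarrow> act x v \<in> V"
    and act_add_right: "v \<in> V \<Longrightarrow> w \<in> V \<Longrightarrow> act x (v + w) = act x v + act x w"
    and act_scale_right: "v \<in> V \<Longrightarrow> act x (c *m v) = c *m act x v"
    and act_add_left: "v \<in> V \<Longrightarrow> act (x + y) v = act x v + act y v"
    and act_scale_left: "v \<in> V \<Longrightarrow> act (c *s x) v = c *m act x v"
    and act_bracket: "v \<in> V \<Longrightarrow> act (bracket x y) v = act x (act y v) - act y (act x v)"
begin

definition submodule :: "'v set \<Rightarrow> bool" where
  "submodule W \<longleftrightarrow> M.subspace W \<and> W \<subseteq> V \<and> (\<forall>x. \<forall>w\<in>W. act x w \<in> W)"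

definition irreducible :: bool where
  "irreducible \<longleftrightarrow> V \<noteq> {0} \<and> (\<forall>W. submodule W \<longrightarrow> W = {0} \<or> W = V)"

definition highest_weight_vector ::
    "'g set \<Rightarrow> ('g \<Rightarrow> complex) set \<Rightarrow> ('g \<Rightarrow> complex) \<Rightarrow> 'v \<Rightarrow> bool" where
  "highest_weight_vector T P lam v \<longleftrightarrow>
     v \<in> V \<and> v \<noteq> 0 \<and> (\<forall>h\<in>T. act h v = lam h *m v) \<and>
     (\<forall>\<alpha>\<in>P. \<forall>x\<in>root_space T \<alpha>. act x v = 0)"

end


section \<open>Monomial orders\<close>

text \<open>Tuples of \<open>N\<close> natural numbers, indexed by \<open>1, \<dots>, N\<close>, are functions vanishing off
  \<open>{1..N}\<close>; their addition is the pointwise one.\<close>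

definition exponents :: "nat \<Rightarrow> (nat \<Rightarrow> nat) set" where
  "exponents N = {p. \<forall>i. i \<notin> {1..N} \<longrightarrow> p i = 0}"

definition monomial_order :: "nat \<Rightarrow> ((nat \<Rightarrow> nat) \<times> (nat \<Rightarrow> nat)) set \<Rightarrow> bool" where
  "monomial_order N R \<longleftrightarrow>
     linear_order_on (exponents N) R \<and>
     (\<forall>p q r. (p, q) \<in> R \<and> r \<in> exponents N \<longrightarrow> (p + r, q + r) \<in> R) \<and>
     (\<forall>p\<in>exponents N. (0, p) \<in> R)"


section \<open>Essential signatures\<close>

text \<open>A signature \<open>(\<lambda>; p\<^sub>1, \<dots>, p\<^sub>N)\<close> is the pair of its highest weight and its exponent tuple;
  addition of pairs is componentwise.\<close>

type_synonym 'g signature = "('g \<Rightarrow> complex) \<times> (nat \<Rightarrow> nat)"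

text \<open>The parameters are: the Cartan subalgebra \<open>T\<close>, the positive roots \<open>P\<close> with their
  numeration \<open>\<alpha> 1, \<dots>, \<alpha> N\<close>, the root vectors \<open>e\<close>, the monomial order \<open>R\<close>, and, for every
  dominant weight \<open>lam\<close>, the irreducible module \<open>V lam\<close> with action \<open>act lam\<close> and highest weight
  vector \<open>hv lam\<close>. Placing all \<open>V lam\<close> in one ambient space is no restriction: they embed into their
  direct sum.\<close>

locale essential_setting =
  simple_complex_lie_algebra scale bracket + M: vector_space mscale
  for scale :: "complex \<Rightarrow> 'g::ab_group_add \<Rightarrow> 'g"  (infixr \<open>*s\<close> 75)
    and bracket :: "'g \<Rightarrow> 'g \<Rightarrow> 'g"
    and mscale :: "complex \<Rightarrow> 'v::ab_group_add \<Rightarrow> 'v"  (infixr \<open>*m\<close> 75) +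
  fixes T :: "'g set"
    and P :: "('g \<Rightarrow> complex) set"
    and N :: nat
    and \<alpha> :: "nat \<Rightarrow> 'g \<Rightarrow> complex"
    and e :: "('g \<Rightarrow> complex) \<Rightarrow> 'g"
    and R :: "((nat \<Rightarrow> nat) \<times> (nat \<Rightarrow> nat)) set"
    and V :: "('g \<Rightarrow> complex) \<Rightarrow> 'v set"
    and act :: "('g \<Rightarrow> complex) \<Rightarrow> 'g \<Rightarrow> 'v \<Rightarrow> 'v"
    and hv :: "('g \<Rightarrow> complex) \<Rightarrow> 'v"
  assumes cartan: "cartan_subalgebra T"
    and positive: "positive_roots T P"
    and numeration: "bij_betw \<alpha> {1..N} P"
    and root_vectors: "\<beta> \<in> roots T \<Longrightarrow> e \<beta> \<in> root_space T \<beta> \<and> e \<beta> \<noteq> 0"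
    and order: "monomial_order N R"
    and module: "lam \<in> dominant_weights T P \<Longrightarrow> lie_module scale bracket mscale (V lam) (act lam)"
    and module_irreducible: "lam \<in> dominant_weights T P \<Longrightarrow>
          lie_module.irreducible mscale (V lam) (act lam)"
    and module_highest_weight: "lam \<in> dominant_weights T P \<Longrightarrow>
          lie_module.highest_weight_vector scale bracket mscale (V lam) (act lam) T P lam (hv lam)"
begin

definition signatures :: "'g signature set" where
  "signatures = dominant_weights T P \<times> exponents N"

text \<open>\<open>e\<^bsub>-\<alpha> 1\<^esub>\<^bsup>p 1\<^esup>/(p 1)! \<cdots> e\<^bsub>-\<alpha> N\<^esub>\<^bsup>p N\<^esup>/(p N)! v\<^sub>\<lambda>\<close>, the \<open>N\<close>-th factor acting first.\<close>

definition signature_vector :: "'g signature \<Rightarrow> 'v" where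
  "signature_vector = (\<lambda>(lam, p).
     foldr (\<lambda>i w. (1 / fact (p i)) *m (act lam (e (- \<alpha> i)) ^^ p i) w) [1..<Suc N] (hv lam))"

definition signature_less :: "'g signature \<Rightarrow> 'g signature \<Rightarrow> bool" where
  "signature_less \<tau> \<sigma> \<longleftrightarrow>
     \<tau> \<in> signatures \<and> \<sigma> \<in> signatures \<and> fst \<tau> = fst \<sigma> \<and> snd \<tau> \<noteq> snd \<sigma> \<and> (snd \<tau>, snd \<sigma>) \<in> R"

definition essential_signatures :: "'g signature set" where
  "essential_signatures =
     {\<sigma> \<in> signatures. signature_vector \<sigma> \<notin> M.span (signature_vector ` {\<tau>. signature_less \<tau> \<sigma>})}"

end


section \<open>Semigroups and decompositions\<close>

inductive_set semigroup_generated :: "'a::semigroup_add set \<Rightarrow> 'a set" for A where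
  generator: "a \<in> A \<Longrightarrow> a \<in> semigroup_generated A"
| add: "a \<in> semigroup_generated A \<Longrightarrow> b \<in> semigroup_generated A \<Longrightarrow>
     a + b \<in> semigroup_generated A"

definition with_highest_weight_in :: "'g signature set \<Rightarrow> ('g \<Rightarrow> complex) set \<Rightarrow> 'g signature set" where
  "with_highest_weight_in E S = {\<sigma> \<in> E. fst \<sigma> \<in> S}"

text \<open>A decomposition into summands from \<open>B\<close> has at least one summand, and the order of its
  summands is immaterial.\<close>

definition decomposition :: "'a::comm_monoid_add set \<Rightarrow> 'a \<Rightarrow> 'a multiset \<Rightarrow> bool" where
  "decomposition B \<sigma> D \<longleftrightarrow> D \<noteq> {#} \<and> set_mset D \<subseteq> B \<and> \<Sum>\<^sub># D = \<sigma>"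

inductive admissible_operation ::
    "'a::comm_monoid_add set \<Rightarrow> 'a multiset \<Rightarrow> 'a multiset \<Rightarrow> bool" for B where
  replace_pair: "a' \<in> B \<Longrightarrow> b' \<in> B \<Longrightarrow> a + b = a' + b' \<Longrightarrow>
     admissible_operation B (D + {#a, b#}) (D + {#a', b'#})"
| merge_pair: "c' \<in> B \<Longrightarrow> a + b = c' \<Longrightarrow>
     admissible_operation B (D + {#a, b#}) (D + {#c'#})"
| split_summand: "a' \<in> B \<Longrightarrow> b' \<in> B \<Longrightarrow> c = a' + b' \<Longrightarrow>
     admissible_operation B (D + {#c#}) (D + {#a', b'#})"

end

theory Submission
  imports Defs "HOL-Library.Poly_Mapping"
begin

text \<open>Expanding \<open>v(\<nu>; p)\<close> in the basis of essential vectors of \<open>V(\<nu>)\<close> attaches to every essential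
  signature \<open>\<sigma>\<close> a coordinate function whose least exponent is \<open>\<sigma>\<close>. By the Leibniz rule for divided
  powers, convolution of coordinate functions describes the vectors generated by
  \<open>v\<^sub>\<kappa> \<otimes> v\<^sub>\<mu>\<close>. The Casimir operator shows that the submodule of \<open>V(\<kappa>) \<otimes> V(\<mu>)\<close> generated by this
  vector is \<open>V(\<kappa> + \<mu>)\<close>; hence the products of coordinate functions of weights \<open>\<kappa>\<close> and \<open>\<mu>\<close> span those of
  weight \<open>\<kappa> + \<mu>\<close>. The two hypotheses then make the coordinate functions of weights
  \<open>\<lambda>\<^sub>1, \<dots>, \<lambda>\<^sub>m\<close> a SAGBI basis: an admissible operation changes a monomial in them by a quadratic
  difference, which the hypothesis on \<open>\<lambda>\<^sub>i + \<lambda>\<^sub>j\<close> rewrites in monomials with larger leading exponent, and by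
  the connectedness hypothesis these differences account for all coincidences of leading exponents.\<close>

section \<open>Weight space decomposition\<close>

text \<open>The obstacle is finiteness. An essential vector is one outside the span of smaller
  exponents, so every rewriting moves upwards in the monomial order, where the order itself gives no
  bound. Termination comes from a second grading: the eigenvalue of \<open>reg\<close> assigns to
  every exponent a real degree \<open>deg\<close>. Root heights are positive, so each degree
  contains finitely many exponents, and products, expansions and rewritings are all homogeneous. The
  Casimir argument needs a singular vector to have nonnegative values on simple roots. This is read
  off from local nilpotency of the simple lowering vectors, which on the modules V(lambda) follows
  from irreducibility together with integrality of the highest weight and then passes to tensor
  products. The facts on roots used on the way (real positive norms, positivity of the sum of
  positive roots on simple roots, doubled roots not being roots) all come from one observation: a
  commutator lying in \<open>T\<close> has trace zero on any span of basis vectors stable under both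
  factors.\<close>

context vector_space
begin

text \<open>Applying \<open>f h\<close> and subtracting \<open>wt k h\<close> times the sum removes
  the component of index \<open>k\<close> and multiplies that of \<open>j\<close> by
  \<open>wt j h - wt k h\<close>, which some \<open>h\<close> makes nonzero; induction on
  \<open>X\<close> does the rest. The operator is abstract and additive only on \<open>V\<close>, so
  that the lemma serves the adjoint action, module actions and the grading by
  \<open>reg\<close>.\<close>

lemma weight_components_in_subspace:
  fixes f :: "'i \<Rightarrow> 'b \<Rightarrow> 'b" and wt :: "'j \<Rightarrow> 'i \<Rightarrow> 'a"
  assumes "finite X" "subspace V" "subspace K"
    and stable: "\<And>h u. h \<in> I \<Longrightarrow> u \<in> K \<Longrightarrow> f h u \<in> K"
    and additive: "\<And>h u v. h \<in> I \<Longrightarrow> u \<in> V \<Longrightarrow> v \<in> V \<Longrightarrow> f h (u + v) = f h u + f h v"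
    and homogeneous: "\<And>h c u. h \<in> I \<Longrightarrow> u \<in> V \<Longrightarrow> f h (scale c u) = scale c (f h u)"
    and distinct: "\<And>j k. j \<in> X \<Longrightarrow> k \<in> X \<Longrightarrow> j \<noteq> k \<Longrightarrow> \<exists>h\<in>I. wt j h \<noteq> wt k h"
    and weight: "\<And>j h. j \<in> X \<Longrightarrow> h \<in> I \<Longrightarrow> f h (u j) = scale (wt j h) (u j)"
    and carrier: "\<And>j. j \<in> X \<Longrightarrow> u j \<in> V"
    and "(\<Sum>j\<in>X. u j) \<in> K"
    and "j \<in> X"
  shows "u j \<in> K"
proof -
  have "\<forall>j\<in>X. u j \<in> K"
    using assms(1) distinct weight carrier assms(10)
  proof (induction X arbitrary: u rule: finite_induct)
    case empty
    then show ?case by simp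
  next
    case (insert k X)
    have V0: "0 \<in> V" using \<open>subspace V\<close> by (rule subspace_0)
    have f0: "f h 0 = 0" if "h \<in> I" for h
      using homogeneous[OF that V0, of 0] by simp
    have car: "\<And>i. i \<in> insert k X \<Longrightarrow> u i \<in> V" and wtu: "\<And>i h. i \<in> insert k X \<Longrightarrow> h \<in> I \<Longrightarrow> f h (u i) = scale (wt i h) (u i)"
      using insert.prems by blast+
    have f_sum: "f h (\<Sum>j\<in>Y. u j) = (\<Sum>j\<in>Y. scale (wt j h) (u j))"
      if "h \<in> I" "Y \<subseteq> insert k X" "finite Y" for h Y
      using that(3,2)
    proof (induction Y rule: finite_induct)
      case empty
      then show ?case using f0 that by simp
    next
      case (insert y Y)
      have "(\<Sum>j\<in>Y. u j) \<in> V"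
        using insert.prems car \<open>subspace V\<close> by (intro subspace_sum) auto
      moreover have "u y \<in> V" using insert.prems car by blast
      ultimately show ?case
        using insert wtu[of y h] that(1) by (auto simp: additive)
    qed
    have inK: "u j \<in> K" if j: "j \<in> X" for j
    proof -
      have "j \<noteq> k" using insert.hyps j by auto
      then obtain h where h: "h \<in> I" "wt j h \<noteq> wt k h"
        using insert.prems(1)[of j k] j by auto
      define u' where "u' i = scale (wt i h - wt k h) (u i)" for i
      let ?z = "\<Sum>i\<in>insert k X. u i"
      have "f h ?z - scale (wt k h) ?z = (\<Sum>i\<in>insert k X. u' i)"
        using f_sum[OF h(1) order_refl] insert.hyps(1)
        by (simp add: scale_sum_right sum_subtractf[symmetric] u'_def scale_left_diff_distrib)
      also have "\<dots> = (\<Sum>i\<in>X. u' i)"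
        using insert.hyps by (simp add: u'_def)
      finally have *: "(\<Sum>i\<in>X. u' i) \<in> K"
        using stable[OF h(1)] insert.prems(4) \<open>subspace K\<close>
        by (metis subspace_diff subspace_scale)
      have "\<forall>i\<in>X. u' i \<in> K"
      proof (rule insert.IH)
        show "\<And>i g. i \<in> X \<Longrightarrow> g \<in> I \<Longrightarrow> f g (u' i) = scale (wt i g) (u' i)"
          unfolding u'_def
          by (simp add: homogeneous insert.prems scale_left_commute mult.commute)
        show "\<And>i. i \<in> X \<Longrightarrow> u' i \<in> V"
          unfolding u'_def using \<open>subspace V\<close> insert.prems(3) by (simp add: subspace_scale)
        show "(\<Sum>i\<in>X. u' i) \<in> K" by (rule *)
      qed (use insert.prems(1) in auto)
      then have "scale (inverse (wt j h - wt k h)) (u' j) \<in> K"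
        using j \<open>subspace K\<close> by (simp add: subspace_scale)
      then show ?thesis using h by (simp add: u'_def)
    qed
    have "u k = (\<Sum>i\<in>insert k X. u i) - (\<Sum>i\<in>X. u i)"
      using insert.hyps by simp
    also have "\<dots> \<in> K"
      using insert.prems(4) \<open>subspace K\<close> by (intro subspace_diff[OF _ _ subspace_sum[OF _ inK]])
    finally show ?case using inK by auto
  qed
  then show ?thesis using assms(11) by blast
qed

lemma span_Union_subspaces_decompose:
  fixes E :: "'j \<Rightarrow> 'b set"
  assumes "x \<in> span (\<Union>j\<in>J. E j)" "\<And>j. j \<in> J \<Longrightarrow> subspace (E j)"
  obtains X u where "finite X" "X \<subseteq> J" "\<And>j. j \<in> X \<Longrightarrow> u j \<in> E j" "x = (\<Sum>j\<in>X. u j)"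
proof -
  have "\<exists>X u. finite X \<and> X \<subseteq> J \<and> (\<forall>j\<in>X. u j \<in> E j) \<and> x = (\<Sum>j\<in>X. u j)"
    using assms(1)
  proof (induction x rule: span_induct_alt)
    case base
    then show ?case by (intro exI[of _ "{}"]) auto
  next
    case (step c b y)
    then obtain X u j where *: "finite X" "X \<subseteq> J" "\<forall>j\<in>X. u j \<in> E j" "y = (\<Sum>j\<in>X. u j)"
      and j: "j \<in> J" "b \<in> E j" by blast
    define u' where "u' = u(j := scale c b + (if j \<in> X then u j else 0))"
    have "\<forall>i\<in>insert j X. u' i \<in> E i"
      using * j assms(2)[OF j(1)] unfolding u'_def by (auto intro!: subspace_add subspace_scale subspace_0)
    moreover have "scale c b + y = (\<Sum>i\<in>insert j X. u' i)"
    proof -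
      have "(\<Sum>i\<in>insert j X. u' i) = u' j + (\<Sum>i\<in>X - {j}. u i)"
        unfolding sum.insert_remove[OF *(1)] by (auto simp: u'_def intro!: sum.cong)
      also have "\<dots> = scale c b + y"
        unfolding u'_def *(4) using *(1) by (auto simp: sum.remove[of X j] add.assoc)
      finally show ?thesis by simp
    qed
    ultimately show ?case using * j
      by (intro exI[of _ "insert j X"] exI[of _ u']) auto
  qed
  with that show thesis by blast
qed

end

context complex_lie_algebra
begin

lemma bracket_zero_left [simp]: "bracket 0 x = 0"
  using bracket_scale_left[of 0 0 x] by simp

lemma bracket_zero_right [simp]: "bracket x 0 = 0"
  using bracket_scale_right[of x 0 0] by simp

lemma bracket_minus_right: "bracket x (- y) = - bracket x y"
  using bracket_scale_right[of x "-1" y] by simp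

lemma bracket_sum_right: "bracket x (sum g A) = (\<Sum>a\<in>A. bracket x (g a))"
  by (induction A rule: infinite_finite_induct) (auto simp: bracket_add_right)

lemma bracket_anticommute: "bracket x y = - bracket y x"
proof -
  have "bracket x y + bracket y x = bracket (x + y) (x + y)"
    unfolding bracket_add_left bracket_add_right by (simp add: bracket_self)
  also have "\<dots> = 0" by (rule bracket_self)
  finally have "bracket x y + bracket y x = 0" .
  then show ?thesis by (simp add: eq_neg_iff_add_eq_0)
qed

lemma bracket_derivation: "bracket x (bracket y z) = bracket (bracket x y) z + bracket y (bracket x z)"
proof -
  have "bracket x (bracket y z) + bracket y (bracket z x) + bracket z (bracket x y) = 0"
    by (rule jacobi)
  then show ?thesis
    using bracket_anticommute[of z x] bracket_anticommute[of z "bracket x y"]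
    by (simp add: bracket_minus_right algebra_simps add_eq_0_iff)
qed

lemma subspace_root_space: "subspace (root_space T \<chi>)"
  unfolding subspace_def root_space_def
  by (auto simp: bracket_add_right bracket_scale_right scale_right_distrib mult.commute)

lemma bracket_root_space:
  assumes "x \<in> root_space T \<chi>" "y \<in> root_space T \<psi>"
  shows "bracket x y \<in> root_space T (\<chi> + \<psi>)"
  using assms unfolding root_space_def
  by (auto simp: bracket_derivation[of _ x y] bracket_scale_left bracket_scale_right scale_left_distrib)

lemma dual_space_add: "\<chi> \<in> dual_space T \<Longrightarrow> \<psi> \<in> dual_space T \<Longrightarrow> \<chi> + \<psi> \<in> dual_space T"
  by (auto simp: dual_space_def algebra_simps)

lemma dual_space_minus: "\<chi> \<in> dual_space T \<Longrightarrow> - \<chi> \<in> dual_space T"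
  by (auto simp: dual_space_def algebra_simps)

lemma dual_space_diff: "\<chi> \<in> dual_space T \<Longrightarrow> \<psi> \<in> dual_space T \<Longrightarrow> \<chi> - \<psi> \<in> dual_space T"
  by (auto simp: dual_space_def algebra_simps)

lemma dual_space_zero: "0 \<in> dual_space T"
  by (auto simp: dual_space_def)

lemma dual_space_eqI:
  "\<chi> \<in> dual_space T \<Longrightarrow> \<psi> \<in> dual_space T \<Longrightarrow> (\<And>h. h \<in> T \<Longrightarrow> \<chi> h = \<psi> h) \<Longrightarrow> \<chi> = \<psi>"
  by (auto simp: dual_space_def fun_eq_iff) metis

lemma dual_space_scaleD: "\<chi> \<in> dual_space T \<Longrightarrow> h \<in> T \<Longrightarrow> \<chi> (c *s h) = c * \<chi> h"
  by (auto simp: dual_space_def)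

lemma dual_space_addD: "\<chi> \<in> dual_space T \<Longrightarrow> h \<in> T \<Longrightarrow> k \<in> T \<Longrightarrow> \<chi> (h + k) = \<chi> h + \<chi> k"
  by (auto simp: dual_space_def)

lemma dual_space_sumD:
  assumes "subspace T" "\<chi> \<in> dual_space T" "\<And>a. a \<in> A \<Longrightarrow> g a \<in> T"
  shows "\<chi> (sum g A) = (\<Sum>a\<in>A. \<chi> (g a))"
  using assms(3)
proof (induction A rule: infinite_finite_induct)
  case (insert a A)
  then have "sum g A \<in> T" by (auto intro: subspace_sum assms(1))
  then show ?case using insert assms(2) by (simp add: dual_space_addD)
qed (use dual_space_scaleD[OF assms(2) subspace_0[OF assms(1)], of 0] in auto)

end

text \<open>Only \<open>T\<close> and \<open>P\<close> are fixed, without numeration or modules, so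
  that the theory applies to every module, including the auxiliary one built from a tensor
  product.\<close>

locale cartan_data = simple_complex_lie_algebra scale bracket
  for scale :: "complex \<Rightarrow> 'g::ab_group_add \<Rightarrow> 'g"  (infixr \<open>*s\<close> 75)
    and bracket :: "'g \<Rightarrow> 'g \<Rightarrow> 'g" +
  fixes T :: "'g set" and P :: "('g \<Rightarrow> complex) set"
  assumes cartan: "cartan_subalgebra T" and positive: "positive_roots T P"
begin

lemma subspace_T: "subspace T" and bracket_T: "h \<in> T \<Longrightarrow> k \<in> T \<Longrightarrow> bracket h k = 0"
  using cartan by (auto simp: cartan_subalgebra_def abelian_subalgebra_def)

text \<open>Maximality of \<open>T\<close> among abelian subalgebras: a vector \<open>x\<close>
  commuting with \<open>T\<close> can be adjoined to it.\<close>

lemma root_space_zero: "root_space T 0 = T"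
proof
  show "T \<subseteq> root_space T 0" using bracket_T by (auto simp: root_space_def)
  show "root_space T 0 \<subseteq> T"
  proof
    fix x assume x: "x \<in> root_space T 0"
    let ?A = "{h + c *s x | h c. h \<in> T}"
    have xT: "bracket h x = 0" "bracket x h = 0" if "h \<in> T" for h
      using x that bracket_anticommute[of x h] by (auto simp: root_space_def)
    have "subspace ?A"
      unfolding subspace_def
    proof (intro conjI ballI allI)
      show "0 \<in> ?A" using subspace_0[OF subspace_T] by (auto intro!: exI[of _ 0])
      fix y z assume "y \<in> ?A" "z \<in> ?A"
      then obtain h c k d where "y = h + c *s x" "z = k + d *s x" "h \<in> T" "k \<in> T" by blast
      then show "y + z \<in> ?A"
        by (auto intro!: exI[of _ "h + k"] exI[of _ "c + d"] simp: algebra_simps subspace_add[OF subspace_T])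
    next
      fix c y assume "y \<in> ?A"
      then obtain h d where "y = h + d *s x" "h \<in> T" by blast
      then show "c *s y \<in> ?A"
        by (auto intro!: exI[of _ "c *s h"] exI[of _ "c * d"] simp: algebra_simps subspace_scale[OF subspace_T])
    qed
    then have "abelian_subalgebra ?A"
      by (auto simp: abelian_subalgebra_def bracket_add_left bracket_add_right bracket_scale_left
          bracket_scale_right bracket_T bracket_self xT)
    moreover have "T \<subseteq> ?A" by (force intro: exI[of _ 0])
    ultimately have "?A = T" using cartan by (auto simp: cartan_subalgebra_def)
    moreover have "x \<in> ?A" using subspace_0[OF subspace_T] by (auto intro!: exI[of _ 0] exI[of _ 1])
    ultimately show "x \<in> T" by simp
  qed
qed

text \<open>Simultaneous diagonalisation, one element at a time. A common eigenvector
  \<open>x\<close> for \<open>F\<close> is split along the eigenspaces of \<open>k\<close>. Since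
  \<open>bracket k\<close> commutes with \<open>bracket h\<close>, it preserves the eigenspace of
  \<open>h\<close> containing \<open>x\<close>, so the components of \<open>x\<close> stay in
  it.\<close>

lemma span_eigenvectors_finite:
  assumes "finite F" "F \<subseteq> T"
  shows "span {x. \<forall>h\<in>F. \<exists>c. bracket h x = c *s x} = UNIV"
  using assms
proof (induction F rule: finite_induct)
  case empty
  then show ?case by simp
next
  case (insert k F)
  have "x \<in> span {x. \<forall>h\<in>insert k F. \<exists>c. bracket h x = c *s x}"
    if x: "\<forall>h\<in>F. \<exists>c. bracket h x = c *s x" for x
  proof -
    from x obtain a where a: "\<And>h. h \<in> F \<Longrightarrow> bracket h x = a h *s x" by metis
    define E where "E c = {x. bracket k x = c *s x}" for c
    have "span {x. \<exists>c. bracket k x = c *s x} = UNIV"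
      using cartan insert.prems by (auto simp: cartan_subalgebra_def ad_diagonalizable_def)
    moreover have "{x. \<exists>c. bracket k x = c *s x} = (\<Union>c\<in>UNIV. E c)" by (auto simp: E_def)
    moreover have "subspace (E c)" for c
      by (auto simp: E_def subspace_def bracket_add_right bracket_scale_right algebra_simps)
    ultimately obtain X u where X: "finite X" "\<And>c. c \<in> X \<Longrightarrow> u c \<in> E c" "x = (\<Sum>c\<in>X. u c)"
      using span_Union_subspaces_decompose[where x = x and J = UNIV and E = E] by (metis UNIV_I)
    have "u c \<in> {z. bracket h z = a h *s z}" if c: "c \<in> X" and h: "h \<in> F" for c h
    proof (rule weight_components_in_subspace[where V = UNIV and X = X and I = "{k}" and f = bracket
            and wt = "\<lambda>c _. c" and u = u])
      show "subspace {z. bracket h z = a h *s z}"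
        by (auto simp: subspace_def bracket_add_right bracket_scale_right algebra_simps)
      show "bracket h' z \<in> {z. bracket h z = a h *s z}"
        if "h' \<in> {k}" "z \<in> {z. bracket h z = a h *s z}" for h' z
        using that insert.prems h bracket_derivation[of h k z] bracket_T[of h k]
        by (auto simp: bracket_scale_right)
      show "(\<Sum>c\<in>X. u c) \<in> {z. bracket h z = a h *s z}"
        using a[OF h] X by simp
    qed (use X c in \<open>auto simp: E_def bracket_add_right bracket_scale_right\<close>)
    then have "u c \<in> {x. \<forall>h\<in>insert k F. \<exists>c. bracket h x = c *s x}" if "c \<in> X" for c
      using that X(2)[OF that] by (auto simp: E_def)
    then show ?thesis unfolding X(3) by (intro span_sum span_base) auto
  qed
  then have "{x. \<forall>h\<in>F. \<exists>c. bracket h x = c *s x} \<subseteq> span {x. \<forall>h\<in>insert k F. \<exists>c. bracket h x = c *s x}"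
    by (intro subsetI) (elim CollectE)
  from span_minimal[OF this subspace_span] have "UNIV \<subseteq> span {x. \<forall>h\<in>insert k F. \<exists>c. bracket h x = c *s x}"
    using insert.IH insert.prems by blast
  then show ?case by (rule antisym[OF subset_UNIV])
qed

text \<open>Common eigenvectors of a finite basis \<open>F\<close> of \<open>T\<close> are
  eigenvectors of all of \<open>T\<close> by linearity of the bracket, and the eigenvalue depends
  linearly on the element of \<open>T\<close>.\<close>

lemma span_weight_vectors: "span (\<Union>\<chi>\<in>dual_space T. root_space T \<chi>) = UNIV"
proof -
  obtain B0 where B0: "finite B0" "span B0 = UNIV" using finite_dimensional by auto
  obtain F where F: "F \<subseteq> T" "independent F" "T \<subseteq> span F"
    using maximal_independent_subset by blast
  have "finite F" using independent_span_bound[OF B0(1) F(2)] B0(2) by auto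
  have T_eq: "span F = T"
    using span_minimal[OF F(1) subspace_T] F(3) by auto
  have "x \<in> (\<Union>\<chi>\<in>dual_space T. root_space T \<chi>)"
    if x: "\<forall>h\<in>F. \<exists>c. bracket h x = c *s x" for x
  proof (cases "x = 0")
    case True
    then show ?thesis using dual_space_zero subspace_0[OF subspace_root_space] by blast
  next
    case False
    have "\<exists>c. bracket h x = c *s x" if "h \<in> T" for h
      using that unfolding T_eq[symmetric]
    proof (induction h rule: span_induct_alt)
      case base
      then show ?case by (auto intro!: exI[of _ 0])
    next
      case (step c y z)
      then obtain d d' where "bracket y x = d *s x" "bracket z x = d' *s x" using x by blast
      then have "bracket (c *s y + z) x = (c * d + d') *s x"
        by (simp add: bracket_add_left bracket_scale_left scale_left_distrib)
      then show ?case by blast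
    qed
    then obtain c where c: "\<And>h. h \<in> T \<Longrightarrow> bracket h x = c h *s x" by metis
    \<comment> \<open>Extended by zero off \<open>T\<close>, as the convention of
      \<open>dual_space\<close> demands.\<close>
    define \<chi> where "\<chi> h = (if h \<in> T then c h else 0)" for h
    have \<chi>: "bracket h x = \<chi> h *s x" if "h \<in> T" for h using c that by (simp add: \<chi>_def)
    have cancel: "a = b" if "a *s x = b *s x" for a b using that False by simp
    have "\<chi> \<in> dual_space T"
      unfolding dual_space_def
    proof (intro CollectI conjI ballI allI impI)
      fix h k assume "h \<in> T" "k \<in> T"
      then have "\<chi> (h + k) *s x = (\<chi> h + \<chi> k) *s x"
        using \<chi>[of h] \<chi>[of k] \<chi>[of "h + k"] subspace_add[OF subspace_T, of h k] by (simp add: scale_left_distrib bracket_add_left)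
      then show "\<chi> (h + k) = \<chi> h + \<chi> k" by (rule cancel)
    next
      fix a h assume h: "h \<in> T"
      have "\<chi> (a *s h) *s x = bracket (a *s h) x"
        by (rule \<chi>[symmetric]) (rule subspace_scale[OF subspace_T h])
      also have "\<dots> = (a * \<chi> h) *s x" by (simp add: bracket_scale_left \<chi>[OF h])
      finally have "\<chi> (a *s h) *s x = (a * \<chi> h) *s x" .
      then show "\<chi> (a *s h) = a * \<chi> h" by (rule cancel)
    qed (simp add: \<chi>_def)
    moreover have "x \<in> root_space T \<chi>" using \<chi> by (auto simp: root_space_def)
    ultimately show ?thesis by blast
  qed
  then have "{x. \<forall>h\<in>F. \<exists>c. bracket h x = c *s x} \<subseteq> span (\<Union>\<chi>\<in>dual_space T. root_space T \<chi>)"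
    by (intro subsetI span_base) (elim CollectE)
  from span_minimal[OF this subspace_span] show ?thesis
    unfolding span_eigenvectors_finite[OF \<open>finite F\<close> F(1)] by (rule antisym[OF subset_UNIV])
qed

end


section \<open>Killing form\<close>

context cartan_data
begin

text \<open>Traces are computed over this basis, so roots enter every sum with the dimension of
  their root space as multiplicity.\<close>

definition weight_basis :: "'g set" where
  "weight_basis = (SOME B. B \<subseteq> (\<Union>\<chi>\<in>dual_space T. root_space T \<chi>) \<and> independent B \<and> span B = UNIV)"

lemma weight_basis_subset: "weight_basis \<subseteq> (\<Union>\<chi>\<in>dual_space T. root_space T \<chi>)"
  and independent_weight_basis: "independent weight_basis"
  and span_weight_basis: "span weight_basis = UNIV"
proof -
  let ?W = "\<Union>\<chi>\<in>dual_space T. root_space T \<chi>"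
  obtain B where "B \<subseteq> ?W" "independent B" "?W \<subseteq> span B"
    using maximal_independent_subset by blast
  moreover from this have "span B = UNIV"
    using span_minimal[of ?W "span B"] span_weight_vectors subspace_span by auto
  ultimately have "\<exists>B. B \<subseteq> ?W \<and> independent B \<and> span B = UNIV" by blast
  from someI_ex[OF this] show "weight_basis \<subseteq> ?W" "independent weight_basis" "span weight_basis = UNIV"
    unfolding weight_basis_def by blast+
qed

lemma finite_weight_basis: "finite weight_basis"
proof -
  obtain B where "finite B" "span B = UNIV" using finite_dimensional by auto
  with independent_span_bound[OF this(1) independent_weight_basis] show ?thesis by auto
qed

definition coord :: "'g \<Rightarrow> 'g \<Rightarrow> complex" where
  "coord x b = representation weight_basis x b"

lemma coord_add: "coord (x + y) b = coord x b + coord y b"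
  and coord_diff: "coord (x - y) b = coord x b - coord y b"
  and coord_minus: "coord (- x) b = - coord x b"
  and coord_scale: "coord (c *s x) b = c * coord x b"
  and coord_zero: "coord 0 b = 0"
  and coord_sum: "coord (sum g A) b = (\<Sum>a\<in>A. coord (g a) b)"
  unfolding coord_def
  using independent_weight_basis span_weight_basis
  by (simp_all add: representation_add representation_diff representation_neg representation_scale
      representation_zero representation_sum)

lemma coord_expand: "(\<Sum>b\<in>weight_basis. coord x b *s b) = x"
  unfolding coord_def
  by (rule sum_representation_eq) (auto simp: independent_weight_basis span_weight_basis finite_weight_basis)

lemma coord_basis: "b \<in> weight_basis \<Longrightarrow> coord b c = (if c = b then 1 else 0)"
  unfolding coord_def by (simp add: representation_basis independent_weight_basis)

lemma coord_eqI: "(\<And>b. b \<in> weight_basis \<Longrightarrow> coord x b = coord y b) \<Longrightarrow> x = y"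
  by (subst coord_expand[of x, symmetric], subst coord_expand[of y, symmetric]) (auto intro: sum.cong)

lemma coord_sum_basis:
  assumes "c \<in> weight_basis"
  shows "coord (\<Sum>b\<in>weight_basis. f b *s b) c = f c"
proof -
  have "coord (\<Sum>b\<in>weight_basis. f b *s b) c = (\<Sum>b\<in>weight_basis. if b = c then f b else 0)"
    unfolding coord_sum by (rule sum.cong) (auto simp: coord_scale coord_basis)
  then show ?thesis using assms finite_weight_basis by simp
qed

definition weight :: "'g \<Rightarrow> 'g \<Rightarrow> complex" where
  "weight b = (SOME \<chi>. \<chi> \<in> dual_space T \<and> b \<in> root_space T \<chi>)"

lemma weight_dual: "b \<in> weight_basis \<Longrightarrow> weight b \<in> dual_space T"
  and in_root_space_weight: "b \<in> weight_basis \<Longrightarrow> b \<in> root_space T (weight b)"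
proof -
  assume "b \<in> weight_basis"
  then have "\<exists>\<chi>. \<chi> \<in> dual_space T \<and> b \<in> root_space T \<chi>" using weight_basis_subset by blast
  from someI_ex[OF this] show "weight b \<in> dual_space T" "b \<in> root_space T (weight b)"
    unfolding weight_def by blast+
qed

lemma weight_basis_nonzero: "b \<in> weight_basis \<Longrightarrow> b \<noteq> 0"
  using independent_weight_basis dependent_zero by auto

lemma bracket_T_basis: "h \<in> T \<Longrightarrow> b \<in> weight_basis \<Longrightarrow> bracket h b = weight b h *s b"
  using in_root_space_weight by (auto simp: root_space_def)

text \<open>Compare the coefficients of \<open>b\<close> in \<open>bracket h x\<close>, computed
  once from the expansion of \<open>x\<close> and once from \<open>x\<close> being a weight
  vector.\<close>

lemma coord_root_space:
  assumes "x \<in> root_space T \<chi>" "\<chi> \<in> dual_space T" "b \<in> weight_basis" "coord x b \<noteq> 0"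
  shows "weight b = \<chi>"
proof (rule dual_space_eqI)
  fix h assume h: "h \<in> T"
  have "bracket h x = (\<Sum>b\<in>weight_basis. (coord x b * weight b h) *s b)"
    by (subst (1) coord_expand[of x, symmetric])
       (auto simp: bracket_sum_right bracket_scale_right bracket_T_basis h intro!: sum.cong)
  then have "coord (bracket h x) b = coord x b * weight b h"
    using coord_sum_basis[OF assms(3)] by simp
  moreover have "bracket h x = \<chi> h *s x" using assms(1) h by (auto simp: root_space_def)
  ultimately show "weight b h = \<chi> h" using assms(4) by (simp add: coord_scale)
qed (use assms weight_dual in auto)

lemma roots_dual: "\<beta> \<in> roots T \<Longrightarrow> \<beta> \<in> dual_space T" and roots_nonzero: "\<beta> \<in> roots T \<Longrightarrow> \<beta> \<noteq> 0"
  by (auto simp: roots_def)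

lemma weight_root: "b \<in> weight_basis \<Longrightarrow> weight b \<noteq> 0 \<Longrightarrow> weight b \<in> roots T"
  using weight_dual in_root_space_weight weight_basis_nonzero by (auto simp: roots_def)

lemma exists_basis_of_root_space:
  assumes "\<chi> \<in> dual_space T" "x \<in> root_space T \<chi>" "x \<noteq> 0"
  obtains b where "b \<in> weight_basis" "weight b = \<chi>"
proof -
  have "\<exists>b\<in>weight_basis. coord x b \<noteq> 0"
    using assms(3) coord_eqI[of x 0] by (auto simp: coord_zero)
  then show thesis using that coord_root_space[OF assms(2,1)] by blast
qed

lemma exists_basis_of_root:
  assumes "\<beta> \<in> roots T"
  obtains b where "b \<in> weight_basis" "weight b = \<beta>"
proof -
  have "\<exists>x\<in>root_space T \<beta>. x \<noteq> 0"
    using assms subspace_0[OF subspace_root_space, of T \<beta>] by (auto simp: roots_def)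
  then show thesis using exists_basis_of_root_space roots_dual[OF assms] that by blast
qed

lemma finite_roots: "finite (roots T)"
proof -
  have "roots T \<subseteq> weight ` weight_basis" using exists_basis_of_root by blast
  then show ?thesis using finite_weight_basis finite_subset by blast
qed

definition reg :: 'g where
  "reg = (SOME H. H \<in> T \<and> (\<forall>\<alpha>\<in>roots T. \<alpha> H \<in> \<real> \<and> \<alpha> H \<noteq> 0) \<and> P = {\<alpha> \<in> roots T. Re (\<alpha> H) > 0})"

lemma reg_T: "reg \<in> T" and roots_reg_real: "\<beta> \<in> roots T \<Longrightarrow> \<beta> reg \<in> \<real>"
  and roots_reg_nonzero: "\<beta> \<in> roots T \<Longrightarrow> \<beta> reg \<noteq> 0" and P_eq: "P = {\<alpha> \<in> roots T. Re (\<alpha> reg) > 0}"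
proof -
  have "\<exists>H. H \<in> T \<and> (\<forall>\<alpha>\<in>roots T. \<alpha> H \<in> \<real> \<and> \<alpha> H \<noteq> 0) \<and> P = {\<alpha> \<in> roots T. Re (\<alpha> H) > 0}"
    using positive by (auto simp: positive_roots_def)
  from someI_ex[OF this, folded reg_def]
  show "reg \<in> T" "\<beta> \<in> roots T \<Longrightarrow> \<beta> reg \<in> \<real>" "\<beta> \<in> roots T \<Longrightarrow> \<beta> reg \<noteq> 0"
    "P = {\<alpha> \<in> roots T. Re (\<alpha> reg) > 0}"
    by blast+
qed

text \<open>The additive real functional that separates positive from negative roots; it plays the
  role of the height in all descents.\<close>

definition ht :: "('g \<Rightarrow> complex) \<Rightarrow> real" where
  "ht \<chi> = Re (\<chi> reg)"

lemma ht_add: "ht (\<chi> + \<psi>) = ht \<chi> + ht \<psi>" and ht_minus: "ht (- \<chi>) = - ht \<chi>"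
  and ht_diff: "ht (\<chi> - \<psi>) = ht \<chi> - ht \<psi>" and ht_zero: "ht 0 = 0"
  by (auto simp: ht_def)

lemma ht_root_nonzero: "\<beta> \<in> roots T \<Longrightarrow> ht \<beta> \<noteq> 0"
  using roots_reg_real[of \<beta>] roots_reg_nonzero[of \<beta>] by (auto simp: ht_def complex_is_Real_iff complex_eq_iff)

lemma root_reg_eq_ht: "\<beta> \<in> roots T \<Longrightarrow> \<beta> reg = of_real (ht \<beta>)"
  using roots_reg_real[of \<beta>] by (simp add: ht_def complex_is_Real_iff complex_eq_iff)

lemma P_iff: "\<beta> \<in> P \<longleftrightarrow> \<beta> \<in> roots T \<and> ht \<beta> > 0"
  using P_eq by (auto simp: ht_def)

lemma finite_P: "finite P"
  using finite_roots P_iff by (metis finite_subset subsetI)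

section \<open>Trace form of the adjoint representation and its nondegeneracy\<close>

definition ad_entry :: "'g \<Rightarrow> 'g \<Rightarrow> 'g \<Rightarrow> complex" where
  "ad_entry x a c = coord (bracket x c) a"

lemma ad_entry_bracket:
  assumes "c \<in> weight_basis"
  shows "ad_entry (bracket x y) a c =
    (\<Sum>b\<in>weight_basis. ad_entry x a b * ad_entry y b c) - (\<Sum>b\<in>weight_basis. ad_entry y a b * ad_entry x b c)"
proof -
  have *: "coord (bracket u (bracket v c)) a = (\<Sum>b\<in>weight_basis. ad_entry u a b * ad_entry v b c)" for u v
    by (subst (1) coord_expand[of "bracket v c", symmetric])
       (simp add: bracket_sum_right bracket_scale_right coord_sum coord_scale ad_entry_def mult.commute)
  have "bracket (bracket x y) c = bracket x (bracket y c) - bracket y (bracket x c)"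
    by (simp add: bracket_derivation[of x y c])
  then show ?thesis by (simp add: ad_entry_def[of "bracket x y"] coord_diff *)
qed

definition killing :: "'g \<Rightarrow> 'g \<Rightarrow> complex" where
  "killing x y = (\<Sum>a\<in>weight_basis. \<Sum>c\<in>weight_basis. ad_entry x a c * ad_entry y c a)"

lemma killing_commute: "killing x y = killing y x"
  unfolding killing_def by (subst sum.swap) (simp add: mult.commute)

lemma killing_add_left: "killing (x + y) z = killing x z + killing y z"
  by (simp add: killing_def ad_entry_def bracket_add_left coord_add distrib_right sum.distrib)

lemma killing_scale_left: "killing (c *s x) z = c * killing x z"
  by (simp add: killing_def ad_entry_def bracket_scale_left coord_scale sum_distrib_left mult.assoc)

lemma killing_add_right: "killing z (x + y) = killing z x + killing z y"
  using killing_add_left killing_commute by metis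

lemma killing_scale_right: "killing z (c *s x) = c * killing z x"
  using killing_scale_left killing_commute by metis

lemma killing_zero_left: "killing 0 z = 0"
  using killing_scale_left[of 0 0 z] by simp

lemma killing_zero_right: "killing z 0 = 0"
  using killing_scale_right[of z 0 0] by simp

lemma killing_minus_left: "killing (- x) z = - killing x z"
  using killing_scale_left[of "-1" x z] by simp

lemma killing_diff_left: "killing (x - y) z = killing x z - killing y z"
  using killing_add_left[of x "- y" z] by (simp add: killing_minus_left)

lemma killing_sum_right: "killing z (sum g A) = (\<Sum>a\<in>A. killing z (g a))"
  by (induction A rule: infinite_finite_induct) (auto simp: killing_add_right killing_zero_right)

lemma killing_sum_left: "killing (sum g A) z = (\<Sum>a\<in>A. killing (g a) z)"
  by (induction A rule: infinite_finite_induct) (auto simp: killing_add_left killing_zero_left)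

text \<open>Both sides are differences of traces of triple products of adjoint matrices, and these
  traces are invariant under cyclic rotation of the factors.\<close>

lemma killing_invariant: "killing (bracket x y) z = killing x (bracket y z)"
proof -
  define tr where "tr X Y Z = (\<Sum>a\<in>weight_basis. \<Sum>b\<in>weight_basis. \<Sum>c\<in>weight_basis. X a b * Y b c * Z c a)"
    for X Y Z :: "'g \<Rightarrow> 'g \<Rightarrow> complex"
  have cyclic: "tr X Y Z = tr Y Z X" for X Y Z
  proof -
    have "tr X Y Z = (\<Sum>b\<in>weight_basis. \<Sum>a\<in>weight_basis. \<Sum>c\<in>weight_basis. X a b * Y b c * Z c a)"
      unfolding tr_def by (rule sum.swap)
    also have "\<dots> = (\<Sum>b\<in>weight_basis. \<Sum>c\<in>weight_basis. \<Sum>a\<in>weight_basis. X a b * Y b c * Z c a)"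
      by (rule sum.cong[OF refl]) (rule sum.swap)
    also have "\<dots> = tr Y Z X" unfolding tr_def by (intro sum.cong refl) (simp add: mult_ac)
    finally show ?thesis .
  qed
  have left: "killing (bracket x y) z = tr (ad_entry x) (ad_entry y) (ad_entry z) - tr (ad_entry y) (ad_entry x) (ad_entry z)" for x y z
  proof -
    have "killing (bracket x y) z = (\<Sum>a\<in>weight_basis. \<Sum>c\<in>weight_basis.
       (\<Sum>b\<in>weight_basis. ad_entry x a b * ad_entry y b c * ad_entry z c a)
        - (\<Sum>b\<in>weight_basis. ad_entry y a b * ad_entry x b c * ad_entry z c a))"
      unfolding killing_def
      by (intro sum.cong refl) (simp add: ad_entry_bracket left_diff_distrib sum_distrib_right)
    also have "\<dots> = (\<Sum>a\<in>weight_basis. \<Sum>b\<in>weight_basis. \<Sum>c\<in>weight_basis. ad_entry x a b * ad_entry y b c * ad_entry z c a)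
       - (\<Sum>a\<in>weight_basis. \<Sum>b\<in>weight_basis. \<Sum>c\<in>weight_basis. ad_entry y a b * ad_entry x b c * ad_entry z c a)"
      unfolding sum_subtractf
      by (intro arg_cong2[where f = minus] sum.cong refl sum.swap)
    finally show ?thesis by (simp add: tr_def)
  qed
  have "killing x (bracket y z) = killing (bracket y z) x" by (rule killing_commute)
  also have "\<dots> = tr (ad_entry y) (ad_entry z) (ad_entry x) - tr (ad_entry z) (ad_entry y) (ad_entry x)"
    by (rule left)
  also have "\<dots> = killing (bracket x y) z"
    unfolding left using cyclic by metis
  finally show ?thesis by simp
qed

lemma ad_entry_T:
  "h \<in> T \<Longrightarrow> c \<in> weight_basis \<Longrightarrow> ad_entry h a c = (if a = c then weight c h else 0)"
  by (simp add: ad_entry_def bracket_T_basis coord_scale coord_basis)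

lemma killing_T: "h \<in> T \<Longrightarrow> k \<in> T \<Longrightarrow> killing h k = (\<Sum>b\<in>weight_basis. weight b h * weight b k)"
  unfolding killing_def
  using finite_weight_basis
  by (intro sum.cong refl) (simp add: ad_entry_T if_distrib[of "\<lambda>z. z * _"] cong: if_cong)

lemma root_exists: "\<exists>b\<in>weight_basis. weight b \<noteq> 0"
proof (rule ccontr)
  assume "\<not> ?thesis"
  then have "weight_basis \<subseteq> T" using in_root_space_weight root_space_zero by fastforce
  then have "T = UNIV" using span_minimal[OF _ subspace_T] span_weight_basis by blast
  then show False using non_abelian bracket_T by auto
qed

text \<open>All weights take real values at \<open>reg\<close>, so the form is a sum of squares
  there, and some root contributes a nonzero one.\<close>

lemma killing_reg: "killing reg reg \<noteq> 0"
proof -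
  have real: "weight b reg = of_real (ht (weight b))" if "b \<in> weight_basis" for b
    using that weight_root root_reg_eq_ht by (cases "weight b = 0") (auto simp: ht_def)
  have "killing reg reg = (\<Sum>b\<in>weight_basis. of_real ((ht (weight b))\<^sup>2))"
    unfolding killing_T[OF reg_T reg_T] by (intro sum.cong refl) (simp add: real power2_eq_square)
  also have "\<dots> = of_real (\<Sum>b\<in>weight_basis. (ht (weight b))\<^sup>2)" by simp
  finally have *: "killing reg reg = of_real (\<Sum>b\<in>weight_basis. (ht (weight b))\<^sup>2)" .
  obtain b where b: "b \<in> weight_basis" "weight b \<noteq> 0" using root_exists by blast
  then have "ht (weight b) \<noteq> 0" using weight_root ht_root_nonzero by blast
  then have "(\<Sum>b\<in>weight_basis. (ht (weight b))\<^sup>2) > 0"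
    using b finite_weight_basis by (intro sum_pos2[of _ b]) auto
  then show ?thesis unfolding * by (simp only: of_real_eq_0_iff)
qed

text \<open>By invariance the radical of the form is an ideal; it does not contain
  \<open>reg\<close>, so simplicity leaves only zero.\<close>

lemma killing_nondegenerate:
  assumes "\<And>y. killing x y = 0"
  shows "x = 0"
proof -
  let ?I = "{x. \<forall>y. killing x y = 0}"
  have "lie_ideal ?I"
    unfolding lie_ideal_def subspace_def
  proof (intro conjI ballI allI)
    fix z x assume "x \<in> ?I"
    then have "killing (bracket z x) y = 0" for y
      using bracket_anticommute[of z x] by (simp add: killing_minus_left killing_invariant)
    then show "bracket z x \<in> ?I" by simp
  qed (auto simp: killing_zero_left killing_add_left killing_scale_left)
  moreover have "?I \<noteq> UNIV" using killing_reg by auto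
  ultimately have "?I = {0}" using no_proper_ideals by blast
  then show ?thesis using assms by blast
qed

lemma killing_nondegenerate_basis:
  assumes "\<And>b. b \<in> weight_basis \<Longrightarrow> killing x b = 0"
  shows "x = 0"
proof (rule killing_nondegenerate)
  fix y
  show "killing x y = 0"
    by (subst coord_expand[of y, symmetric]) (simp add: killing_sum_right killing_scale_right assms)
qed

section \<open>Dual basis and the identification of the dual of \<open>T\<close> with
  \<open>T\<close>\<close>

lemma dual_basis_exists:
  "\<exists>d. \<forall>b\<in>weight_basis. \<forall>c\<in>weight_basis. killing (d b) c = (if b = c then 1 else 0)"
proof -
  interpret fd: finite_dimensional_vector_space scale weight_basis
    by unfold_locales (auto simp: finite_weight_basis independent_weight_basis span_weight_basis)
  interpret fp: finite_dimensional_vector_space_pair scale weight_basis scale weight_basis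
    by unfold_locales
  \<comment> \<open>The coordinates of \<open>\<phi> x\<close> are the values of
    \<open>killing x\<close> on the basis. Nondegeneracy makes the map injective, hence surjective
    in finite dimension, and preimages of the basis vectors form the dual basis.\<close>
  define \<phi> where "\<phi> x = (\<Sum>b\<in>weight_basis. killing x b *s b)" for x
  have coord_\<phi>: "coord (\<phi> x) b = killing x b" if "b \<in> weight_basis" for x b
    unfolding \<phi>_def using that by (rule coord_sum_basis)
  have "Vector_Spaces.linear scale scale \<phi>"
    by unfold_locales
       (auto simp: \<phi>_def killing_add_left killing_scale_left scale_left_distrib sum.distrib scale_sum_right)
  moreover have "inj \<phi>"
  proof (rule injI)
    fix x y assume "\<phi> x = \<phi> y"
    then have "killing (x - y) b = 0" if "b \<in> weight_basis" for b
      using coord_\<phi>[OF that, of x] coord_\<phi>[OF that, of y] by (simp add: killing_diff_left)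
    then show "x = y" using killing_nondegenerate_basis[of "x - y"] by simp
  qed
  ultimately have "surj \<phi>" by (rule fp.linear_injective_imp_surjective) simp
  then have "killing (inv \<phi> b) c = coord b c" if "c \<in> weight_basis" for b c
    using coord_\<phi>[OF that, of "inv \<phi> b"] by (simp add: surj_f_inv_f)
  then show ?thesis by (intro exI[of _ "inv \<phi>"]) (auto simp: coord_basis)
qed

definition dual_vector :: "'g \<Rightarrow> 'g" where
  "dual_vector = (SOME d. \<forall>b\<in>weight_basis. \<forall>c\<in>weight_basis. killing (d b) c = (if b = c then 1 else 0))"

lemma killing_dual_vector:
  "b \<in> weight_basis \<Longrightarrow> c \<in> weight_basis \<Longrightarrow> killing (dual_vector b) c = (if b = c then 1 else 0)"
  using someI_ex[OF dual_basis_exists] unfolding dual_vector_def by blast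

lemma coord_eq_killing:
  assumes "b \<in> weight_basis"
  shows "coord x b = killing x (dual_vector b)"
proof -
  have "killing x (dual_vector b) = (\<Sum>c\<in>weight_basis. coord x c * killing c (dual_vector b))"
    by (subst coord_expand[of x, symmetric]) (simp add: killing_sum_left killing_scale_left)
  also have "\<dots> = (\<Sum>c\<in>weight_basis. if c = b then coord x c else 0)"
    using assms by (intro sum.cong refl) (auto simp: killing_dual_vector killing_commute[of _ "dual_vector b"])
  finally show ?thesis using assms finite_weight_basis by simp
qed

lemma dual_vector_expand: "(\<Sum>b\<in>weight_basis. killing x b *s dual_vector b) = x"
proof -
  have "(\<Sum>b\<in>weight_basis. killing x b *s dual_vector b) - x = 0"
  proof (rule killing_nondegenerate_basis)
    fix c assume c: "c \<in> weight_basis"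
    have "(\<Sum>b\<in>weight_basis. killing x b * killing (dual_vector b) c) = (\<Sum>b\<in>weight_basis. if b = c then killing x b else 0)"
      using c by (intro sum.cong refl) (auto simp: killing_dual_vector)
    then show "killing ((\<Sum>b\<in>weight_basis. killing x b *s dual_vector b) - x) c = 0"
      using c finite_weight_basis by (simp add: killing_diff_left killing_sum_left killing_scale_left)
  qed
  then show ?thesis by simp
qed

text \<open>By invariance both sides of the eigenvalue equation pair equally with every basis
  vector. Dual vectors being nonzero, negatives of roots are then roots.\<close>

lemma dual_vector_root_space:
  assumes b: "b \<in> weight_basis"
  shows "dual_vector b \<in> root_space T (- weight b)"
  unfolding root_space_def
proof (intro CollectI ballI)
  fix h assume h: "h \<in> T"
  have "bracket h (dual_vector b) + weight b h *s dual_vector b = 0"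
  proof (rule killing_nondegenerate_basis)
    fix c assume c: "c \<in> weight_basis"
    have "killing (bracket h (dual_vector b)) c = - killing (dual_vector b) (bracket h c)"
      using bracket_anticommute[of h "dual_vector b"] by (simp add: killing_minus_left killing_invariant)
    then show "killing (bracket h (dual_vector b) + weight b h *s dual_vector b) c = 0"
      using c b by (simp add: killing_add_left bracket_T_basis h killing_scale_right killing_scale_left killing_dual_vector)
  qed
  then show "bracket h (dual_vector b) = (- weight b) h *s dual_vector b"
    by (simp add: add_eq_0_iff2)
qed

lemma dual_vector_nonzero: "b \<in> weight_basis \<Longrightarrow> dual_vector b \<noteq> 0"
  using killing_dual_vector[of b b] by (auto simp: killing_zero_left)

lemma roots_minus:
  assumes "\<beta> \<in> roots T"
  shows "- \<beta> \<in> roots T"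
proof -
  obtain b where b: "b \<in> weight_basis" "weight b = \<beta>" using exists_basis_of_root[OF assms] .
  then show ?thesis
    using dual_vector_root_space[OF b(1)] dual_vector_nonzero[OF b(1)] roots_dual[OF assms] roots_nonzero[OF assms]
    by (auto simp: roots_def dual_space_minus)
qed

lemma roots_cases: "\<beta> \<in> roots T \<Longrightarrow> \<beta> \<in> P \<or> - \<beta> \<in> P"
  using ht_root_nonzero[of \<beta>] roots_minus[of \<beta>] by (auto simp: P_iff ht_minus)

lemma killing_root_spaces_orthogonal:
  assumes "x \<in> root_space T \<chi>" "y \<in> root_space T \<psi>" "\<chi> \<in> dual_space T" "\<psi> \<in> dual_space T" "\<chi> + \<psi> \<noteq> 0"
  shows "killing x y = 0"
proof -
  obtain h where h: "h \<in> T" "\<chi> h + \<psi> h \<noteq> 0"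
    using assms(5) dual_space_eqI[OF dual_space_add[OF assms(3,4)] dual_space_zero] by auto
  have "killing (bracket h x) y = - killing x (bracket h y)"
    using bracket_anticommute[of h x] by (simp add: killing_minus_left killing_invariant)
  then have "(\<chi> h + \<psi> h) * killing x y = 0"
    using assms(1,2) h by (simp add: root_space_def killing_scale_left killing_scale_right distrib_right)
  then show ?thesis using h by simp
qed

text \<open>An element of \<open>T\<close> is automatically orthogonal to the root spaces of nonzero
  weight, so orthogonality to \<open>T\<close> is orthogonality to everything.\<close>

lemma killing_T_nondegenerate:
  assumes "z \<in> T" "\<And>h. h \<in> T \<Longrightarrow> killing z h = 0"
  shows "z = 0"
proof (rule killing_nondegenerate_basis)
  fix b assume b: "b \<in> weight_basis"
  show "killing z b = 0"
  proof (cases "weight b = 0")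
    case True
    then show ?thesis using in_root_space_weight[OF b] root_space_zero assms(2) by simp
  next
    case False
    then show ?thesis
      using killing_root_spaces_orthogonal[of z 0 b "weight b"] in_root_space_weight[OF b] weight_dual[OF b]
        dual_space_zero root_space_zero assms(1) by simp
  qed
qed

text \<open>The element of \<open>T\<close> representing the functional \<open>\<chi>\<close> with respect to the Killing form.\<close>

definition tt :: "('g \<Rightarrow> complex) \<Rightarrow> 'g" where
  "tt \<chi> = (\<Sum>b\<in>{b\<in>weight_basis. weight b = 0}. \<chi> b *s dual_vector b)"

lemma tt_T: "tt \<chi> \<in> T"
  unfolding tt_def
proof (rule subspace_sum[OF subspace_T])
  fix b assume "b \<in> {b \<in> weight_basis. weight b = 0}"
  then have "dual_vector b \<in> T" using dual_vector_root_space[of b] root_space_zero by simp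
  then show "\<chi> b *s dual_vector b \<in> T" by (rule subspace_scale[OF subspace_T])
qed

lemma T_expand:
  assumes "h \<in> T"
  shows "(\<Sum>b\<in>{b\<in>weight_basis. weight b = 0}. coord h b *s b) = h"
proof -
  have "(\<Sum>b\<in>{b\<in>weight_basis. weight b = 0}. coord h b *s b) = (\<Sum>b\<in>weight_basis. coord h b *s b)"
    using coord_root_space[of h 0] assms finite_weight_basis root_space_zero dual_space_zero
    by (intro sum.mono_neutral_left) auto
  then show ?thesis by (simp add: coord_expand)
qed

lemma killing_tt:
  assumes "h \<in> T" "\<chi> \<in> dual_space T"
  shows "killing (tt \<chi>) h = \<chi> h"
proof -
  let ?Z = "{b\<in>weight_basis. weight b = 0}"
  have zero_T: "b \<in> T" if "b \<in> ?Z" for b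
    using in_root_space_weight[of b] root_space_zero that by simp
  have "killing (tt \<chi>) h = (\<Sum>b\<in>?Z. \<chi> b * killing (dual_vector b) h)"
    unfolding tt_def by (simp add: killing_sum_left killing_scale_left)
  also have "\<dots> = (\<Sum>b\<in>?Z. coord h b * \<chi> b)"
    by (intro sum.cong refl) (simp add: coord_eq_killing killing_commute mult.commute)
  also have "\<dots> = (\<Sum>b\<in>?Z. \<chi> (coord h b *s b))"
    using zero_T by (intro sum.cong refl) (simp add: dual_space_scaleD[OF assms(2)])
  also have "\<dots> = \<chi> (\<Sum>b\<in>?Z. coord h b *s b)"
    by (rule dual_space_sumD[OF subspace_T assms(2), symmetric]) (rule subspace_scale[OF subspace_T zero_T])
  finally show ?thesis using T_expand[OF assms(1)] by simp
qed

lemma tt_add: "tt (\<chi> + \<psi>) = tt \<chi> + tt \<psi>"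
  by (simp add: tt_def scale_left_distrib sum.distrib)

lemma tt_symmetric: "\<chi> \<in> dual_space T \<Longrightarrow> \<psi> \<in> dual_space T \<Longrightarrow> \<chi> (tt \<psi>) = \<psi> (tt \<chi>)"
  using killing_tt[OF tt_T] killing_commute by metis

text \<open>Both sides lie in \<open>T\<close> and pair equally with \<open>T\<close> by invariance,
  and the form is nondegenerate on \<open>T\<close>.\<close>

lemma bracket_opposite_root_spaces:
  assumes "x \<in> root_space T \<chi>" "y \<in> root_space T (- \<chi>)" "\<chi> \<in> dual_space T"
  shows "bracket x y = killing x y *s tt \<chi>"
proof -
  have "bracket x y \<in> T" using bracket_root_space[OF assms(1,2)] root_space_zero by simp
  moreover have "killing (bracket x y) h = killing x y * \<chi> h" if "h \<in> T" for h
  proof -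
    have "bracket y h = \<chi> h *s y"
      using assms(2) that bracket_anticommute[of y h] by (simp add: root_space_def)
    then show ?thesis by (simp add: killing_invariant killing_scale_right mult.commute)
  qed
  ultimately have "bracket x y - killing x y *s tt \<chi> = 0"
    using tt_T subspace_diff[OF subspace_T] subspace_scale[OF subspace_T]
    by (intro killing_T_nondegenerate) (auto simp: killing_diff_left killing_scale_left killing_tt assms(3))
  then show ?thesis by simp
qed

text \<open>The trace of a commutator on a stable subspace vanishes. A bracket lying in
  \<open>T\<close> acts diagonally, so this trace is the sum of the weights over \<open>A\<close>.
  The facts about weight strings, the sum of the positive roots and doubled roots come from
  different choices of \<open>A\<close>.\<close>

lemma trace_on_invariant_span:
  assumes T: "bracket x y \<in> T" and A: "A \<subseteq> weight_basis"
    and stable: "\<And>a b. a \<in> A \<Longrightarrow> b \<in> weight_basis - A \<Longrightarrow> ad_entry x b a = 0"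
      "\<And>a b. a \<in> A \<Longrightarrow> b \<in> weight_basis - A \<Longrightarrow> ad_entry y b a = 0"
  shows "(\<Sum>a\<in>A. weight a (bracket x y)) = 0"
proof -
  have "weight a (bracket x y) = (\<Sum>b\<in>A. ad_entry x a b * ad_entry y b a) - (\<Sum>b\<in>A. ad_entry y a b * ad_entry x b a)"
    if a: "a \<in> A" for a
  proof -
    have aw: "a \<in> weight_basis" using a A by auto
    have "weight a (bracket x y) = ad_entry (bracket x y) a a" using ad_entry_T[OF T aw] by simp
    also have "\<dots> = (\<Sum>b\<in>weight_basis. ad_entry x a b * ad_entry y b a) - (\<Sum>b\<in>weight_basis. ad_entry y a b * ad_entry x b a)"
      by (rule ad_entry_bracket[OF aw])
    also have "(\<Sum>b\<in>weight_basis. ad_entry x a b * ad_entry y b a) = (\<Sum>b\<in>A. ad_entry x a b * ad_entry y b a)"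
      by (rule sum.mono_neutral_right[OF finite_weight_basis A]) (simp add: stable a)
    also have "(\<Sum>b\<in>weight_basis. ad_entry y a b * ad_entry x b a) = (\<Sum>b\<in>A. ad_entry y a b * ad_entry x b a)"
      by (rule sum.mono_neutral_right[OF finite_weight_basis A]) (simp add: stable a)
    finally show ?thesis .
  qed
  then have "(\<Sum>a\<in>A. weight a (bracket x y)) =
     (\<Sum>a\<in>A. \<Sum>b\<in>A. ad_entry x a b * ad_entry y b a) - (\<Sum>a\<in>A. \<Sum>b\<in>A. ad_entry y a b * ad_entry x b a)"
    by (simp add: sum_subtractf)
  also have "(\<Sum>a\<in>A. \<Sum>b\<in>A. ad_entry y a b * ad_entry x b a) = (\<Sum>a\<in>A. \<Sum>b\<in>A. ad_entry x a b * ad_entry y b a)"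
    by (subst sum.swap) (simp add: mult.commute)
  finally show ?thesis by simp
qed

text \<open>Since \<open>x\<close> and \<open>y\<close> shift weights by \<open>\<beta>\<close> and
  \<open>-\<beta>\<close>, closure of \<open>A\<close> under these shifts of weights makes its span
  stable.\<close>

lemma trace_on_string:
  assumes x: "x \<in> root_space T \<beta>" and y: "y \<in> root_space T (- \<beta>)" and \<beta>: "\<beta> \<in> dual_space T"
    and A: "A \<subseteq> weight_basis"
    and closed: "\<And>a c. a \<in> A \<Longrightarrow> c \<in> weight_basis \<Longrightarrow> weight c = weight a + \<beta> \<or> weight c = weight a - \<beta> \<Longrightarrow> c \<in> A"
  shows "(\<Sum>a\<in>A. weight a (bracket x y)) = 0"
proof (rule trace_on_invariant_span[OF _ A])
  show "bracket x y \<in> T" using bracket_root_space[OF x y] root_space_zero by simp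
  fix a c assume a: "a \<in> A" and c: "c \<in> weight_basis - A"
  have aw: "a \<in> weight_basis" using a A by auto
  show "ad_entry x c a = 0"
  proof (rule ccontr)
    assume "ad_entry x c a \<noteq> 0"
    then have "weight c = \<beta> + weight a"
      using coord_root_space[of "bracket x a" "\<beta> + weight a" c] bracket_root_space[OF x in_root_space_weight[OF aw]]
        dual_space_add[OF \<beta> weight_dual[OF aw]] c unfolding ad_entry_def by blast
    then show False using closed[OF a, of c] c by (simp add: add.commute)
  qed
  show "ad_entry y c a = 0"
  proof (rule ccontr)
    assume "ad_entry y c a \<noteq> 0"
    then have "weight c = - \<beta> + weight a"
      using coord_root_space[of "bracket y a" "- \<beta> + weight a" c] bracket_root_space[OF y in_root_space_weight[OF aw]]
        dual_space_add[OF dual_space_minus[OF \<beta>] weight_dual[OF aw]] c unfolding ad_entry_def by blast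
    then show False using closed[OF a, of c] c by simp
  qed
qed

end


section \<open>Coroots and simple roots\<close>

context cartan_data
begin

lemma exists_dual_pair:
  assumes "\<beta> \<in> roots T"
  obtains x y where "x \<in> root_space T \<beta>" "y \<in> root_space T (- \<beta>)" "killing x y = 1"
proof -
  obtain b where b: "b \<in> weight_basis" "weight b = \<beta>" using exists_basis_of_root[OF assms] .
  then show thesis
    using that[of b "dual_vector b"] in_root_space_weight[OF b(1)] dual_vector_root_space[OF b(1)]
      killing_dual_vector[OF b(1) b(1)] killing_commute by simp
qed

lemma dual_pair_bracket:
  assumes "\<beta> \<in> roots T"
  obtains x y where "x \<in> root_space T \<beta>" "y \<in> root_space T (- \<beta>)" "bracket x y = tt \<beta>"
  using exists_dual_pair[OF assms] bracket_opposite_root_spaces roots_dual[OF assms]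
  by (metis scale_one)

text \<open>The basis vectors with weights \<open>weight b + k\<beta>\<close>, for integers
  \<open>k\<close>, span a subspace stable under both root vectors. Trace zero there makes
  \<open>weight b (tt \<beta>)\<close> a rational multiple of \<open>\<beta> (tt \<beta>)\<close>;
  the statement records that the factor is real.\<close>

lemma weight_string_ratio:
  assumes \<beta>: "\<beta> \<in> roots T" and b: "b \<in> weight_basis"
  shows "\<exists>q::real. weight b (tt \<beta>) = of_real q * \<beta> (tt \<beta>)"
proof -
  obtain x y where xy: "x \<in> root_space T \<beta>" "y \<in> root_space T (- \<beta>)" "bracket x y = tt \<beta>"
    using dual_pair_bracket[OF \<beta>] .
  define A where "A = {c\<in>weight_basis. \<exists>k::int. weight c = (\<lambda>h. weight b h + of_int k * \<beta> h)}"
  have "\<forall>a\<in>A. \<exists>k::int. weight a = (\<lambda>h. weight b h + of_int k * \<beta> h)" by (auto simp: A_def)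
  then obtain k where k: "\<And>a. a \<in> A \<Longrightarrow> weight a = (\<lambda>h. weight b h + of_int (k a) * \<beta> h)" by metis
  have fin: "finite A" using finite_weight_basis by (simp add: A_def)
  have "b \<in> A" using b by (auto simp: A_def intro!: exI[of _ 0])
  then have card: "card A > 0" using fin card_gt_0_iff by blast
  have "(\<Sum>a\<in>A. weight a (bracket x y)) = 0"
  proof (rule trace_on_string[OF xy(1,2) roots_dual[OF \<beta>]])
    fix a c assume a: "a \<in> A" "c \<in> weight_basis" "weight c = weight a + \<beta> \<or> weight c = weight a - \<beta>"
    from a(3) show "c \<in> A"
    proof
      assume "weight c = weight a + \<beta>"
      then have "weight c = (\<lambda>h. weight b h + of_int (k a + 1) * \<beta> h)"
        using k[OF a(1)] by (auto simp: fun_eq_iff algebra_simps)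
      then show ?thesis using a(2) unfolding A_def by blast
    next
      assume "weight c = weight a - \<beta>"
      then have "weight c = (\<lambda>h. weight b h + of_int (k a - 1) * \<beta> h)"
        using k[OF a(1)] by (auto simp: fun_eq_iff algebra_simps)
      then show ?thesis using a(2) unfolding A_def by blast
    qed
  qed (auto simp: A_def)
  moreover have "(\<Sum>a\<in>A. weight a (bracket x y)) = (\<Sum>a\<in>A. weight b (tt \<beta>) + of_int (k a) * \<beta> (tt \<beta>))"
    unfolding xy(3) by (intro sum.cong refl) (simp add: k)
  ultimately have "of_nat (card A) * weight b (tt \<beta>) = - (of_int (\<Sum>a\<in>A. k a) * \<beta> (tt \<beta>))"
    by (simp add: sum.distrib sum_distrib_right add_eq_0_iff2)
  then have "weight b (tt \<beta>) = of_real (- of_int (\<Sum>a\<in>A. k a) / of_nat (card A)) * \<beta> (tt \<beta>)"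
    using card by (simp add: field_simps)
  then show ?thesis by blast
qed

lemma tt_nonzero: "\<chi> \<in> dual_space T \<Longrightarrow> \<chi> \<noteq> 0 \<Longrightarrow> tt \<chi> \<noteq> 0"
  by (metis dual_space_eqI dual_space_zero killing_tt killing_zero_left zero_fun_apply)

text \<open>With the real ratios \<open>q b\<close> of weights to \<open>n\<close>, the norm
  \<open>n\<close> equals its own square times the sum of the squares of the \<open>q b\<close>. As
  \<open>n\<close> is nonzero, it is the inverse of that positive sum.\<close>

lemma root_norm_pos:
  assumes \<beta>: "\<beta> \<in> roots T"
  shows "\<exists>r>0. \<beta> (tt \<beta>) = complex_of_real r"
proof -
  define n where "n = \<beta> (tt \<beta>)"
  have "\<forall>b\<in>weight_basis. \<exists>q::real. weight b (tt \<beta>) = of_real q * n"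
    unfolding n_def using weight_string_ratio[OF \<beta>] by blast
  then obtain q :: "'g \<Rightarrow> real" where q: "\<And>b. b \<in> weight_basis \<Longrightarrow> weight b (tt \<beta>) = of_real (q b) * n"
    by metis
  \<comment> \<open>Otherwise all weights vanish at \<open>tt \<beta>\<close>, which would then be
    orthogonal to \<open>T\<close>.\<close>
  have "n \<noteq> 0"
  proof
    assume "n = 0"
    then have "killing (tt \<beta>) h = 0" if "h \<in> T" for h
      unfolding killing_T[OF tt_T that] by (simp add: q)
    then have "tt \<beta> = 0" using killing_T_nondegenerate tt_T by blast
    then show False using tt_nonzero roots_dual[OF \<beta>] roots_nonzero[OF \<beta>] by blast
  qed
  have "n = killing (tt \<beta>) (tt \<beta>)" unfolding n_def using killing_tt[OF tt_T roots_dual[OF \<beta>]] by simp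
  also have "\<dots> = (\<Sum>b\<in>weight_basis. n * (n * of_real ((q b)\<^sup>2)))"
    unfolding killing_T[OF tt_T tt_T] by (intro sum.cong refl) (simp add: q power2_eq_square)
  also have "\<dots> = n * (n * of_real (\<Sum>b\<in>weight_basis. (q b)\<^sup>2))"
    by (simp add: sum_distrib_left)
  finally have *: "n * of_real (\<Sum>b\<in>weight_basis. (q b)\<^sup>2) = 1" using \<open>n \<noteq> 0\<close> by simp
  define s where "s = (\<Sum>b\<in>weight_basis. (q b)\<^sup>2)"
  have "s \<noteq> 0" using * unfolding s_def[symmetric] by auto
  moreover have "s \<ge> 0" by (auto simp: s_def intro: sum_nonneg)
  moreover have "n = of_real (1 / s)" using * \<open>s \<noteq> 0\<close> unfolding s_def[symmetric] by (simp add: field_simps)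
  ultimately show ?thesis by (intro exI[of _ "1 / s"]) (auto simp: n_def)
qed

section \<open>Simple roots and the sum of the positive roots\<close>

definition simple_root :: "('g \<Rightarrow> complex) \<Rightarrow> bool" where
  "simple_root \<alpha> \<longleftrightarrow> \<alpha> \<in> P \<and> \<not> (\<exists>\<beta>\<in>P. \<exists>\<gamma>\<in>P. \<alpha> = \<beta> + \<gamma>)"

lemma P_roots: "\<beta> \<in> P \<Longrightarrow> \<beta> \<in> roots T" and P_ht: "\<beta> \<in> P \<Longrightarrow> ht \<beta> > 0" and P_dual: "\<beta> \<in> P \<Longrightarrow> \<beta> \<in> dual_space T"
  using P_iff roots_dual by blast+

text \<open>Both summands of a decomposable positive root have smaller height. Heights being real,
  the descent is made well-founded by counting the positive roots below.\<close>

lemma positive_root_induct [consumes 1, case_names simple add]: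
  assumes "\<beta> \<in> P"
    and simple: "\<And>\<alpha>. simple_root \<alpha> \<Longrightarrow> Q \<alpha>"
    and add: "\<And>\<beta> \<gamma>. \<beta> \<in> P \<Longrightarrow> \<gamma> \<in> P \<Longrightarrow> Q \<beta> \<Longrightarrow> Q \<gamma> \<Longrightarrow> Q (\<beta> + \<gamma>)"
  shows "Q \<beta>"
  using assms(1)
proof (induction "card {\<gamma>\<in>P. ht \<gamma> < ht \<beta>}" arbitrary: \<beta> rule: less_induct)
  case less
  show ?case
  proof (cases "simple_root \<beta>")
    case False
    then obtain \<gamma> \<delta> where *: "\<gamma> \<in> P" "\<delta> \<in> P" "\<beta> = \<gamma> + \<delta>"
      using less.prems by (auto simp: simple_root_def)
    have "card {\<epsilon>\<in>P. ht \<epsilon> < ht \<zeta>} < card {\<epsilon>\<in>P. ht \<epsilon> < ht \<beta>}" if "\<zeta> \<in> P" "ht \<zeta> < ht \<beta>" for \<zeta>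
      using that finite_P by (intro psubset_card_mono) auto
    then have "Q \<gamma>" "Q \<delta>" using less.hyps * P_ht by (auto simp: ht_add)
    then show ?thesis using add * by blast
  qed (rule simple)
qed

text \<open>Twice the Weyl vector: the sum of the positive roots, each counted with the dimension of
  its root space.\<close>

definition rho2 :: "'g \<Rightarrow> complex" where
  "rho2 = (\<Sum>b\<in>{b\<in>weight_basis. weight b \<in> P}. weight b)"

lemma sum_fun_apply: "(\<Sum>a\<in>A. f a) h = (\<Sum>a\<in>A. f a h)" for f :: "'i \<Rightarrow> 'j \<Rightarrow> complex"
  by (induction A rule: infinite_finite_induct) auto

lemma rho2_dual: "rho2 \<in> dual_space T"
proof -
  have "(\<Sum>b\<in>A. weight b) \<in> dual_space T" if "A \<subseteq> weight_basis" for A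
    using that by (induction A rule: infinite_finite_induct) (auto simp: dual_space_zero intro!: dual_space_add weight_dual)
  then show ?thesis by (auto simp: rho2_def)
qed

text \<open>Among the positive roots that are not multiples of \<open>\<alpha>\<close>, shifting by
  \<open>\<alpha>\<close> cannot lead to a negative root, since that would decompose the simple root
  \<open>\<alpha>\<close>. Their total therefore vanishes at \<open>tt \<alpha>\<close> by the trace
  argument, while the positive multiples of \<open>\<alpha>\<close> contribute positive
  numbers.\<close>

lemma rho2_simple_pos:
  assumes \<alpha>: "simple_root \<alpha>"
  shows "\<exists>r>0. rho2 (tt \<alpha>) = complex_of_real r"
proof -
  have \<alpha>P: "\<alpha> \<in> P" and \<alpha>R: "\<alpha> \<in> roots T" using \<alpha> P_roots by (auto simp: simple_root_def)
  obtain x y where xy: "x \<in> root_space T \<alpha>" "y \<in> root_space T (- \<alpha>)" "bracket x y = tt \<alpha>"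
    using dual_pair_bracket[OF \<alpha>R] .
  define mult where "mult \<chi> \<longleftrightarrow> (\<exists>c. \<chi> = (\<lambda>h. c * \<alpha> h))" for \<chi>
  define A where "A = {b\<in>weight_basis. weight b \<in> P \<and> \<not> mult (weight b)}"
  define C where "C = {b\<in>weight_basis. weight b \<in> P \<and> mult (weight b)}"
  have fin: "finite A" "finite C" using finite_weight_basis by (auto simp: A_def C_def)
  have mult_shift: "mult (\<chi> + \<alpha>)" "mult (\<chi> - \<alpha>)" if chi: "mult \<chi>" for \<chi>
  proof -
    obtain c where c: "\<chi> = (\<lambda>h. c * \<alpha> h)" using chi by (auto simp: mult_def)
    have "\<chi> + \<alpha> = (\<lambda>h. (c + 1) * \<alpha> h)" "\<chi> - \<alpha> = (\<lambda>h. (c - 1) * \<alpha> h)"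
      by (auto simp: c fun_eq_iff algebra_simps)
    then show "mult (\<chi> + \<alpha>)" "mult (\<chi> - \<alpha>)" unfolding mult_def by blast+
  qed
  have mult0: "mult 0" by (auto simp: mult_def fun_eq_iff intro!: exI[of _ 0])
  have A0: "(\<Sum>a\<in>A. weight a (bracket x y)) = 0"
  proof (rule trace_on_string[OF xy(1,2) roots_dual[OF \<alpha>R]])
    fix a c assume a: "a \<in> A" and c: "c \<in> weight_basis"
      and eq: "weight c = weight a + \<alpha> \<or> weight c = weight a - \<alpha>"
    have aP: "weight a \<in> P" and am: "\<not> mult (weight a)" using a by (auto simp: A_def)
    have cm: "\<not> mult (weight c)"
    proof
      assume m: "mult (weight c)"
      from eq have "weight a = weight c - \<alpha> \<or> weight a = weight c + \<alpha>" by auto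
      then show False using mult_shift[OF m] am by auto
    qed
    then have "weight c \<noteq> 0" using mult0 by auto
    then have cR: "weight c \<in> roots T" using weight_root c by blast
    have "weight c \<in> P"
    proof (rule ccontr)
      assume "weight c \<notin> P"
      then have neg: "- weight c \<in> P" using roots_cases[OF cR] by blast
      from eq show False
      proof
        assume "weight c = weight a + \<alpha>"
        then show False using P_ht[OF neg] P_ht[OF aP] P_ht[OF \<alpha>P] by (simp add: ht_minus ht_add ht_diff)
      next
        assume "weight c = weight a - \<alpha>"
        then have "\<alpha> = weight a + (- weight c)" by simp
        then show False using \<alpha> aP neg unfolding simple_root_def by blast
      qed
    qed
    then show "c \<in> A" using c cm by (simp add: A_def)
  qed (auto simp: A_def)
  obtain n where n: "n > 0" "\<alpha> (tt \<alpha>) = complex_of_real n" using root_norm_pos[OF \<alpha>R] by blast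
  \<comment> \<open>The complex scalar is identified as a ratio of heights by evaluating at
    \<open>reg\<close>, where roots take real values.\<close>
  have C_val: "weight b (tt \<alpha>) = of_real (ht (weight b) / ht \<alpha> * n)" if b: "b \<in> C" for b
  proof -
    obtain c where c: "weight b = (\<lambda>h. c * \<alpha> h)" using b by (auto simp: C_def mult_def)
    have "weight b \<in> roots T" using b P_roots by (auto simp: C_def)
    then have "of_real (ht (weight b)) = c * of_real (ht \<alpha>)"
      using root_reg_eq_ht[of "weight b"] root_reg_eq_ht[OF \<alpha>R] c by (metis)
    then have "c = of_real (ht (weight b) / ht \<alpha>)" using P_ht[OF \<alpha>P] by (simp add: field_simps)
    then show ?thesis by (subst c) (simp add: n)
  qed
  have "rho2 (tt \<alpha>) = (\<Sum>b\<in>A \<union> C. weight b (tt \<alpha>))"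
    unfolding rho2_def sum_fun_apply by (rule sum.cong) (auto simp: A_def C_def)
  also have "\<dots> = (\<Sum>b\<in>A. weight b (tt \<alpha>)) + (\<Sum>b\<in>C. weight b (tt \<alpha>))"
    using fin by (intro sum.union_disjoint) (auto simp: A_def C_def)
  also have "\<dots> = (\<Sum>b\<in>C. weight b (tt \<alpha>))" using A0 xy(3) by simp
  also have "\<dots> = of_real (\<Sum>b\<in>C. ht (weight b) / ht \<alpha> * n)" using C_val by simp
  finally have eq: "rho2 (tt \<alpha>) = of_real (\<Sum>b\<in>C. ht (weight b) / ht \<alpha> * n)" .
  obtain b where b: "b \<in> weight_basis" "weight b = \<alpha>" using exists_basis_of_root[OF \<alpha>R] .
  then have "b \<in> C" using \<alpha>P by (auto simp: C_def mult_def intro!: exI[of _ 1])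
  then have "(\<Sum>b\<in>C. ht (weight b) / ht \<alpha> * n) > 0"
    using fin n P_ht[OF \<alpha>P] b
    by (intro sum_pos2[of _ b]) (auto simp: C_def intro!: mult_nonneg_nonneg divide_nonneg_nonneg less_imp_le[OF P_ht])
  then show ?thesis using eq by blast
qed

text \<open>The brackets of opposite root vectors span the line of \<open>tt \<beta>\<close>, on
  which the normalisation singles out one point; the definite description is therefore
  meaningful.\<close>

lemma coroot_eq:
  assumes "\<beta> \<in> roots T"
  shows "coroot T \<beta> = (2 / \<beta> (tt \<beta>)) *s tt \<beta>"
proof -
  let ?S = "{bracket x y | x y. x \<in> root_space T \<beta> \<and> y \<in> root_space T (- \<beta>)}"
  have nz: "\<beta> (tt \<beta>) \<noteq> 0" using root_norm_pos[OF assms] by auto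
  have val: "\<beta> (c *s tt \<beta>) = c * \<beta> (tt \<beta>)" for c
    using dual_space_scaleD[OF roots_dual[OF assms] tt_T] .
  show ?thesis
    unfolding coroot_def
  proof (rule the_equality, intro conjI)
    obtain x y where "x \<in> root_space T \<beta>" "y \<in> root_space T (- \<beta>)" "bracket x y = tt \<beta>"
      using dual_pair_bracket[OF assms] .
    then have "tt \<beta> \<in> ?S" unfolding mem_Collect_eq by metis
    then show "(2 / \<beta> (tt \<beta>)) *s tt \<beta> \<in> span ?S" by (intro span_scale span_base)
    show "\<beta> ((2 / \<beta> (tt \<beta>)) *s tt \<beta>) = 2" using nz by (simp add: val)
  next
    fix h assume h: "h \<in> span ?S \<and> \<beta> h = 2"
    have "subspace (range (\<lambda>c. c *s tt \<beta>))"
      unfolding subspace_def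
    proof (intro conjI ballI allI)
      show "0 \<in> range (\<lambda>c. c *s tt \<beta>)" by (rule range_eqI[of _ _ 0]) simp
    qed (auto simp: scale_left_distrib[symmetric])
    moreover have "?S \<subseteq> range (\<lambda>c. c *s tt \<beta>)"
      using bracket_opposite_root_spaces[OF _ _ roots_dual[OF assms]] by auto
    ultimately have "h \<in> range (\<lambda>c. c *s tt \<beta>)" using h span_minimal by blast
    then obtain c where c: "h = c *s tt \<beta>" by blast
    then have "c = 2 / \<beta> (tt \<beta>)" using h nz by (simp add: val field_simps)
    then show "h = (2 / \<beta> (tt \<beta>)) *s tt \<beta>" using c by simp
  qed
qed

lemma dominant_weights_dual: "\<nu> \<in> dominant_weights T P \<Longrightarrow> \<nu> \<in> dual_space T"
  by (simp add: dominant_weights_def)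

lemma dominant_weights_add:
  "\<nu> \<in> dominant_weights T P \<Longrightarrow> \<mu> \<in> dominant_weights T P \<Longrightarrow> \<nu> + \<mu> \<in> dominant_weights T P"
  by (auto simp: dominant_weights_def dual_space_add)

text \<open>Dominance rewritten for the unnormalised element \<open>tt \<beta>\<close>; the factor
  one half comes from the value 2 of \<open>\<beta>\<close> on its coroot.\<close>

lemma dominant_weight_tt:
  assumes "\<nu> \<in> dominant_weights T P" "\<beta> \<in> P"
  shows "\<exists>n::nat. \<nu> (tt \<beta>) = of_nat n * \<beta> (tt \<beta>) / 2"
proof -
  have nz: "\<beta> (tt \<beta>) \<noteq> 0" using root_norm_pos[OF P_roots[OF assms(2)]] by auto
  have "\<nu> (coroot T \<beta>) \<in> \<nat>" using assms by (simp add: dominant_weights_def)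
  then obtain n where "\<nu> (coroot T \<beta>) = of_nat n" by (auto simp: Nats_def)
  then have "2 / \<beta> (tt \<beta>) * \<nu> (tt \<beta>) = of_nat n"
    using dual_space_scaleD[OF dominant_weights_dual[OF assms(1)] tt_T]
    by (simp add: coroot_eq[OF P_roots[OF assms(2)]])
  then show ?thesis using nz by (intro exI[of _ n]) (simp add: field_simps)
qed

end


section \<open>Modules and the Casimir operator\<close>

locale cartan_module = cartan_data scale bracket T P + lie_module scale bracket mscale V act
  for scale :: "complex \<Rightarrow> 'g::ab_group_add \<Rightarrow> 'g"  (infixr \<open>*s\<close> 75)
    and bracket :: "'g \<Rightarrow> 'g \<Rightarrow> 'g"
    and T :: "'g set" and P :: "('g \<Rightarrow> complex) set"
    and mscale :: "complex \<Rightarrow> 'v::ab_group_add \<Rightarrow> 'v"  (infixr \<open>*m\<close> 75)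
    and V :: "'v set" and act :: "'g \<Rightarrow> 'v \<Rightarrow> 'v"
begin

lemma V_add: "v \<in> V \<Longrightarrow> u \<in> V \<Longrightarrow> v + u \<in> V" and V_scale: "v \<in> V \<Longrightarrow> c *m v \<in> V" and V_zero: "0 \<in> V"
  and V_sum: "(\<And>i. i \<in> I \<Longrightarrow> g i \<in> V) \<Longrightarrow> sum g I \<in> V"
  using subspace_V by (auto intro: M.subspace_add M.subspace_scale M.subspace_0 M.subspace_sum)

lemma act_zero_right: "act x 0 = 0"
  using act_scale_right[OF V_zero, of x 0] by simp

lemma act_zero_left: "v \<in> V \<Longrightarrow> act 0 v = 0"
  using act_scale_left[of v 0 0] by simp

lemma act_sum_right: "(\<And>i. i \<in> I \<Longrightarrow> g i \<in> V) \<Longrightarrow> act x (sum g I) = (\<Sum>i\<in>I. act x (g i))"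
  by (induction I rule: infinite_finite_induct) (auto simp: act_zero_right act_add_right V_sum)

lemma act_sum_left: "v \<in> V \<Longrightarrow> act (sum g I) v = (\<Sum>i\<in>I. act (g i) v)"
  by (induction I rule: infinite_finite_induct) (auto simp: act_zero_left act_add_left)

lemma act_expand: "v \<in> V \<Longrightarrow> act x v = (\<Sum>b\<in>weight_basis. coord x b *m act b v)"
  by (subst coord_expand[of x, symmetric]) (simp add: act_sum_left act_scale_left)

lemma act_swap: "v \<in> V \<Longrightarrow> act x (act y v) = act y (act x v) + act (bracket x y) v"
  by (simp add: act_bracket)

lemma act_funpow_closed: "v \<in> V \<Longrightarrow> (act x ^^ n) v \<in> V"
  by (induction n) (auto intro: act_closed)

lemma act_funpow_zero: "(act x ^^ n) 0 = 0"
  by (induction n) (auto simp: act_zero_right)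

lemma act_funpow_add: "v \<in> V \<Longrightarrow> u \<in> V \<Longrightarrow> (act x ^^ n) (v + u) = (act x ^^ n) v + (act x ^^ n) u"
  by (induction n) (auto simp: act_add_right act_funpow_closed)

lemma act_funpow_scale: "v \<in> V \<Longrightarrow> (act x ^^ n) (c *m v) = c *m (act x ^^ n) v"
  by (induction n) (auto simp: act_scale_right act_funpow_closed)

lemma act_funpow_zero_mono:
  assumes "(act x ^^ n) v = 0" "n \<le> m"
  shows "(act x ^^ m) v = 0"
proof -
  have "(act x ^^ (m - n + n)) v = 0" unfolding funpow_add comp_apply assms(1) by (rule act_funpow_zero)
  then show ?thesis using assms(2) by simp
qed

section \<open>Weight spaces of a module\<close>

definition weight_space :: "('g \<Rightarrow> complex) \<Rightarrow> 'v set" where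
  "weight_space \<chi> = {v\<in>V. \<forall>h\<in>T. act h v = \<chi> h *m v}"

lemma weight_space_subset: "weight_space \<chi> \<subseteq> V"
  by (auto simp: weight_space_def)

lemma weight_spaceD: "v \<in> weight_space \<chi> \<Longrightarrow> h \<in> T \<Longrightarrow> act h v = \<chi> h *m v"
  by (auto simp: weight_space_def)

lemma subspace_weight_space: "M.subspace (weight_space \<chi>)"
  unfolding M.subspace_def weight_space_def
  by (auto simp: V_zero V_add V_scale act_zero_right act_add_right act_scale_right
      M.scale_right_distrib mult.commute)

lemma act_weight_space:
  assumes "x \<in> root_space T \<psi>" "v \<in> weight_space \<chi>"
  shows "act x v \<in> weight_space (\<chi> + \<psi>)"
proof -
  have v: "v \<in> V" using assms(2) weight_space_subset by auto
  have "act h (act x v) = (\<chi> + \<psi>) h *m act x v" if h: "h \<in> T" for h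
  proof -
    have "bracket h x = \<psi> h *s x" using assms(1) h by (simp add: root_space_def)
    then show ?thesis
      by (simp add: act_swap[OF v, of h x] weight_spaceD[OF assms(2) h] act_scale_right act_scale_left v
          M.scale_left_distrib)
  qed
  then show ?thesis using act_closed v by (simp add: weight_space_def)
qed

lemma weight_space_components:
  assumes "finite X" "X \<subseteq> dual_space T" "M.subspace K" "\<And>h v. h \<in> T \<Longrightarrow> v \<in> K \<Longrightarrow> act h v \<in> K"
    and "\<And>\<chi>. \<chi> \<in> X \<Longrightarrow> u \<chi> \<in> weight_space \<chi>" "(\<Sum>\<chi>\<in>X. u \<chi>) \<in> K" "\<chi> \<in> X"
  shows "u \<chi> \<in> K"
proof (rule M.weight_components_in_subspace[where f = act and I = T and wt = "\<lambda>\<chi>. \<chi>" and u = u, OF assms(1) subspace_V assms(3)])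
  fix \<chi> \<psi> assume "\<chi> \<in> X" "\<psi> \<in> X" "\<chi> \<noteq> \<psi>"
  then show "\<exists>h\<in>T. \<chi> h \<noteq> \<psi> h" using assms(2) dual_space_eqI by blast
next
  show "u \<psi> \<in> V" if "\<psi> \<in> X" for \<psi> using weight_space_subset assms(5)[OF that] by blast
qed (use assms weight_spaceD act_add_right act_scale_right in auto)

lemma weight_space_independent:
  assumes "finite X" "X \<subseteq> dual_space T" "\<And>\<chi>. \<chi> \<in> X \<Longrightarrow> u \<chi> \<in> weight_space \<chi>" "(\<Sum>\<chi>\<in>X. u \<chi>) = 0" "\<chi> \<in> X"
  shows "u \<chi> = 0"
  using weight_space_components[OF assms(1,2), of "{0}" u \<chi>] assms(3-5) by (auto simp: act_zero_right)

section \<open>Casimir operator\<close>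

definition casimir :: "'v \<Rightarrow> 'v" where
  "casimir v = (\<Sum>b\<in>weight_basis. act b (act (dual_vector b) v))"

text \<open>Commuting \<open>x\<close> through a summand brackets it with \<open>b\<close> or with
  the dual vector of \<open>b\<close>. Expanded in the basis and in the dual basis respectively, the
  two families have opposite coefficients by invariance of the form, so they cancel.\<close>

lemma casimir_commute:
  assumes v: "v \<in> V"
  shows "act x (casimir v) = casimir (act x v)"
proof -
  let ?B = "weight_basis"
  have "act x (act b (act (dual_vector b) v)) - act b (act (dual_vector b) (act x v)) =
        act (bracket x b) (act (dual_vector b) v) + act b (act (bracket x (dual_vector b)) v)" for b
  proof -
    have "act x (act b (act (dual_vector b) v)) =
        act b (act x (act (dual_vector b) v)) + act (bracket x b) (act (dual_vector b) v)"
      by (rule act_swap[OF act_closed[OF v]])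
    also have "act b (act x (act (dual_vector b) v)) =
        act b (act (dual_vector b) (act x v)) + act b (act (bracket x (dual_vector b)) v)"
      unfolding act_swap[OF v, of x "dual_vector b"] by (intro act_add_right act_closed v)
    finally show ?thesis by simp
  qed
  then have "act x (casimir v) - casimir (act x v) =
     (\<Sum>b\<in>?B. act (bracket x b) (act (dual_vector b) v)) + (\<Sum>b\<in>?B. act b (act (bracket x (dual_vector b)) v))"
    unfolding casimir_def by (simp add: act_sum_right act_closed v sum_subtractf[symmetric] sum.distrib)
  also have "(\<Sum>b\<in>?B. act (bracket x b) (act (dual_vector b) v)) =
     (\<Sum>b\<in>?B. \<Sum>c\<in>?B. killing (bracket x b) (dual_vector c) *m act c (act (dual_vector b) v))"
    by (intro sum.cong refl, subst act_expand) (auto intro!: sum.cong simp: act_closed v coord_eq_killing)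
  also have "(\<Sum>b\<in>?B. act b (act (bracket x (dual_vector b)) v)) =
     (\<Sum>b\<in>?B. \<Sum>c\<in>?B. killing (bracket x (dual_vector b)) c *m act b (act (dual_vector c) v))"
    by (intro sum.cong refl, subst dual_vector_expand[symmetric])
       (auto simp: act_sum_left act_scale_left act_sum_right act_scale_right v act_closed V_scale)
  also have "\<dots> = (\<Sum>c\<in>?B. \<Sum>b\<in>?B. killing (bracket x (dual_vector b)) c *m act b (act (dual_vector c) v))"
    by (rule sum.swap)
  also have "\<dots> = (\<Sum>b\<in>?B. \<Sum>c\<in>?B. - (killing (bracket x b) (dual_vector c) *m act c (act (dual_vector b) v)))"
  proof (intro sum.cong refl)
    fix b c
    have "killing (bracket x (dual_vector c)) b = - killing (bracket x b) (dual_vector c)"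
      using killing_invariant[of b x "dual_vector c"] bracket_anticommute[of b x]
      by (simp add: killing_minus_left killing_commute)
    then show "killing (bracket x (dual_vector c)) b *m act c (act (dual_vector b) v) =
       - (killing (bracket x b) (dual_vector c) *m act c (act (dual_vector b) v))" by simp
  qed
  finally show ?thesis by (simp add: sum_negf)
qed

lemma casimir_add: "v \<in> V \<Longrightarrow> u \<in> V \<Longrightarrow> casimir (v + u) = casimir v + casimir u"
  by (simp add: casimir_def act_add_right act_closed sum.distrib)

lemma casimir_scale: "v \<in> V \<Longrightarrow> casimir (c *m v) = c *m casimir v"
  by (simp add: casimir_def act_scale_right act_closed M.scale_sum_right)

text \<open>Basis vectors in \<open>T\<close> contribute the squared length of
  \<open>\<chi>\<close>. A positive root vector contributes its bracket with its dual vector, since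
  it kills \<open>v\<close> itself. A negative one contributes nothing, because its dual vector
  kills \<open>v\<close>. In classical notation the eigenvalue is
  \<open>(\<chi>, \<chi> + 2 rho)\<close>.\<close>

lemma casimir_singular:
  assumes v: "v \<in> weight_space \<chi>" and \<chi>: "\<chi> \<in> dual_space T"
    and sing: "\<And>\<beta> x. \<beta> \<in> P \<Longrightarrow> x \<in> root_space T \<beta> \<Longrightarrow> act x v = 0"
  shows "casimir v = (\<chi> (tt \<chi>) + rho2 (tt \<chi>)) *m v"
proof -
  have vV: "v \<in> V" using v weight_space_subset by auto
  define f where "f b = (if weight b = 0 then \<chi> b * \<chi> (dual_vector b) else if weight b \<in> P then weight b (tt \<chi>) else 0)" for b
  have "act b (act (dual_vector b) v) = f b *m v" if b: "b \<in> weight_basis" for b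
  proof -
    have bs: "b \<in> root_space T (weight b)" and ds: "dual_vector b \<in> root_space T (- weight b)"
      using in_root_space_weight[OF b] dual_vector_root_space[OF b] by auto
    consider "weight b = 0" | "weight b \<noteq> 0" "weight b \<in> P" | "weight b \<noteq> 0" "weight b \<notin> P" "- weight b \<in> P"
      using weight_root[OF b] roots_cases by blast
    then show ?thesis
    proof cases
      case 1
      then have "b \<in> T" "dual_vector b \<in> T" using bs ds root_space_zero by auto
      then show ?thesis using 1 by (simp add: f_def weight_spaceD[OF v] act_scale_right vV mult.commute)
    next
      case 2
      have br: "bracket b (dual_vector b) = tt (weight b)"
        using bracket_opposite_root_spaces[OF bs ds weight_dual[OF b]] killing_dual_vector[OF b b] killing_commute by simp
      have "act b (act (dual_vector b) v) = \<chi> (tt (weight b)) *m v"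
        using act_swap[OF vV, of b "dual_vector b"] sing[OF 2(2) bs]
        by (simp add: act_zero_right br weight_spaceD[OF v tt_T])
      then show ?thesis using 2 tt_symmetric[OF \<chi> weight_dual[OF b]] by (simp add: f_def)
    next
      case 3
      then show ?thesis using sing[OF 3(3) ds] by (simp add: f_def act_zero_right)
    qed
  qed
  then have "casimir v = (\<Sum>b\<in>weight_basis. f b) *m v"
    by (simp add: casimir_def M.scale_sum_left)
  \<comment> \<open>Zero is not in \<open>P\<close>, so the two cases of \<open>f\<close> do not
    overlap.\<close>
  also have "(\<Sum>b\<in>weight_basis. f b) = (\<Sum>b\<in>weight_basis. if weight b = 0 then \<chi> b * \<chi> (dual_vector b) else 0)
      + (\<Sum>b\<in>weight_basis. if weight b \<in> P then weight b (tt \<chi>) else 0)"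
    unfolding sum.distrib[symmetric] using P_ht[of 0] by (intro sum.cong refl) (auto simp: f_def ht_zero)
  also have "(\<Sum>b\<in>weight_basis. if weight b \<in> P then weight b (tt \<chi>) else 0) = rho2 (tt \<chi>)"
    unfolding rho2_def sum_fun_apply using finite_weight_basis by (simp add: sum.If_cases Int_def)
  also have "(\<Sum>b\<in>weight_basis. if weight b = 0 then \<chi> b * \<chi> (dual_vector b) else 0) =
     (\<Sum>b\<in>{b\<in>weight_basis. weight b = 0}. \<chi> (\<chi> b *s dual_vector b))"
  proof -
    have "dual_vector b \<in> T" if "b \<in> weight_basis" "weight b = 0" for b
      using dual_vector_root_space[OF that(1)] that(2) root_space_zero by simp
    then show ?thesis
      using finite_weight_basis by (simp add: sum.If_cases Int_def dual_space_scaleD[OF \<chi>])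
  qed
  also have "\<dots> = \<chi> (tt \<chi>)"
    unfolding tt_def
  proof (rule dual_space_sumD[OF subspace_T \<chi>, symmetric])
    fix b assume b: "b \<in> {b\<in>weight_basis. weight b = 0}"
    then have "dual_vector b \<in> T" using dual_vector_root_space[of b] root_space_zero by simp
    then show "\<chi> b *s dual_vector b \<in> T" by (rule subspace_scale[OF subspace_T])
  qed
  finally show ?thesis .
qed

text \<open>By the Leibniz rule every application of \<open>y\<close> to \<open>act x v\<close>
  turns \<open>x\<close> into \<open>bracket y x\<close> or \<open>v\<close> into
  \<open>act y v\<close>, so induction on \<open>k + m\<close> ends with one of them zero.\<close>

lemma nilpotent_action_step:
  assumes "v \<in> V" "((bracket y) ^^ k) x = 0" "(act y ^^ m) v = 0"
  shows "\<exists>n. (act y ^^ n) (act x v) = 0"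
  using assms
proof (induction "k + m" arbitrary: k m x v rule: less_induct)
  case less
  show ?case
  proof (cases "k = 0 \<or> m = 0")
    case True
    then have "act x v = 0" using less.prems by (auto simp: act_zero_left act_zero_right)
    then show ?thesis by (intro exI[of _ 0]) simp
  next
    case False
    then obtain k' m' where km: "k = Suc k'" "m = Suc m'" by (auto simp: not0_implies_Suc dest!: gr0_implies_Suc)
    obtain n1 where n1: "(act y ^^ n1) (act (bracket y x) v) = 0"
      using less.hyps[of k' m v "bracket y x"] less.prems by (auto simp: km funpow_swap1)
    obtain n2 where n2: "(act y ^^ n2) (act x (act y v)) = 0"
      using less.hyps[of k m' "act y v" x] less.prems act_closed by (auto simp: km funpow_swap1)
    have "(act y ^^ (n1 + n2)) (act (bracket y x) v + act x (act y v)) = 0"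
      using act_funpow_zero_mono[OF n1, of "n1 + n2"] act_funpow_zero_mono[OF n2, of "n1 + n2"] less.prems(1)
      by (simp add: act_funpow_add act_closed)
    moreover have "act y (act x v) = act (bracket y x) v + act x (act y v)"
      using act_swap[OF less.prems(1), of y x] by (simp add: add.commute)
    ultimately have "(act y ^^ Suc (n1 + n2)) (act x v) = 0"
      unfolding funpow_Suc_right comp_apply by simp
    then show ?thesis by blast
  qed
qed

text \<open>Otherwise the iterates would be nonzero vectors of the pairwise distinct weights
  \<open>weight b - k\<beta>\<close>, but only finitely many weights occur in the basis.\<close>

lemma negative_root_ad_nilpotent:
  assumes "\<beta> \<in> P" "y \<in> root_space T (- \<beta>)" "b \<in> weight_basis"
  shows "\<exists>k. ((bracket y) ^^ k) b = 0"
proof (rule ccontr)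
  assume "\<not> ?thesis"
  then have nz: "((bracket y) ^^ k) b \<noteq> 0" for k by blast
  define w where "w k = weight b - (\<lambda>h. of_nat k * \<beta> h)" for k :: nat
  have wS: "w (Suc k) = - \<beta> + w k" for k
  proof
    fix h show "w (Suc k) h = (- \<beta> + w k) h" by (simp add: w_def distrib_right)
  qed
  have *: "w k \<in> dual_space T \<and> ((bracket y) ^^ k) b \<in> root_space T (w k)" for k
  proof (induction k)
    case 0
    have "w 0 = weight b" by (rule ext) (simp add: w_def)
    then show ?case using weight_dual in_root_space_weight assms(3) by simp
  next
    case (Suc k)
    then show ?case unfolding wS funpow.simps comp_apply
      using bracket_root_space[OF assms(2)] dual_space_add[OF dual_space_minus[OF P_dual[OF assms(1)]]] by blast
  qed
  have "w k \<in> weight ` weight_basis" for k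
    using exists_basis_of_root_space[of "w k" "((bracket y) ^^ k) b"] *[of k] nz[of k] by (metis image_eqI)
  then have "range w \<subseteq> weight ` weight_basis" by blast
  then have "finite (range w)" using finite_weight_basis finite_subset by blast
  moreover have "inj w"
  proof (rule injI)
    fix i j assume "w i = w j"
    then have "ht (w i) = ht (w j)" by simp
    then have "real i * ht \<beta> = real j * ht \<beta>" by (simp add: w_def ht_def)
    then show "i = j" using P_ht[OF assms(1)] by simp
  qed
  ultimately show False using finite_imageD by blast
qed

text \<open>Nilpotency is checked for \<open>x\<close> in the weight basis, where iterated brackets
  with \<open>y\<close> eventually vanish. The lemma spreads local nilpotency from a generator to
  the module it generates.\<close>

lemma negative_root_nilpotent_act:
  assumes "\<beta> \<in> P" "y \<in> root_space T (- \<beta>)" "v \<in> V" "(act y ^^ m) v = 0"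
  shows "\<exists>n. (act y ^^ n) (act x v) = 0"
proof -
  have "\<forall>b\<in>weight_basis. \<exists>n. (act y ^^ n) (act b v) = 0"
    using negative_root_ad_nilpotent[OF assms(1,2)] nilpotent_action_step[OF assms(3) _ assms(4)] by blast
  then obtain n where n: "\<And>b. b \<in> weight_basis \<Longrightarrow> (act y ^^ n b) (act b v) = 0" by metis
  \<comment> \<open>The sum of the finitely many exponents bounds each of them.\<close>
  define N where "N = (\<Sum>b\<in>weight_basis. n b)"
  have "(act y ^^ N) (act b v) = 0" if b: "b \<in> weight_basis" for b
  proof -
    have "n b \<le> N" unfolding N_def using b finite_weight_basis by (intro member_le_sum) auto
    then show ?thesis using n[OF b] act_funpow_zero_mono by blast
  qed
  then have zero: "(act y ^^ N) (coord x b *m act b v) = 0" if "b \<in> weight_basis" for b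
    using that by (simp add: act_funpow_scale act_closed assms(3))
  have sumN: "(act y ^^ N) (sum g I) = (\<Sum>i\<in>I. (act y ^^ N) (g i))" if "\<And>i. i \<in> I \<Longrightarrow> g i \<in> V" for g :: "'g \<Rightarrow> 'v" and I
    using that by (induction I rule: infinite_finite_induct) (auto simp: act_funpow_zero act_funpow_add V_sum)
  have "(act y ^^ N) (act x v) = (\<Sum>b\<in>weight_basis. (act y ^^ N) (coord x b *m act b v))"
    unfolding act_expand[OF assms(3), of x] by (rule sumN) (intro V_scale act_closed assms(3))
  also have "\<dots> = 0" by (rule sum.neutral) (simp add: zero)
  finally show ?thesis by blast
qed

text \<open>The standard sl2 formula, with \<open>tt \<beta>\<close> in place of the coroot and an
  arbitrary factor \<open>c\<close> in the bracket. Each step adds the eigenvalue of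
  \<open>tt \<beta>\<close> on the current iterate; the one half comes from summing this arithmetic
  progression.\<close>

lemma sl2_lowering:
  assumes v: "v \<in> weight_space \<chi>" and x: "act x v = 0" and y: "y \<in> root_space T (- \<beta>)"
    and xy: "bracket x y = c *s tt \<beta>"
  shows "act x ((act y ^^ Suc k) v) = (c * of_nat (Suc k) * (\<chi> (tt \<beta>) - of_nat k * \<beta> (tt \<beta>) / 2)) *m (act y ^^ k) v"
proof -
  have vV: "v \<in> V" using v weight_space_subset by auto
  have wt: "(act y ^^ k) v \<in> weight_space (\<chi> - (\<lambda>h. of_nat k * \<beta> h))" for k
  proof (induction k)
    case 0
    have "\<chi> - (\<lambda>h. of_nat 0 * \<beta> h) = \<chi>" by (rule ext) simp
    then show ?case using v by simp
  next
    case (Suc k)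
    have "\<chi> - (\<lambda>h. of_nat (Suc k) * \<beta> h) = (\<chi> - (\<lambda>h. of_nat k * \<beta> h)) + - \<beta>"
      by (rule ext) (simp add: distrib_right)
    then show ?case using act_weight_space[OF y Suc] by (simp only: funpow.simps comp_apply)
  qed
  show ?thesis
  proof (induction k)
    case 0
    show ?case using act_swap[OF vV, of x y] x weight_spaceD[OF v tt_T]
      by (simp add: act_zero_right xy act_scale_left vV)
  next
    case (Suc k)
    let ?u = "(act y ^^ Suc k) v"
    have u: "?u \<in> V" using act_funpow_closed[OF vV] .
    have "act x (act y ?u) = act y (act x ?u) + c *m act (tt \<beta>) ?u"
      unfolding act_swap[OF u, of x y] xy act_scale_left[OF u] ..
    also have "act (tt \<beta>) ?u = (\<chi> (tt \<beta>) - of_nat (Suc k) * \<beta> (tt \<beta>)) *m ?u"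
      using weight_spaceD[OF wt[of "Suc k"] tt_T] by simp
    also have "act y (act x ?u) = (c * of_nat (Suc k) * (\<chi> (tt \<beta>) - of_nat k * \<beta> (tt \<beta>) / 2)) *m ?u"
      unfolding Suc.IH act_scale_right[OF act_funpow_closed[OF vV]] by simp
    finally have "act x (act y ?u) =
      (c * of_nat (Suc k) * (\<chi> (tt \<beta>) - of_nat k * \<beta> (tt \<beta>) / 2) + c * (\<chi> (tt \<beta>) - of_nat (Suc k) * \<beta> (tt \<beta>))) *m ?u"
      by (simp only: M.scale_left_distrib M.scale_scale)
    also have "c * of_nat (Suc k) * (\<chi> (tt \<beta>) - of_nat k * \<beta> (tt \<beta>) / 2) + c * (\<chi> (tt \<beta>) - of_nat (Suc k) * \<beta> (tt \<beta>))
       = c * of_nat (Suc (Suc k)) * (\<chi> (tt \<beta>) - of_nat (Suc k) * \<beta> (tt \<beta>) / 2)"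
      by (simp add: field_simps)
    finally show ?case by (simp only: funpow.simps comp_apply)
  qed
qed

text \<open>At the last nonzero iterate \<open>(act y ^^ k) v\<close> the coefficient in the sl2
  formula must vanish, so \<open>\<chi> (tt \<beta>)\<close> is \<open>k\<close> times half of the
  positive number \<open>\<beta> (tt \<beta>)\<close>.\<close>

lemma singular_weight_nonneg:
  assumes v: "v \<in> weight_space \<chi>" "v \<noteq> 0" and \<beta>: "\<beta> \<in> P"
    and sing: "\<And>x. x \<in> root_space T \<beta> \<Longrightarrow> act x v = 0"
    and nilp: "\<And>y. y \<in> root_space T (- \<beta>) \<Longrightarrow> \<exists>n. (act y ^^ n) v = 0"
  shows "\<exists>r\<ge>0. \<chi> (tt \<beta>) = complex_of_real r"
proof -
  obtain x y where xy: "x \<in> root_space T \<beta>" "y \<in> root_space T (- \<beta>)" "bracket x y = tt \<beta>"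
    using dual_pair_bracket[OF P_roots[OF \<beta>]] .
  obtain n where n: "(act y ^^ n) v = 0" "\<And>k. k < n \<Longrightarrow> (act y ^^ k) v \<noteq> 0"
    using exists_least_iff[of "\<lambda>n. (act y ^^ n) v = 0"] nilp[OF xy(2)] by blast
  have "n \<noteq> 0" using n(1) v(2) by (intro notI) simp
  then obtain k where k: "n = Suc k" using not0_implies_Suc by blast
  have "(of_nat (Suc k) * (\<chi> (tt \<beta>) - of_nat k * \<beta> (tt \<beta>) / 2)) *m (act y ^^ k) v = 0"
    using sl2_lowering[where c = 1 and k = k, OF v(1) sing[OF xy(1)] xy(2)] xy(3) n(1)
    unfolding k by (simp add: act_zero_right del: of_nat_Suc funpow.simps)
  then have "\<chi> (tt \<beta>) = of_nat k * \<beta> (tt \<beta>) / 2" using n(2)[of k] k by (simp del: of_nat_Suc)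
  moreover obtain r where "r > 0" "\<beta> (tt \<beta>) = complex_of_real r" using root_norm_pos[OF P_roots[OF \<beta>]] by blast
  ultimately show ?thesis by (intro exI[of _ "real k * r / 2"]) auto
qed

end


section \<open>Irreducibility of integrable highest weight modules\<close>

context cartan_module
begin

text \<open>The list of roots records by how much the weight has dropped.\<close>

inductive lowering_word :: "'v \<Rightarrow> ('g \<Rightarrow> complex) list \<Rightarrow> 'v \<Rightarrow> bool" for w where
  lowering_Nil: "lowering_word w [] w"
| lowering_Cons: "lowering_word w bs u \<Longrightarrow> \<beta> \<in> P \<Longrightarrow> y \<in> root_space T (- \<beta>) \<Longrightarrow>
    lowering_word w (\<beta> # bs) (act y u)"

definition lowering_span :: "'v \<Rightarrow> 'v set" where
  "lowering_span w = M.span {u. \<exists>bs. lowering_word w bs u}"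

lemma lowering_word_P: "lowering_word w bs u \<Longrightarrow> set bs \<subseteq> P"
  by (induction rule: lowering_word.induct) auto

lemma subspace_lowering_span: "M.subspace (lowering_span w)"
  by (simp add: lowering_span_def M.subspace_span)

lemma lowering_word_in_span: "lowering_word w bs u \<Longrightarrow> u \<in> lowering_span w"
  unfolding lowering_span_def by (rule M.span_base) blast

lemma generator_in_lowering_span: "w \<in> lowering_span w"
  using lowering_word_in_span lowering_Nil .

lemma sum_list_P_dual: "set bs \<subseteq> P \<Longrightarrow> sum_list bs \<in> dual_space T"
  by (induction bs) (auto simp: dual_space_zero intro!: dual_space_add intro: P_dual)

lemma sum_list_P_ht: "set bs \<subseteq> P \<Longrightarrow> ht (sum_list bs) \<ge> 0"
  by (induction bs) (auto simp: ht_zero ht_add intro!: add_nonneg_nonneg less_imp_le[OF P_ht])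

lemma sum_list_P_ht_pos: "set bs \<subseteq> P \<Longrightarrow> bs \<noteq> [] \<Longrightarrow> ht (sum_list bs) > 0"
  using sum_list_P_ht P_ht by (cases bs) (auto simp: ht_add intro!: add_pos_nonneg)

context
  fixes \<nu> :: "'g \<Rightarrow> complex" and w :: 'v
  assumes w_weight: "w \<in> weight_space \<nu>" and \<nu>_dual: "\<nu> \<in> dual_space T"
    and w_singular: "\<And>\<beta> x. \<beta> \<in> P \<Longrightarrow> x \<in> root_space T \<beta> \<Longrightarrow> act x w = 0"
begin

lemma w_V: "w \<in> V"
  using w_weight weight_space_subset by auto

lemma lowering_word_V: "lowering_word w bs u \<Longrightarrow> u \<in> V"
  by (induction rule: lowering_word.induct) (auto simp: w_V act_closed)

lemma lowering_span_V: "lowering_span w \<subseteq> V"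
  unfolding lowering_span_def by (rule M.span_minimal[OF _ subspace_V]) (auto simp: lowering_word_V)

lemma lowering_word_weight: "lowering_word w bs u \<Longrightarrow> u \<in> weight_space (\<nu> - sum_list bs)"
proof (induction rule: lowering_word.induct)
  case lowering_Nil
  then show ?case using w_weight by simp
next
  case (lowering_Cons bs u \<beta> y)
  have "\<nu> - sum_list (\<beta> # bs) = (\<nu> - sum_list bs) + - \<beta>" by simp
  then show ?case using act_weight_space[OF lowering_Cons(3,4)] by (simp only:)
qed

lemma linear_stable:
  assumes "M.subspace K" "K \<subseteq> V" "\<And>u bs. lowering_word w bs u \<Longrightarrow> act x u \<in> K" "u \<in> lowering_span w"
  shows "act x u \<in> K"
proof -
  have "M.subspace {u\<in>V. act x u \<in> K}"
    unfolding M.subspace_def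
    by (auto simp: V_zero V_add V_scale act_zero_right act_add_right act_scale_right
        intro: M.subspace_0[OF assms(1)] M.subspace_add[OF assms(1)] M.subspace_scale[OF assms(1)])
  then have "lowering_span w \<subseteq> {u\<in>V. act x u \<in> K}"
    unfolding lowering_span_def using assms(3) lowering_word_V by (intro M.span_minimal) auto
  then show ?thesis using assms(4) by blast
qed

lemma lowering_span_negative:
  assumes "\<beta> \<in> P" "y \<in> root_space T (- \<beta>)" "u \<in> lowering_span w"
  shows "act y u \<in> lowering_span w"
proof (rule linear_stable[OF subspace_lowering_span lowering_span_V _ assms(3)])
  fix u bs assume "lowering_word w bs u"
  then show "act y u \<in> lowering_span w" using lowering_word_in_span lowering_Cons assms by blast
qed

lemma act_from_basis:
  assumes "v \<in> V" "\<And>b. b \<in> weight_basis \<Longrightarrow> act b v \<in> lowering_span w"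
  shows "act x v \<in> lowering_span w"
  unfolding act_expand[OF assms(1), of x]
  by (intro M.subspace_sum[OF subspace_lowering_span] M.subspace_scale[OF subspace_lowering_span] assms)

lemma weight_basis_cases:
  assumes "b \<in> weight_basis"
  obtains "b \<in> T" | "weight b \<in> P" "b \<in> root_space T (weight b)" | \<beta> where "\<beta> \<in> P" "b \<in> root_space T (- \<beta>)"
proof (cases "weight b = 0")
  case True
  then show ?thesis using that in_root_space_weight[OF assms] root_space_zero by auto
next
  case False
  from roots_cases[OF weight_root[OF assms False]] show ?thesis
  proof
    assume "- weight b \<in> P"
    then show ?thesis using that(3)[of "- weight b"] in_root_space_weight[OF assms] by simp
  qed (use that in_root_space_weight[OF assms] in blast)
qed

text \<open>Moving \<open>x\<close> past the outer \<open>y\<close> leaves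
  \<open>bracket x y\<close> acting on the shorter word, which the induction covers because
  \<open>x\<close> is arbitrary.\<close>

lemma lowering_word_act: "lowering_word w bs u \<Longrightarrow> act x u \<in> lowering_span w"
proof (induction arbitrary: x rule: lowering_word.induct)
  case lowering_Nil
  show ?case
  proof (rule act_from_basis[OF w_V])
    fix b assume "b \<in> weight_basis"
    then show "act b w \<in> lowering_span w"
    proof (cases rule: weight_basis_cases)
      case 1
      then show ?thesis using weight_spaceD[OF w_weight]
        by (simp add: M.subspace_scale[OF subspace_lowering_span generator_in_lowering_span])
    next
      case 2
      then show ?thesis using w_singular M.subspace_0[OF subspace_lowering_span] by simp
    next
      case (3 \<beta>)
      then show ?thesis using lowering_span_negative generator_in_lowering_span by blast
    qed
  qed
next
  case (lowering_Cons bs u \<beta> y)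
  have u: "u \<in> V" using lowering_word_V lowering_Cons.hyps by blast
  show ?case
    unfolding act_swap[OF u, of x y]
    using lowering_Cons lowering_span_negative by (intro M.subspace_add[OF subspace_lowering_span]) auto
qed

lemma lowering_span_act: "u \<in> lowering_span w \<Longrightarrow> act x u \<in> lowering_span w"
  using linear_stable[OF subspace_lowering_span lowering_span_V] lowering_word_act by blast

lemma lowering_span_weights:
  assumes "u \<in> lowering_span w"
  obtains c X f where "finite X" "X \<subseteq> {\<nu> - sum_list bs | bs. set bs \<subseteq> P \<and> bs \<noteq> []}"
    "\<And>\<chi>. \<chi> \<in> X \<Longrightarrow> f \<chi> \<in> weight_space \<chi>" "u = c *m w + (\<Sum>\<chi>\<in>X. f \<chi>)"
proof -
  let ?J = "{\<nu> - sum_list bs | bs. set bs \<subseteq> P \<and> bs \<noteq> []}"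
  have "{u. \<exists>bs. lowering_word w bs u} \<subseteq> insert w (\<Union>\<chi>\<in>?J. weight_space \<chi>)"
  proof
    fix u assume "u \<in> {u. \<exists>bs. lowering_word w bs u}"
    then obtain bs where bs: "lowering_word w bs u" by blast
    show "u \<in> insert w (\<Union>\<chi>\<in>?J. weight_space \<chi>)"
    proof (cases "bs = []")
      case True
      then show ?thesis using bs by (auto elim: lowering_word.cases)
    next
      case False
      then show ?thesis using lowering_word_weight[OF bs] lowering_word_P[OF bs] by blast
    qed
  qed
  then have "u \<in> M.span (insert w (\<Union>\<chi>\<in>?J. weight_space \<chi>))"
    using assms M.span_mono unfolding lowering_span_def by blast
  then obtain c where c: "u - c *m w \<in> M.span (\<Union>\<chi>\<in>?J. weight_space \<chi>)"
    using M.span_breakdown_eq by blast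
  from M.span_Union_subspaces_decompose[OF c subspace_weight_space]
  obtain X f where "finite X" "X \<subseteq> ?J" "\<And>\<chi>. \<chi> \<in> X \<Longrightarrow> f \<chi> \<in> weight_space \<chi>" "u - c *m w = (\<Sum>\<chi>\<in>X. f \<chi>)"
    by blast
  then show thesis using that[of X f c] by (simp add: diff_eq_eq add.commute)
qed

lemma weight_vector_in_lowering_span:
  assumes u: "u \<in> lowering_span w" "u \<in> weight_space \<chi>" "u \<noteq> 0" and \<chi>: "\<chi> \<in> dual_space T"
  obtains c where "u = c *m w" | bs where "set bs \<subseteq> P" "bs \<noteq> []" "\<chi> = \<nu> - sum_list bs"
proof -
  obtain c X f where X: "finite X" "X \<subseteq> {\<nu> - sum_list bs | bs. set bs \<subseteq> P \<and> bs \<noteq> []}"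
    "\<And>\<psi>. \<psi> \<in> X \<Longrightarrow> f \<psi> \<in> weight_space \<psi>" "u = c *m w + (\<Sum>\<psi>\<in>X. f \<psi>)"
    by (rule lowering_span_weights[OF u(1)]) (rule that)
  show thesis
  proof (cases "\<chi> \<in> X")
    case True
    then show ?thesis using X(2) that by blast
  next
    case False
    have \<nu>X: "\<nu> \<notin> X"
    proof
      assume "\<nu> \<in> X"
      then obtain bs where bs: "set bs \<subseteq> P" "bs \<noteq> []" "\<nu> = \<nu> - sum_list bs" using X(2) by blast
      then have "ht \<nu> = ht \<nu> - ht (sum_list bs)" by (metis ht_diff)
      then show False using sum_list_P_ht_pos[OF bs(1,2)] by simp
    qed
    have Xd: "X \<subseteq> dual_space T" using X(2) dual_space_diff[OF \<nu>_dual] sum_list_P_dual by blast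
    have cw: "c *m w \<in> weight_space \<nu>" using w_weight M.subspace_scale[OF subspace_weight_space] by blast
    \<comment> \<open>The vector \<open>u\<close> minus its decomposition, collected by weight. The
      total is zero, so independence of the weight spaces annihilates the part of weight
      \<open>\<chi>\<close>.\<close>
    define g where "g \<psi> = (if \<psi> = \<chi> then u - (if \<chi> = \<nu> then c *m w else 0) else if \<psi> = \<nu> then - (c *m w) else - f \<psi>)" for \<psi>
    have "g \<chi> = 0"
    proof (rule weight_space_independent[where X = "insert \<chi> (insert \<nu> X)"])
      show "insert \<chi> (insert \<nu> X) \<subseteq> dual_space T" using Xd \<chi> \<nu>_dual by simp
      show "g \<psi> \<in> weight_space \<psi>" if "\<psi> \<in> insert \<chi> (insert \<nu> X)" for \<psi>
        using that u(2) cw X(3)[of \<psi>] unfolding g_def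
        by (auto intro: M.subspace_diff[OF subspace_weight_space] M.subspace_neg[OF subspace_weight_space])
      have "sum g X = (\<Sum>\<psi>\<in>X. - f \<psi>)"
        using False \<nu>X by (intro sum.cong refl) (auto simp: g_def)
      then show "sum g (insert \<chi> (insert \<nu> X)) = 0"
        using X(1,4) False \<nu>X by (cases "\<chi> = \<nu>") (auto simp: g_def sum_negf)
    qed (use X in auto)
    then have "u = (if \<chi> = \<nu> then c *m w else 0)" by (simp add: g_def)
    then show ?thesis using u(3) that(1)[of c] by (auto split: if_splits)
  qed
qed

text \<open>The operator commutes with the action, so its eigenvalue on \<open>w\<close> spreads to
  all words.\<close>

lemma casimir_lowering_span:
  assumes "u \<in> lowering_span w"
  shows "casimir u = (\<nu> (tt \<nu>) + rho2 (tt \<nu>)) *m u"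
proof -
  let ?c = "\<nu> (tt \<nu>) + rho2 (tt \<nu>)"
  have "casimir u = ?c *m u" if "lowering_word w bs u" for bs u
    using that
  proof (induction rule: lowering_word.induct)
    case lowering_Nil
    show ?case by (rule casimir_singular[OF w_weight \<nu>_dual w_singular])
  next
    case (lowering_Cons bs u \<beta> y)
    then have u: "u \<in> V" using lowering_word_V by blast
    show ?case unfolding casimir_commute[OF u, symmetric] lowering_Cons.IH act_scale_right[OF u] ..
  qed
  then have "{u. \<exists>bs. lowering_word w bs u} \<subseteq> {u\<in>V. casimir u = ?c *m u}"
    using lowering_word_V by blast
  moreover have "casimir 0 = 0" using casimir_scale[OF V_zero, of 0] by simp
  then have "M.subspace {u\<in>V. casimir u = ?c *m u}"
    unfolding M.subspace_def
    by (auto simp: V_zero V_add V_scale casimir_add casimir_scale M.scale_right_distrib mult.commute)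
  ultimately show ?thesis using assms M.span_minimal unfolding lowering_span_def by blast
qed

text \<open>A nonzero submodule missing \<open>w\<close> contains a singular vector of weight \<open>\<nu> - \<sigma>\<close>, where \<open>\<sigma>\<close> is a
  nonempty sum of positive roots. The Casimir operator has the same eigenvalue on it as on \<open>w\<close>,
  whereas dominance of both weights makes the eigenvalue at \<open>\<nu>\<close> strictly larger.\<close>

lemma integrable_lowering_span_irreducible:
  assumes nonneg: "\<And>\<alpha>. simple_root \<alpha> \<Longrightarrow> \<exists>r\<ge>0. \<nu> (tt \<alpha>) = complex_of_real r"
    and nilp: "\<And>\<alpha> y. simple_root \<alpha> \<Longrightarrow> y \<in> root_space T (- \<alpha>) \<Longrightarrow> \<exists>n. (act y ^^ n) w = 0"
    and K: "submodule K" "K \<subseteq> lowering_span w" "w \<notin> K"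
  shows "K = {0}"
proof (rule ccontr)
  assume "K \<noteq> {0}"
  have Ks: "M.subspace K" and Kact: "\<And>x u. u \<in> K \<Longrightarrow> act x u \<in> K" using K(1) by (auto simp: submodule_def)
  obtain u where u: "u \<in> K" "u \<noteq> 0" using \<open>K \<noteq> {0}\<close> M.subspace_0[OF Ks] by blast
  have weights: "\<exists>bs. set bs \<subseteq> P \<and> bs \<noteq> [] \<and> \<chi> = \<nu> - sum_list bs"
    if v: "v \<in> K" "v \<noteq> 0" "v \<in> weight_space \<chi>" "\<chi> \<in> dual_space T" for v \<chi>
  proof -
    have vU: "v \<in> lowering_span w" using v K by auto
    show ?thesis
    proof (cases rule: weight_vector_in_lowering_span[OF vU v(3,2,4)])
      case (1 c)
      then have "c \<noteq> 0" using v by auto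
      then have "w = inverse c *m v" using 1 by simp
      then show ?thesis using v(1) K(3) M.subspace_scale[OF Ks] by blast
    qed blast
  qed
  \<comment> \<open>The weight components of a vector of \<open>K\<close> lie in \<open>K\<close>,
    because \<open>K\<close> is stable under \<open>T\<close>.\<close>
  have "\<exists>v \<chi>. v \<in> K \<and> v \<noteq> 0 \<and> v \<in> weight_space \<chi> \<and> \<chi> \<in> dual_space T"
  proof -
    obtain c X f where X: "finite X" "X \<subseteq> {\<nu> - sum_list bs | bs. set bs \<subseteq> P \<and> bs \<noteq> []}"
      "\<And>\<psi>. \<psi> \<in> X \<Longrightarrow> f \<psi> \<in> weight_space \<psi>" "u = c *m w + (\<Sum>\<psi>\<in>X. f \<psi>)"
      by (rule lowering_span_weights[OF subsetD[OF K(2) u(1)]]) (rule that)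
    define g where "g \<psi> = (if \<psi> \<in> X then f \<psi> else 0) + (if \<psi> = \<nu> then c *m w else 0)" for \<psi>
    have Xd: "insert \<nu> X \<subseteq> dual_space T" using X(2) \<nu>_dual dual_space_diff[OF \<nu>_dual] sum_list_P_dual by blast
    have gw: "g \<psi> \<in> weight_space \<psi>" for \<psi>
      using X(3) w_weight unfolding g_def
      by (auto intro!: M.subspace_add[OF subspace_weight_space] M.subspace_0[OF subspace_weight_space]
          M.subspace_scale[OF subspace_weight_space])
    have "(\<Sum>\<psi>\<in>insert \<nu> X. g \<psi>) = (\<Sum>\<psi>\<in>insert \<nu> X. if \<psi> \<in> X then f \<psi> else 0) + (\<Sum>\<psi>\<in>insert \<nu> X. if \<psi> = \<nu> then c *m w else 0)"
      unfolding g_def by (rule sum.distrib)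
    also have "(\<Sum>\<psi>\<in>insert \<nu> X. if \<psi> = \<nu> then c *m w else 0) = c *m w" using X(1) by simp
    also have "(\<Sum>\<psi>\<in>insert \<nu> X. if \<psi> \<in> X then f \<psi> else 0) = (\<Sum>\<psi>\<in>X. f \<psi>)"
      using X(1) by (intro sum.mono_neutral_cong_right) auto
    finally have gsum: "(\<Sum>\<psi>\<in>insert \<nu> X. g \<psi>) = u" using X(4) by (simp add: add.commute)
    have gK: "g \<psi> \<in> K" if "\<psi> \<in> insert \<nu> X" for \<psi>
      using weight_space_components[where K = K and u = g, OF _ Xd Ks Kact gw _ that] gsum u(1) X(1) by simp
    have "\<exists>\<psi>\<in>insert \<nu> X. g \<psi> \<noteq> 0"
      using gsum u(2) sum.neutral[of "insert \<nu> X" g] by blast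
    then show ?thesis using gK gw Xd by blast
  qed
  then obtain v0 \<chi>0 where v0: "v0 \<in> K" "v0 \<noteq> 0" "v0 \<in> weight_space \<chi>0" "\<chi>0 \<in> dual_space T" by blast
  \<comment> \<open>A positive lower bound for the gain in height per raising step. Weights in
    \<open>K\<close> have height at most that of \<open>\<nu>\<close>, so raising must stop, and it
    stops at a singular vector.\<close>
  define \<delta> where "\<delta> = Min (ht ` P)"
  have Pne: "P \<noteq> {}" using root_exists weight_root roots_cases by blast
  have \<delta>: "\<delta> > 0" "\<And>\<beta>. \<beta> \<in> P \<Longrightarrow> \<delta> \<le> ht \<beta>" using finite_P Pne P_ht by (auto simp: \<delta>_def)
  have climb: "\<exists>v \<chi>. v \<in> K \<and> v \<noteq> 0 \<and> v \<in> weight_space \<chi> \<and> \<chi> \<in> dual_space T \<and>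
       (\<forall>\<beta>\<in>P. \<forall>x\<in>root_space T \<beta>. act x v = 0)"
    if "v \<in> K" "v \<noteq> 0" "v \<in> weight_space \<chi>" "\<chi> \<in> dual_space T" "ht \<nu> - ht \<chi> < real n * \<delta>" for n v \<chi>
    using that
  proof (induction n arbitrary: v \<chi>)
    case 0
    then obtain bs where "set bs \<subseteq> P" "\<chi> = \<nu> - sum_list bs" using weights by blast
    then have "ht \<chi> = ht \<nu> - ht (sum_list bs)" "ht (sum_list bs) \<ge> 0"
      using sum_list_P_ht[of bs] ht_diff by (auto simp del: minus_apply fun_diff_def)
    then show ?case using 0(5) by simp
  next
    case (Suc n)
    show ?case
    proof (cases "\<forall>\<beta>\<in>P. \<forall>x\<in>root_space T \<beta>. act x v = 0")
      case True
      then show ?thesis using Suc.prems by blast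
    next
      case False
      then obtain \<beta> x where bx: "\<beta> \<in> P" "x \<in> root_space T \<beta>" "act x v \<noteq> 0" by blast
      have "real (Suc n) * \<delta> = real n * \<delta> + \<delta>" by (simp add: distrib_right)
      then have "ht \<nu> - ht (\<chi> + \<beta>) < real n * \<delta>"
        using Suc.prems(5) \<delta>(2)[OF bx(1)] by (simp add: ht_add)
      then show ?thesis
        using Suc.IH[OF Kact[OF Suc.prems(1)] bx(3) act_weight_space[OF bx(2) Suc.prems(3)]
            dual_space_add[OF Suc.prems(4) P_dual[OF bx(1)]]] by blast
    qed
  qed
  obtain n :: nat where "ht \<nu> - ht \<chi>0 < real n * \<delta>" using reals_Archimedean3[OF \<delta>(1)] by blast
  from climb[OF v0 this] obtain v \<chi> where v: "v \<in> K" "v \<noteq> 0" "v \<in> weight_space \<chi>" "\<chi> \<in> dual_space T"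
    and vsing: "\<And>\<beta> x. \<beta> \<in> P \<Longrightarrow> x \<in> root_space T \<beta> \<Longrightarrow> act x v = 0" by blast
  obtain bs where bs: "set bs \<subseteq> P" "bs \<noteq> []" "\<chi> = \<nu> - sum_list bs" using weights[OF v] by blast
  define \<sigma> where "\<sigma> = sum_list bs"
  have \<sigma>d: "\<sigma> \<in> dual_space T" using sum_list_P_dual[OF bs(1)] by (simp add: \<sigma>_def)
  have \<nu>eq: "\<nu> = \<chi> + \<sigma>" using bs(3) by (simp add: \<sigma>_def)
  \<comment> \<open>Local nilpotency spreads from \<open>w\<close> to the whole submodule, in
    particular to \<open>v\<close>, whose weight is then nonnegative on simple roots.\<close>
  have nilpU: "\<exists>n. (act y ^^ n) z = 0" if a: "simple_root \<alpha>" and y: "y \<in> root_space T (- \<alpha>)" and z: "z \<in> lowering_span w" for \<alpha> y z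
  proof -
    have aP: "\<alpha> \<in> P" using a by (simp add: simple_root_def)
    have "lowering_word w cs z \<Longrightarrow> \<exists>n. (act y ^^ n) z = 0" for cs z
    proof (induction rule: lowering_word.induct)
      case lowering_Nil
      then show ?case by (rule nilp[OF a y])
    next
      case (lowering_Cons cs z \<beta> y')
      then show ?case using negative_root_nilpotent_act[OF aP y] lowering_word_V by blast
    qed
    then have "{u. \<exists>bs. lowering_word w bs u} \<subseteq> {z\<in>V. \<exists>n. (act y ^^ n) z = 0}"
      using lowering_word_V by blast
    moreover have "M.subspace {z\<in>V. \<exists>n. (act y ^^ n) z = 0}"
      unfolding M.subspace_def
    proof (intro conjI ballI allI)
      fix z z' assume "z \<in> {z\<in>V. \<exists>n. (act y ^^ n) z = 0}" "z' \<in> {z\<in>V. \<exists>n. (act y ^^ n) z = 0}"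
      then obtain n n' where nn: "z \<in> V" "z' \<in> V" "(act y ^^ n) z = 0" "(act y ^^ n') z' = 0" by blast
      have "(act y ^^ (n + n')) (z + z') = 0"
        using act_funpow_zero_mono[OF nn(3), of "n + n'"] act_funpow_zero_mono[OF nn(4), of "n + n'"]
        by (simp add: act_funpow_add nn)
      then show "z + z' \<in> {z\<in>V. \<exists>n. (act y ^^ n) z = 0}" using nn V_add by blast
    next
      fix c z assume "z \<in> {z\<in>V. \<exists>n. (act y ^^ n) z = 0}"
      then obtain n where "z \<in> V" "(act y ^^ n) z = 0" by blast
      then have "c *m z \<in> V" "(act y ^^ n) (c *m z) = 0" by (auto simp: V_scale act_funpow_scale)
      then show "c *m z \<in> {z\<in>V. \<exists>n. (act y ^^ n) z = 0}" by blast
    qed (auto simp: V_zero act_funpow_zero)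
    ultimately have "lowering_span w \<subseteq> {z\<in>V. \<exists>n. (act y ^^ n) z = 0}"
      unfolding lowering_span_def by (rule M.span_minimal)
    then show ?thesis using z by blast
  qed
  have \<chi>nonneg: "\<exists>r\<ge>0. \<chi> (tt \<alpha>) = complex_of_real r" if a: "simple_root \<alpha>" for \<alpha>
  proof (rule singular_weight_nonneg[OF v(3,2)])
    show "\<alpha> \<in> P" using a by (simp add: simple_root_def)
    then show "act x v = 0" if "x \<in> root_space T \<alpha>" for x using vsing that by blast
    show "\<exists>n. (act y ^^ n) v = 0" if "y \<in> root_space T (- \<alpha>)" for y
      using nilpU[OF a that] v(1) K(2) by blast
  qed
  \<comment> \<open>With \<open>\<nu> = \<chi> + \<sigma>\<close>, the Casimir eigenvalues at
    \<open>\<nu>\<close> and \<open>\<chi>\<close> differ by \<open>\<phi> (tt \<sigma>)\<close>.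
    Positivity of \<open>\<phi>\<close> on positive roots keeps this away from zero.\<close>
  define \<phi> where "\<phi> = \<nu> + \<chi> + rho2"
  have \<phi>d: "\<phi> \<in> dual_space T" unfolding \<phi>_def by (intro dual_space_add \<nu>_dual v(4) rho2_dual)
  have \<phi>pos: "\<exists>r>0. \<phi> (tt \<beta>) = complex_of_real r" if "\<beta> \<in> P" for \<beta>
    using that
  proof (induction rule: positive_root_induct)
    case (simple \<alpha>)
    obtain r1 r2 r3 where "r1 \<ge> 0" "\<nu> (tt \<alpha>) = complex_of_real r1" "r2 \<ge> 0" "\<chi> (tt \<alpha>) = complex_of_real r2"
      "r3 > 0" "rho2 (tt \<alpha>) = complex_of_real r3"
      using nonneg[OF simple] \<chi>nonneg[OF simple] rho2_simple_pos[OF simple] by blast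
    then show ?case by (intro exI[of _ "r1 + r2 + r3"]) (auto simp: \<phi>_def)
  next
    case (add \<beta> \<gamma>)
    then obtain r s where "r > 0" "\<phi> (tt \<beta>) = complex_of_real r" "s > 0" "\<phi> (tt \<gamma>) = complex_of_real s" by blast
    moreover from this have "\<phi> (tt (\<beta> + \<gamma>)) = complex_of_real (r + s)"
      unfolding tt_add dual_space_addD[OF \<phi>d tt_T tt_T] by simp
    moreover from calculation have "r + s > 0" by simp
    ultimately show ?case by blast
  qed
  have \<phi>0: "\<phi> 0 = 0" using dual_space_scaleD[OF \<phi>d subspace_0[OF subspace_T], of 0] by simp
  have sum_pos: "\<exists>r>0. \<phi> (tt (sum_list cs)) = complex_of_real r" if "set cs \<subseteq> P" "cs \<noteq> []" for cs
    using that
  proof (induction cs)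
    case (Cons \<beta> cs)
    obtain r where r: "r > 0" "\<phi> (tt \<beta>) = complex_of_real r" using \<phi>pos Cons.prems by auto
    show ?case
    proof (cases "cs = []")
      case True
      then show ?thesis using r by auto
    next
      case False
      then obtain s where "s > 0" "\<phi> (tt (sum_list cs)) = complex_of_real s" using Cons by auto
      moreover from this r have "\<phi> (tt (sum_list (\<beta> # cs))) = complex_of_real (r + s)"
        unfolding sum_list.Cons tt_add dual_space_addD[OF \<phi>d tt_T tt_T] by simp
      moreover from calculation r have "r + s > 0" by simp
      ultimately show ?thesis by blast
    qed
  qed simp
  have "(\<chi> (tt \<chi>) + rho2 (tt \<chi>)) *m v = (\<nu> (tt \<nu>) + rho2 (tt \<nu>)) *m v"
    using casimir_singular[OF v(3,4) vsing] casimir_lowering_span[of v] v(1) K(2) by auto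
  then have eq: "\<chi> (tt \<chi>) + rho2 (tt \<chi>) = \<nu> (tt \<nu>) + rho2 (tt \<nu>)" using v(2) by simp
  have "\<nu> (tt \<nu>) + rho2 (tt \<nu>) = \<chi> (tt \<chi>) + \<chi> (tt \<sigma>) + (\<sigma> (tt \<chi>) + \<sigma> (tt \<sigma>)) + (rho2 (tt \<chi>) + rho2 (tt \<sigma>))"
    unfolding \<nu>eq tt_add
    by (simp add: dual_space_addD[OF v(4) tt_T tt_T] dual_space_addD[OF \<sigma>d tt_T tt_T] dual_space_addD[OF rho2_dual tt_T tt_T])
  also have "\<sigma> (tt \<chi>) = \<chi> (tt \<sigma>)" by (rule tt_symmetric[OF \<sigma>d v(4)])
  finally have "\<chi> (tt \<chi>) + rho2 (tt \<chi>) =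
      \<chi> (tt \<chi>) + \<chi> (tt \<sigma>) + (\<chi> (tt \<sigma>) + \<sigma> (tt \<sigma>)) + (rho2 (tt \<chi>) + rho2 (tt \<sigma>))"
    unfolding eq .
  moreover have "\<phi> (tt \<sigma>) = \<chi> (tt \<sigma>) + \<sigma> (tt \<sigma>) + \<chi> (tt \<sigma>) + rho2 (tt \<sigma>)"
    by (simp add: \<phi>_def \<nu>eq)
  ultimately have "\<phi> (tt \<sigma>) = 0" by (simp add: add_ac)
  then show False using sum_pos[OF bs(1,2)] by (auto simp: \<sigma>_def)
qed

end

end


section \<open>Direct sums and tensor products\<close>

context cartan_data
begin

text \<open>The subspace spanned by a root vector \<open>y\<close> of root \<open>-\<alpha>\<close>, by \<open>T\<close> and by the root spaces of positive
  multiples of \<open>\<alpha>\<close> is stable under \<open>y\<close> and a dual root vector; a trace argument bounds its dimension.\<close>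

lemma twice_root_not_root:
  assumes \<alpha>: "\<alpha> \<in> P"
  shows "\<alpha> + \<alpha> \<notin> roots T"
proof
  assume \<alpha>2: "\<alpha> + \<alpha> \<in> roots T"
  have \<alpha>R: "\<alpha> \<in> roots T" using P_roots \<alpha> .
  \<comment> \<open>Taking one vector rather than the whole root space makes the negative
    contribution to the trace exactly \<open>- \<alpha> (tt \<alpha>)\<close>.\<close>
  obtain y where y: "y \<in> weight_basis" "weight y = - \<alpha>" using exists_basis_of_root[OF roots_minus[OF \<alpha>R]] .
  define x where "x = dual_vector y"
  have x: "x \<in> root_space T \<alpha>" using dual_vector_root_space[OF y(1)] y(2) by (simp add: x_def)
  have yr: "y \<in> root_space T (- \<alpha>)" using in_root_space_weight[OF y(1)] y(2) by simp
  have xy: "bracket x y = tt \<alpha>"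
    using bracket_opposite_root_spaces[OF x yr roots_dual[OF \<alpha>R]] killing_dual_vector[OF y(1) y(1)] by (simp add: x_def)
  define mult where "mult \<chi> k \<longleftrightarrow> (\<forall>h. \<chi> h = of_nat k * \<alpha> h)" for \<chi> and k :: nat
  \<comment> \<open>The multiple \<open>k = 0\<close> puts the basis vectors in \<open>T\<close>
    into \<open>C\<close>.\<close>
  define C where "C = {b\<in>weight_basis. \<exists>k. mult (weight b) k}"
  define A where "A = insert y C"
  have A: "A \<subseteq> weight_basis" using y by (auto simp: A_def C_def)
  have finC: "finite C" using finite_weight_basis by (simp add: C_def)
  have yC: "y \<notin> C"
  proof
    assume "y \<in> C"
    then obtain k where "mult (weight y) k" by (auto simp: C_def)
    then have "- \<alpha> reg = of_nat k * \<alpha> reg" using y(2) by (simp add: mult_def)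
    then have "- ht \<alpha> = of_nat k * ht \<alpha>" by (auto simp: ht_def dest: arg_cong[where f = Re])
    moreover have "of_nat k * ht \<alpha> \<ge> 0" using P_ht[OF \<alpha>] by simp
    ultimately show False using P_ht[OF \<alpha>] by linarith
  qed
  have "(\<Sum>a\<in>A. weight a (bracket x y)) = 0"
  proof (rule trace_on_invariant_span[OF _ A])
    show "bracket x y \<in> T" using xy tt_T by simp
    fix a b assume a: "a \<in> A" and b: "b \<in> weight_basis - A"
    have aw: "a \<in> weight_basis" using a A by auto
    show "ad_entry x b a = 0"
    proof (rule ccontr)
      assume "ad_entry x b a \<noteq> 0"
      then have eq: "weight b = \<alpha> + weight a"
        using coord_root_space[of "bracket x a" "\<alpha> + weight a" b] bracket_root_space[OF x in_root_space_weight[OF aw]]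
          dual_space_add[OF roots_dual[OF \<alpha>R] weight_dual[OF aw]] b unfolding ad_entry_def by blast
      have "\<exists>k. mult (weight b) k"
      proof (cases "a = y")
        case True
        then show ?thesis using eq y(2) by (intro exI[of _ 0]) (simp add: mult_def)
      next
        case False
        then obtain k where "mult (weight a) k" using a by (auto simp: A_def C_def)
        then show ?thesis using eq by (intro exI[of _ "Suc k"]) (simp add: mult_def distrib_right)
      qed
      then show False using b by (auto simp: A_def C_def)
    qed
    show "ad_entry y b a = 0"
    proof (rule ccontr)
      assume nz: "ad_entry y b a \<noteq> 0"
      then have eq: "weight b = - \<alpha> + weight a"
        using coord_root_space[of "bracket y a" "- \<alpha> + weight a" b] bracket_root_space[OF yr in_root_space_weight[OF aw]]
          dual_space_add[OF dual_space_minus[OF roots_dual[OF \<alpha>R]] weight_dual[OF aw]] b unfolding ad_entry_def by blast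
      have "a \<noteq> y" using nz by (auto simp: ad_entry_def bracket_self coord_zero)
      then obtain k where k: "mult (weight a) k" using a by (auto simp: A_def C_def)
      show False
      proof (cases k)
        case 0
        then have "weight a = 0" using k by (auto simp: mult_def fun_eq_iff)
        then have "a \<in> T" using in_root_space_weight[OF aw] root_space_zero by simp
        then have "bracket y a = - (weight y a *s y)" using bracket_anticommute[of y a] bracket_T_basis y(1) by simp
        then have "b = y" using nz coord_basis[OF y(1), of b] by (auto simp: ad_entry_def coord_minus coord_scale split: if_splits)
        then show False using b by (simp add: A_def)
      next
        case (Suc j)
        then have "mult (weight b) j" using k eq by (simp add: mult_def distrib_right)
        then show False using b by (auto simp: A_def C_def)
      qed
    qed
  qed
  then have zero: "- \<alpha> (tt \<alpha>) + (\<Sum>b\<in>C. weight b (tt \<alpha>)) = 0"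
    unfolding A_def xy using finC yC y(2) by simp
  obtain n where n: "n > 0" "\<alpha> (tt \<alpha>) = complex_of_real n" using root_norm_pos[OF \<alpha>R] by blast
  have "\<forall>b\<in>C. \<exists>k::nat. weight b (tt \<alpha>) = of_real (of_nat k * n)"
    by (auto simp: C_def mult_def n)
  then obtain k :: "'g \<Rightarrow> nat" where k: "\<And>b. b \<in> C \<Longrightarrow> weight b (tt \<alpha>) = of_real (of_nat (k b) * n)" by metis
  have "complex_of_real (- n + (\<Sum>b\<in>C. of_nat (k b) * n)) = 0"
    using zero by (simp add: n k)
  \<comment> \<open>The weights in \<open>C\<close> add up to exactly one copy of \<open>n\<close>,
    whereas a basis vector of weight \<open>2\<alpha>\<close> alone would contribute two.\<close>
  then have sum_n: "(\<Sum>b\<in>C. of_nat (k b) * n) = n" by (simp only: of_real_eq_0_iff)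
  obtain b where b: "b \<in> weight_basis" "weight b = \<alpha> + \<alpha>" using exists_basis_of_root[OF \<alpha>2] .
  have bC: "b \<in> C" using b by (auto simp: C_def mult_def intro!: exI[of _ 2])
  then have "complex_of_real (of_nat (k b) * n) = complex_of_real (2 * n)"
    using k[OF bC] b(2) n(2) by simp
  then have "of_nat (k b) * n = 2 * n" by (simp only: of_real_eq_iff)
  moreover have "of_nat (k b) * n \<le> (\<Sum>b\<in>C. of_nat (k b) * n)"
    using n(1) by (intro member_le_sum[OF bC] finC) auto
  ultimately show False using sum_n n(1) by linarith
qed

end

context cartan_module
begin

text \<open>The vector \<open>(act y ^^ Suc n) w\<close> is singular: along \<open>\<alpha>\<close>
  the sl2 coefficient vanishes by the choice of \<open>n\<close>, and along the other positive roots
  simplicity of \<open>\<alpha>\<close> gives it. If it were nonzero it would generate the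
  irreducible module, although \<open>w\<close> has larger weight.\<close>

lemma simple_lowering_vanishes:
  assumes irr: irreducible
    and w: "w \<in> weight_space \<nu>" and \<nu>: "\<nu> \<in> dual_space T" "w \<noteq> 0"
    and sing: "\<And>\<beta> x. \<beta> \<in> P \<Longrightarrow> x \<in> root_space T \<beta> \<Longrightarrow> act x w = 0"
    and \<alpha>: "simple_root \<alpha>" and n: "\<nu> (tt \<alpha>) = of_nat n * \<alpha> (tt \<alpha>) / 2" and y: "y \<in> root_space T (- \<alpha>)"
  shows "(act y ^^ Suc n) w = 0"
proof (rule ccontr)
  assume nz: "(act y ^^ Suc n) w \<noteq> 0"
  have \<alpha>P: "\<alpha> \<in> P" using \<alpha> by (simp add: simple_root_def)
  have wV: "w \<in> V" using w weight_space_subset by auto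
  have other: "act x ((act y ^^ k) w) = 0" if "\<gamma> \<in> P" "\<gamma> \<noteq> \<alpha>" "x \<in> root_space T \<gamma>" for \<gamma> x k
    using that
  proof (induction k arbitrary: \<gamma> x)
    case 0
    then show ?case using sing by simp
  next
    case (Suc k)
    let ?u = "(act y ^^ k) w"
    have u: "?u \<in> V" by (rule act_funpow_closed[OF wV])
    have "act (bracket x y) ?u = 0"
    proof (cases "bracket x y = 0")
      case True
      then show ?thesis using act_zero_left[OF u] by simp
    next
      case False
      have br: "bracket x y \<in> root_space T (\<gamma> - \<alpha>)" using bracket_root_space[OF Suc.prems(3) y] by simp
      have root: "\<gamma> - \<alpha> \<in> roots T"
        using False br Suc.prems(2) dual_space_diff[OF P_dual[OF Suc.prems(1)] P_dual[OF \<alpha>P]]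
        unfolding roots_def by auto
      from roots_cases[OF root] show ?thesis
      proof
        assume "\<gamma> - \<alpha> \<in> P"
        \<comment> \<open>The induction hypothesis excludes \<open>\<alpha>\<close> itself, so
          \<open>\<gamma> = 2\<alpha>\<close> has to be ruled out.\<close>
        moreover have "\<gamma> - \<alpha> \<noteq> \<alpha>"
        proof
          assume "\<gamma> - \<alpha> = \<alpha>"
          then have "\<gamma> = \<alpha> + \<alpha>" by (simp add: diff_eq_eq)
          then show False using twice_root_not_root[OF \<alpha>P] P_roots[OF Suc.prems(1)] by metis
        qed
        ultimately show ?thesis using Suc.IH br by blast
      next
        assume "- (\<gamma> - \<alpha>) \<in> P"
        moreover have "\<alpha> = \<gamma> + - (\<gamma> - \<alpha>)" by simp
        ultimately show ?thesis using \<alpha> Suc.prems(1) unfolding simple_root_def by blast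
      qed
    qed
    then show ?case
      using act_swap[OF u, of x y] Suc.IH[OF Suc.prems] by (simp add: act_zero_right)
  qed
  define s where "s = (act y ^^ Suc n) w"
  have s_sing: "act x s = 0" if "\<gamma> \<in> P" "x \<in> root_space T \<gamma>" for \<gamma> x
  proof (cases "\<gamma> = \<alpha>")
    case False
    then show ?thesis unfolding s_def using other that by blast
  next
    case True
    then have x: "x \<in> root_space T \<alpha>" using that by simp
    from sl2_lowering[where k = n, OF w sing[OF \<alpha>P x] y bracket_opposite_root_spaces[OF x y P_dual[OF \<alpha>P]]]
    show ?thesis unfolding s_def n by simp
  qed
  define \<nu>' where "\<nu>' = \<nu> - (\<lambda>h. of_nat (Suc n) * \<alpha> h)"
  have wt: "(act y ^^ k) w \<in> weight_space (\<nu> - (\<lambda>h. of_nat k * \<alpha> h)) \<and> \<nu> - (\<lambda>h. of_nat k * \<alpha> h) \<in> dual_space T" for k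
  proof (induction k)
    case 0
    have "\<nu> - (\<lambda>h. of_nat 0 * \<alpha> h) = \<nu>" by (rule ext) simp
    then show ?case using w \<nu> by simp
  next
    case (Suc k)
    have eq: "\<nu> - (\<lambda>h. of_nat (Suc k) * \<alpha> h) = (\<nu> - (\<lambda>h. of_nat k * \<alpha> h)) + - \<alpha>"
      by (rule ext) (simp add: distrib_right)
    show ?case unfolding eq funpow.simps comp_apply
      using act_weight_space[OF y] dual_space_add dual_space_minus P_dual[OF \<alpha>P] Suc by blast
  qed
  have s_wt: "s \<in> weight_space \<nu>'" and \<nu>'d: "\<nu>' \<in> dual_space T" using wt[of "Suc n"] by (simp_all only: s_def \<nu>'_def)
  have ht': "ht \<nu>' < ht \<nu>"
  proof -
    have "ht \<nu>' = ht \<nu> - real (Suc n) * ht \<alpha>" unfolding \<nu>'_def ht_def by simp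
    moreover have "real (Suc n) * ht \<alpha> > 0" using P_ht[OF \<alpha>P] by simp
    ultimately show ?thesis by linarith
  qed
  have "lowering_span s \<subseteq> V" by (rule lowering_span_V[OF s_wt \<nu>'d s_sing])
  moreover have "act x z \<in> lowering_span s" if "z \<in> lowering_span s" for x z
    by (rule lowering_span_act[OF s_wt \<nu>'d s_sing that])
  ultimately have sub: "submodule (lowering_span s)"
    unfolding submodule_def using subspace_lowering_span by blast
  have "s \<in> lowering_span s" by (rule generator_in_lowering_span)
  then have "lowering_span s = V" using irr sub nz unfolding irreducible_def s_def by blast
  then have wU: "w \<in> lowering_span s" using wV by simp
  \<comment> \<open>Inside the module generated by \<open>s\<close>, the vector \<open>w\<close> is
    either a multiple of \<open>s\<close> or has weight below \<open>\<nu>'\<close>; comparing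
    heights excludes both.\<close>
  have "(\<exists>c. w = c *m s) \<or> (\<exists>bs. set bs \<subseteq> P \<and> \<nu> = \<nu>' - sum_list bs)"
    by (rule weight_vector_in_lowering_span[OF s_wt \<nu>'d s_sing wU w \<nu>(2,1)]) blast+
  then show False
  proof (elim disjE exE conjE)
    fix c assume "w = c *m s"
    then have "w \<in> weight_space \<nu>'" using s_wt M.subspace_scale[OF subspace_weight_space] by blast
    then have "\<nu> reg *m w = \<nu>' reg *m w" using weight_spaceD[OF w reg_T] weight_spaceD[of w \<nu>' reg] reg_T by metis
    then have "\<nu> reg = \<nu>' reg" using \<nu>(2) by simp
    then show False using ht' by (simp add: ht_def)
  next
    fix bs assume bs: "set bs \<subseteq> P" "\<nu> = \<nu>' - sum_list bs"
    then have "ht \<nu> = ht \<nu>' - ht (sum_list bs)" by (metis ht_diff)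
    then show False using ht' sum_list_P_ht[OF bs(1)] by linarith
  qed
qed

end

section \<open>Direct sums and tensor products of modules\<close>

lemma lie_module_direct_sum:
  assumes "lie_module scale bracket m1 V1 a1" "lie_module scale bracket m2 V2 a2"
  shows "lie_module scale bracket (\<lambda>c z. (m1 c (fst z), m2 c (snd z))) (V1 \<times> V2) (\<lambda>x z. (a1 x (fst z), a2 x (snd z)))"
proof -
  interpret A: lie_module scale bracket m1 V1 a1 by fact
  interpret B: lie_module scale bracket m2 V2 a2 by fact
  interpret M: vector_space "\<lambda>c z. (m1 c (fst z), m2 c (snd z))"
    by unfold_locales (auto simp: A.M.scale_right_distrib B.M.scale_right_distrib A.M.scale_left_distrib B.M.scale_left_distrib)
  have "M.subspace (V1 \<times> V2)"
    using A.subspace_V B.subspace_V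
    by (auto simp: M.subspace_def A.M.subspace_def B.M.subspace_def zero_prod_def)
  then show ?thesis
    by unfold_locales (auto simp: A.act_closed B.act_closed A.act_add_right B.act_add_right A.act_scale_right B.act_scale_right
        A.act_add_left B.act_add_left A.act_scale_left B.act_scale_left A.act_bracket B.act_bracket)
qed

text \<open>The tensor product of \<open>V1\<close> and \<open>V2\<close>, realised inside the linear maps from the dual space
  of \<open>V1\<close> to \<open>V2\<close>. Functionals vanish outside \<open>V1\<close>, and maps vanish outside the functionals.\<close>

locale two_lie_modules =
  A: lie_module scale bracket mscale V1 a1 + B: lie_module scale bracket mscale V2 a2
  for scale :: "complex \<Rightarrow> 'g::ab_group_add \<Rightarrow> 'g" and bracket :: "'g \<Rightarrow> 'g \<Rightarrow> 'g"
    and mscale :: "complex \<Rightarrow> 'v::ab_group_add \<Rightarrow> 'v"  (infixr \<open>*m\<close> 75)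
    and V1 a1 V2 a2
begin

definition functionals :: "('v \<Rightarrow> complex) set" where
  "functionals = {f. (\<forall>u\<in>V1. \<forall>v\<in>V1. f (u + v) = f u + f v) \<and> (\<forall>c. \<forall>u\<in>V1. f (c *m u) = c * f u) \<and>
     (\<forall>u. u \<notin> V1 \<longrightarrow> f u = 0)}"

text \<open>The transpose of the action, without the sign of the dual module: the tensor of
  \<open>u\<close> and \<open>v\<close> evaluated at \<open>f\<close> is \<open>f u\<close> times
  \<open>v\<close>, so acting on \<open>u\<close> amounts to composing \<open>f\<close> with the
  action.\<close>

definition pullback :: "'g \<Rightarrow> ('v \<Rightarrow> complex) \<Rightarrow> 'v \<Rightarrow> complex" where
  "pullback x f = (\<lambda>u. if u \<in> V1 then f (a1 x u) else 0)"

definition tensor_space :: "(('v \<Rightarrow> complex) \<Rightarrow> 'v) set" where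
  "tensor_space = {\<phi>. (\<forall>f. \<phi> f \<in> V2) \<and> (\<forall>f. f \<notin> functionals \<longrightarrow> \<phi> f = 0) \<and>
     (\<forall>f\<in>functionals. \<forall>g\<in>functionals. \<phi> (f + g) = \<phi> f + \<phi> g) \<and>
     (\<forall>c. \<forall>f\<in>functionals. \<phi> (\<lambda>u. c * f u) = c *m \<phi> f)}"

definition tensor_scale :: "complex \<Rightarrow> (('v \<Rightarrow> complex) \<Rightarrow> 'v) \<Rightarrow> ('v \<Rightarrow> complex) \<Rightarrow> 'v" where
  "tensor_scale c \<phi> = (\<lambda>f. c *m \<phi> f)"

definition tensor_act :: "'g \<Rightarrow> (('v \<Rightarrow> complex) \<Rightarrow> 'v) \<Rightarrow> ('v \<Rightarrow> complex) \<Rightarrow> 'v" where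
  "tensor_act x \<phi> = (\<lambda>f. if f \<in> functionals then a2 x (\<phi> f) + \<phi> (pullback x f) else 0)"

definition tensor :: "'v \<Rightarrow> 'v \<Rightarrow> ('v \<Rightarrow> complex) \<Rightarrow> 'v" where
  "tensor u v = (\<lambda>f. if f \<in> functionals then f u *m v else 0)"

sublocale TS: vector_space tensor_scale
  by unfold_locales (auto simp: tensor_scale_def fun_eq_iff A.M.scale_right_distrib A.M.scale_left_distrib)

lemma V1_simps: "u \<in> V1 \<Longrightarrow> v \<in> V1 \<Longrightarrow> u + v \<in> V1" "u \<in> V1 \<Longrightarrow> c *m u \<in> V1" "0 \<in> V1"
  and V2_simps: "u \<in> V2 \<Longrightarrow> v \<in> V2 \<Longrightarrow> u + v \<in> V2" "u \<in> V2 \<Longrightarrow> c *m u \<in> V2" "0 \<in> V2"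
  using A.subspace_V B.subspace_V by (auto simp: A.M.subspace_def)

lemma functionals_add: "f \<in> functionals \<Longrightarrow> g \<in> functionals \<Longrightarrow> f + g \<in> functionals"
  and functionals_scale: "f \<in> functionals \<Longrightarrow> (\<lambda>u. c * f u) \<in> functionals"
  and functionals_pullback: "f \<in> functionals \<Longrightarrow> pullback x f \<in> functionals"
  by (auto simp: functionals_def pullback_def V1_simps algebra_simps A.act_add_right A.act_scale_right A.act_closed)

lemma functional_add: "f \<in> functionals \<Longrightarrow> u \<in> V1 \<Longrightarrow> v \<in> V1 \<Longrightarrow> f (u + v) = f u + f v"
  and functional_scale: "f \<in> functionals \<Longrightarrow> u \<in> V1 \<Longrightarrow> f (c *m u) = c * f u"
  by (auto simp: functionals_def)

lemma functional_zero: "f \<in> functionals \<Longrightarrow> f 0 = 0"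
  using functional_scale[OF _ V1_simps(3), of f 0] by simp

lemma pullback_linear:
  "pullback x (f + g) = pullback x f + pullback x g" "pullback x (\<lambda>u. c * f u) = (\<lambda>u. c * pullback x f u)"
  by (auto simp: pullback_def fun_eq_iff)

lemma pullback_add: "f \<in> functionals \<Longrightarrow> pullback (x + y) f = pullback x f + pullback y f"
  and pullback_scale: "f \<in> functionals \<Longrightarrow> pullback (scale c x) f = (\<lambda>u. c * pullback x f u)"
  by (auto simp: pullback_def fun_eq_iff A.act_add_left A.act_scale_left functional_add functional_scale A.act_closed)

lemma pullback_bracket:
  assumes "f \<in> functionals"
  shows "pullback y (pullback x f) = pullback (bracket x y) f + pullback x (pullback y f)"
proof
  fix u
  have "f (a1 x (a1 y u)) = f (a1 (bracket x y) u) + f (a1 y (a1 x u))" if "u \<in> V1"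
  proof -
    have "a1 x (a1 y u) = a1 (bracket x y) u + a1 y (a1 x u)" using that by (simp add: A.act_bracket)
    then show ?thesis using functional_add[OF assms] that A.act_closed by metis
  qed
  then show "pullback y (pullback x f) u = (pullback (bracket x y) f + pullback x (pullback y f)) u"
    by (simp add: pullback_def A.act_closed)
qed

lemma tensor_spaceD:
  assumes "\<phi> \<in> tensor_space"
  shows "\<phi> f \<in> V2" "f \<notin> functionals \<Longrightarrow> \<phi> f = 0"
    "f \<in> functionals \<Longrightarrow> g \<in> functionals \<Longrightarrow> \<phi> (f + g) = \<phi> f + \<phi> g"
    "f \<in> functionals \<Longrightarrow> \<phi> (\<lambda>u. c * f u) = c *m \<phi> f"
  using assms by (auto simp: tensor_space_def)

lemma subspace_tensor_space: "TS.subspace tensor_space"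
  unfolding TS.subspace_def tensor_space_def tensor_scale_def
  by (auto simp: V2_simps A.M.scale_right_distrib A.M.scale_left_commute)

lemma tensor_act_closed:
  assumes "\<phi> \<in> tensor_space"
  shows "tensor_act x \<phi> \<in> tensor_space"
  using tensor_spaceD[OF assms]
  by (auto simp: tensor_space_def tensor_act_def V2_simps B.act_closed functionals_add functionals_scale
      functionals_pullback pullback_linear B.act_add_right B.act_scale_right A.M.scale_right_distrib)

sublocale tensor: lie_module scale bracket tensor_scale tensor_space tensor_act
proof (unfold_locales, goal_cases)
  case 1
  show ?case by (rule subspace_tensor_space)
next
  case (2 v x)
  then show ?case by (rule tensor_act_closed)
next
  case (3 v w x)
  then show ?case by (auto simp: tensor_act_def fun_eq_iff B.act_add_right tensor_spaceD)
next
  case (4 v x c)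
  then show ?case by (auto simp: tensor_act_def tensor_scale_def fun_eq_iff B.act_scale_right tensor_spaceD A.M.scale_right_distrib)
next
  case (5 v x y)
  then show ?case
    by (auto simp: tensor_act_def fun_eq_iff B.act_add_left tensor_spaceD pullback_add functionals_pullback)
next
  case (6 v c x)
  show ?case
  proof
    fix f
    show "tensor_act (scale c x) v f = tensor_scale c (tensor_act x v) f"
    proof (cases "f \<in> functionals")
      case True
      have "v (pullback (scale c x) f) = c *m v (pullback x f)"
        unfolding pullback_scale[OF True] by (rule tensor_spaceD(4)[OF 6 functionals_pullback[OF True]])
      then show ?thesis using True tensor_spaceD(1)[OF 6]
        by (simp add: tensor_act_def tensor_scale_def B.act_scale_left A.M.scale_right_distrib)
    qed (simp add: tensor_act_def tensor_scale_def)
  qed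
next
  case (7 v x y)
  show ?case
  proof
    fix f
    show "tensor_act (bracket x y) v f = (tensor_act x (tensor_act y v) - tensor_act y (tensor_act x v)) f"
    proof (cases "f \<in> functionals")
      case True
      have "v (pullback y (pullback x f)) = v (pullback (bracket x y) f) + v (pullback x (pullback y f))"
        unfolding pullback_bracket[OF True, where x = x and y = y] by (intro tensor_spaceD(3)[OF 7] functionals_pullback True)
      then show ?thesis using True
        by (simp add: tensor_act_def functionals_pullback B.act_bracket B.act_add_right tensor_spaceD(1)[OF 7] B.act_closed)
    qed (simp add: tensor_act_def)
  qed
qed

lemma tensor_in_space: "v \<in> V2 \<Longrightarrow> tensor u v \<in> tensor_space"
  by (auto simp: tensor_space_def tensor_def V2_simps functionals_add functionals_scale A.M.scale_left_distrib)

lemma tensor_act_tensor: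
  "u \<in> V1 \<Longrightarrow> v \<in> V2 \<Longrightarrow> tensor_act x (tensor u v) = tensor u (a2 x v) + tensor (a1 x u) v"
  by (auto simp: tensor_def tensor_act_def fun_eq_iff functionals_pullback B.act_scale_right) (auto simp: pullback_def)

lemma tensor_scale_left: "u \<in> V1 \<Longrightarrow> tensor (c *m u) v = tensor_scale c (tensor u v)"
  and tensor_scale_right: "tensor u (c *m v) = tensor_scale c (tensor u v)"
  and tensor_add_left: "u \<in> V1 \<Longrightarrow> u' \<in> V1 \<Longrightarrow> tensor (u + u') v = tensor u v + tensor u' v"
  and tensor_add_right: "tensor u (v + v') = tensor u v + tensor u v'"
  by (auto simp: tensor_def tensor_scale_def fun_eq_iff functional_scale functional_add mult.commute
      A.M.scale_left_distrib A.M.scale_right_distrib)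

lemma tensor_zero_left: "tensor 0 v = 0" and tensor_zero_right: "tensor u 0 = 0"
  by (auto simp: tensor_def fun_eq_iff functional_zero)

text \<open>By the Leibniz rule each application of \<open>y\<close> uses up one unit of
  \<open>k\<close> or of \<open>l\<close>.\<close>

lemma tensor_act_nilpotent:
  assumes "u \<in> V1" "v \<in> V2" "(a1 y ^^ k) u = 0" "(a2 y ^^ l) v = 0"
  shows "(tensor_act y ^^ (k + l)) (tensor u v) = 0"
  using assms
proof (induction "k + l" arbitrary: k l u v rule: less_induct)
  case less
  have zero: "(tensor_act y ^^ n) 0 = 0" for n
    by (induction n) (auto simp: tensor_act_def fun_eq_iff B.act_scale_right[OF V2_simps(3), of _ 0, simplified])
  have lin: "(tensor_act y ^^ n) (\<phi> + \<psi>) = (tensor_act y ^^ n) \<phi> + (tensor_act y ^^ n) \<psi>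
      \<and> (tensor_act y ^^ n) \<phi> \<in> tensor_space" if "\<phi> \<in> tensor_space" "\<psi> \<in> tensor_space" for n \<phi> \<psi>
    using that
  proof (induction n arbitrary: \<phi> \<psi>)
    case (Suc n)
    have eq: "tensor_act y (\<phi> + \<psi>) = tensor_act y \<phi> + tensor_act y \<psi>"
      by (rule tensor.act_add_right[OF Suc.prems])
    show ?case unfolding funpow_Suc_right comp_apply eq
      by (rule Suc.IH) (intro tensor_act_closed Suc.prems)+
  qed simp
  show ?case
  proof (cases "k = 0 \<or> l = 0")
    case True
    then have "tensor u v = 0" using less.prems by (auto simp: tensor_zero_left tensor_zero_right)
    then show ?thesis by (simp add: zero)
  next
    case False
    then obtain k' l' where kl: "k = Suc k'" "l = Suc l'" by (cases k; cases l) auto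
    have 1: "(tensor_act y ^^ (k + l')) (tensor u (a2 y v)) = 0"
      using less.hyps[of k l' u "a2 y v"] less.prems by (simp add: kl funpow_swap1 B.act_closed)
    have 2: "(tensor_act y ^^ (k' + l)) (tensor (a1 y u) v) = 0"
      using less.hyps[of k' l "a1 y u" v] less.prems by (simp add: kl funpow_swap1 A.act_closed)
    have "(tensor_act y ^^ (k + l)) (tensor u v) = (tensor_act y ^^ (k' + l)) (tensor_act y (tensor u v))"
      by (simp add: kl funpow_swap1)
    also have "\<dots> = (tensor_act y ^^ (k' + l)) (tensor u (a2 y v)) + (tensor_act y ^^ (k' + l)) (tensor (a1 y u) v)"
      using lin less.prems by (simp add: tensor_act_tensor tensor_in_space B.act_closed)
    also have "\<dots> = 0" using 1 2 by (simp add: kl)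
    finally show ?thesis .
  qed
qed

end


section \<open>Divided powers\<close>

context vector_space
begin

text \<open>Independence is given for an indexed family, as absence of nontrivial relations. It
  makes \<open>f\<close> injective and its image an independent set, on which a functional can be
  prescribed.\<close>

lemma dual_functional_exists:
  assumes "finite J" and ind: "\<And>c. (\<Sum>j\<in>J. scale (c j) (f j)) = 0 \<Longrightarrow> \<forall>j\<in>J. c j = 0" and "j0 \<in> J"
  obtains g :: "'b \<Rightarrow> 'a" where "\<And>u v. g (u + v) = g u + g v" "\<And>c u. g (scale c u) = c * g u"
    "\<And>j. j \<in> J \<Longrightarrow> g (f j) = (if j = j0 then 1 else 0)"
proof -
  interpret self: vector_space "(*) :: 'a \<Rightarrow> 'a \<Rightarrow> 'a"
    by unfold_locales (auto simp: algebra_simps)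
  interpret pair: vector_space_pair scale "(*) :: 'a \<Rightarrow> 'a \<Rightarrow> 'a" ..
  have inj: "inj_on f J"
  proof (rule inj_onI, rule ccontr)
    fix i j assume ij: "i \<in> J" "j \<in> J" "f i = f j" "i \<noteq> j"
    define c where "c k = (if k = i then 1 else if k = j then - 1 else 0 :: 'a)" for k
    have "(\<Sum>k\<in>J. scale (c k) (f k)) = (\<Sum>k\<in>{i, j}. scale (c k) (f k))"
      using ij assms(1) by (intro sum.mono_neutral_right) (auto simp: c_def)
    also have "\<dots> = 0" using ij by (simp add: c_def)
    finally have "c i = 0" using ind ij by blast
    then show False by (simp add: c_def)
  qed
  have "independent (f ` J)"
  proof
    assume "dependent (f ` J)"
    then obtain u where u: "(\<Sum>v\<in>f ` J. scale (u v) v) = 0" "\<exists>v\<in>f ` J. u v \<noteq> 0"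
      unfolding dependent_finite[OF finite_imageI[OF assms(1)]] by (elim exE conjE)
    have "(\<Sum>j\<in>J. scale (u (f j)) (f j)) = 0" using u(1) by (simp add: sum.reindex[OF inj])
    then show False using ind[of "\<lambda>j. u (f j)"] u(2) by blast
  qed
  from pair.linear_independent_extend[OF this, of "\<lambda>v. if v = f j0 then 1 else 0"]
  obtain g where g: "Vector_Spaces.linear scale (*) g" "\<forall>v\<in>f ` J. g v = (if v = f j0 then 1 else 0)" by blast
  interpret g: Vector_Spaces.linear scale "(*)" g by (rule g(1))
  show thesis
  proof (rule that[of g])
    show "g (f j) = (if j = j0 then 1 else 0)" if "j \<in> J" for j
      using g(2) that assms(3) inj_onD[OF inj] by auto
  qed (auto simp: g.add g.scale)
qed

end

section \<open>Divided powers, their ordered products, and the Leibniz rule\<close>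

context lie_module
begin

text \<open>Dividing by the factorial removes the binomial coefficients from the Leibniz rule and
  matches the normalisation of \<open>signature_vector\<close>.\<close>

definition divided_power :: "'g \<Rightarrow> nat \<Rightarrow> 'v \<Rightarrow> 'v" where
  "divided_power y k u = (1 / fact k) *m (act y ^^ k) u"

lemma divided_power_closed: "u \<in> V \<Longrightarrow> divided_power y k u \<in> V"
proof -
  assume u: "u \<in> V"
  have "(act y ^^ k) u \<in> V" by (induction k) (auto simp: u act_closed)
  then show ?thesis using subspace_V by (simp add: divided_power_def M.subspace_scale)
qed

lemma divided_power_0: "divided_power y 0 u = u"
  by (simp add: divided_power_def)

lemma act_divided_power:
  assumes u: "u \<in> V"
  shows "act y (divided_power y k u) = of_nat (Suc k) *m divided_power y (Suc k) u"
proof -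
  have "(act y ^^ k) u \<in> V" by (induction k) (auto simp: u act_closed)
  then show ?thesis by (simp add: divided_power_def act_scale_right del: of_nat_Suc)
qed

lemma divided_power_Suc:
  assumes u: "u \<in> V"
  shows "divided_power y (Suc k) u = (1 / of_nat (Suc k)) *m act y (divided_power y k u)"
  unfolding act_divided_power[OF u] by (simp del: of_nat_Suc)

lemma divided_power_add: "u \<in> V \<Longrightarrow> v \<in> V \<Longrightarrow> divided_power y k (u + v) = divided_power y k u + divided_power y k v"
proof -
  assume uv: "u \<in> V" "v \<in> V"
  have cl: "(act y ^^ k) z \<in> V" if "z \<in> V" for z k using that by (induction k) (auto simp: act_closed)
  have "(act y ^^ k) (u + v) = (act y ^^ k) u + (act y ^^ k) v"
    by (induction k) (auto simp: act_add_right cl uv)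
  then show ?thesis by (simp add: divided_power_def M.scale_right_distrib)
qed

lemma divided_power_zero: "divided_power y k 0 = 0"
proof -
  have "act y 0 = 0" using act_scale_right[OF M.subspace_0[OF subspace_V], of y 0] by simp
  then have "(act y ^^ k) 0 = 0" by (induction k) auto
  then show ?thesis by (simp add: divided_power_def)
qed

lemma divided_power_sum: "(\<And>i. i \<in> I \<Longrightarrow> g i \<in> V) \<Longrightarrow> divided_power y k (sum g I) = (\<Sum>i\<in>I. divided_power y k (g i))"
  by (induction I rule: infinite_finite_induct)
     (auto simp: divided_power_zero divided_power_add M.subspace_sum[OF subspace_V])

definition ordered_product :: "('i \<Rightarrow> 'g) \<Rightarrow> ('i \<Rightarrow> nat) \<Rightarrow> 'i list \<Rightarrow> 'v \<Rightarrow> 'v" where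
  "ordered_product E p xs u = foldr (\<lambda>i z. divided_power (E i) (p i) z) xs u"

lemma ordered_product_simps:
  "ordered_product E p [] u = u"
  "ordered_product E p (i # xs) u = divided_power (E i) (p i) (ordered_product E p xs u)"
  by (auto simp: ordered_product_def)

lemma ordered_product_closed: "u \<in> V \<Longrightarrow> ordered_product E p xs u \<in> V"
  by (induction xs) (auto simp: ordered_product_simps divided_power_closed)

lemma ordered_product_cong:
  "(\<And>i. i \<in> set xs \<Longrightarrow> p i = q i) \<Longrightarrow> ordered_product E p xs u = ordered_product E q xs u"
  by (induction xs) (auto simp: ordered_product_simps)

end

text \<open>The first components of all ways to distribute the exponents \<open>p\<close> over two
  tensor factors; on \<open>A\<close> the natural number subtraction \<open>p - q\<close> is
  exact.\<close>

definition splits :: "'i set \<Rightarrow> ('i \<Rightarrow> nat) \<Rightarrow> ('i \<Rightarrow> nat) set" where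
  "splits A p = {q. (\<forall>i\<in>A. q i \<le> p i) \<and> (\<forall>i. i \<notin> A \<longrightarrow> q i = 0)}"

lemma splits_empty: "splits {} p = {\<lambda>_. 0}"
  by (auto simp: splits_def)

lemma bij_betw_splits_insert:
  assumes "i \<notin> A"
  shows "bij_betw (\<lambda>(q, k). q(i := k)) (splits A p \<times> {..p i}) (splits (insert i A) p)"
proof (rule bij_betw_byWitness[where f' = "\<lambda>q. (q(i := 0), q i)"])
  show "\<forall>z\<in>splits A p \<times> {..p i}. (((\<lambda>(q, k). q(i := k)) z)(i := 0), ((\<lambda>(q, k). q(i := k)) z) i) = z"
    using assms by (auto simp: splits_def fun_eq_iff)
qed (use assms in \<open>auto simp: splits_def\<close>)

lemma finite_splits: "finite A \<Longrightarrow> finite (splits A p)"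
proof (induction A rule: finite_induct)
  case (insert i A)
  then have "finite (splits A p \<times> {..p i})" by blast
  then show ?case using bij_betw_finite[OF bij_betw_splits_insert[OF insert.hyps(2)]] by blast
qed (simp add: splits_empty)

context two_lie_modules
begin

lemma tensor_act_sum:
  assumes "\<And>i. i \<in> I \<Longrightarrow> g i \<in> tensor_space"
  shows "tensor_act y (sum g I) = (\<Sum>i\<in>I. tensor_act y (g i))"
proof -
  have "tensor_act y 0 = 0"
    using tensor.act_scale_right[OF TS.subspace_0[OF subspace_tensor_space], of y 0] by simp
  then show ?thesis using assms
    by (induction I rule: infinite_finite_induct)
       (simp_all add: tensor.act_add_right TS.subspace_sum[OF subspace_tensor_space])
qed

lemma tensor_divided_power:
  assumes uv: "u \<in> V1" "v \<in> V2"
  shows "tensor.divided_power y n (tensor u v) =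
    (\<Sum>k\<le>n. tensor (A.divided_power y k u) (B.divided_power y (n - k) v))"
proof (induction n)
  case 0
  show ?case by (simp add: tensor.divided_power_0 A.divided_power_0 B.divided_power_0)
next
  case (Suc n)
  define t where "t k = tensor (A.divided_power y k u) (B.divided_power y (Suc n - k) v)" for k
  have cl: "A.divided_power y k u \<in> V1" "B.divided_power y k v \<in> V2" for k
    using uv by (auto simp: A.divided_power_closed B.divided_power_closed)
  have step: "tensor_act y (tensor (A.divided_power y k u) (B.divided_power y (n - k) v))
      = tensor_scale (of_nat (Suc n - k)) (t k) + tensor_scale (of_nat (Suc k)) (t (Suc k))" if "k \<le> n" for k
    using that
    by (simp add: tensor_act_tensor cl A.act_divided_power B.act_divided_power uv tensor_scale_left tensor_scale_right
        t_def Suc_diff_le del: of_nat_Suc)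
  have "tensor.divided_power y (Suc n) (tensor u v) =
     tensor_scale (1 / of_nat (Suc n)) (tensor_act y (\<Sum>k\<le>n. tensor (A.divided_power y k u) (B.divided_power y (n - k) v)))"
    unfolding tensor.divided_power_Suc[OF tensor_in_space[OF uv(2)]] Suc ..
  also have "tensor_act y (\<Sum>k\<le>n. tensor (A.divided_power y k u) (B.divided_power y (n - k) v)) =
      (\<Sum>k\<le>n. tensor_scale (of_nat (Suc n - k)) (t k)) + (\<Sum>k\<le>n. tensor_scale (of_nat (Suc k)) (t (Suc k)))"
    by (subst tensor_act_sum) (auto simp: tensor_in_space cl step sum.distrib[symmetric] intro!: sum.cong)
  \<comment> \<open>The added term \<open>k = Suc n\<close> has coefficient zero; in the shifted sum
    the same holds for \<open>k = 0\<close>. Over the common range the two coefficients add up to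
    \<open>Suc n\<close> at every \<open>k\<close>.\<close>
  also have "(\<Sum>k\<le>n. tensor_scale (of_nat (Suc n - k)) (t k)) = (\<Sum>k\<le>Suc n. tensor_scale (of_nat (Suc n - k)) (t k))"
    by simp
  also have "(\<Sum>k\<le>n. tensor_scale (of_nat (Suc k)) (t (Suc k))) = (\<Sum>k\<le>Suc n. tensor_scale (of_nat k) (t k))"
    unfolding sum.atMost_Suc_shift by simp
  also have "(\<Sum>k\<le>Suc n. tensor_scale (of_nat (Suc n - k)) (t k)) + (\<Sum>k\<le>Suc n. tensor_scale (of_nat k) (t k))
      = (\<Sum>k\<le>Suc n. tensor_scale (of_nat (Suc n)) (t k))"
    unfolding sum.distrib[symmetric] TS.scale_left_distrib[symmetric] of_nat_add[symmetric]
    by (intro sum.cong refl) simp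
  also have "\<dots> = tensor_scale (of_nat (Suc n)) (\<Sum>k\<le>Suc n. t k)" by (rule TS.scale_sum_right[symmetric])
  finally show ?case unfolding t_def by (simp del: of_nat_Suc sum.atMost_Suc)
qed

text \<open>The coproduct of an ordered product of divided powers: each exponent is shared between
  the two factors independently.\<close>

lemma tensor_ordered_product:
  assumes uv: "u \<in> V1" "v \<in> V2" and "distinct xs"
  shows "tensor.ordered_product E p xs (tensor u v) =
    (\<Sum>q\<in>splits (set xs) p. tensor (A.ordered_product E q xs u) (B.ordered_product E (p - q) xs v))"
  using assms(3)
proof (induction xs)
  case Nil
  show ?case by (simp add: splits_empty A.ordered_product_simps B.ordered_product_simps tensor.ordered_product_simps)
next
  case (Cons i xs)
  then have i: "i \<notin> set xs" and d: "distinct xs" by auto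
  have cl: "A.ordered_product E q xs u \<in> V1" "B.ordered_product E q xs v \<in> V2" for q
    using uv by (auto simp: A.ordered_product_closed B.ordered_product_closed)
  have "tensor.ordered_product E p (i # xs) (tensor u v) =
    (\<Sum>q\<in>splits (set xs) p. \<Sum>k\<le>p i. tensor (A.divided_power (E i) k (A.ordered_product E q xs u))
        (B.divided_power (E i) (p i - k) (B.ordered_product E (p - q) xs v)))"
    unfolding tensor.ordered_product_simps Cons.IH[OF d]
    by (subst tensor.divided_power_sum) (auto simp: tensor_in_space cl tensor_divided_power)
  also have "\<dots> = (\<Sum>(q, k)\<in>splits (set xs) p \<times> {..p i}.
      tensor (A.divided_power (E i) k (A.ordered_product E q xs u))
        (B.divided_power (E i) (p i - k) (B.ordered_product E (p - q) xs v)))"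
    by (rule sum.cartesian_product)
  also have "\<dots> = (\<Sum>z\<in>splits (set xs) p \<times> {..p i}. (\<lambda>q. tensor (A.ordered_product E q (i # xs) u)
      (B.ordered_product E (p - q) (i # xs) v)) ((\<lambda>(q, k). q(i := k)) z))"
  proof (intro sum.cong refl, clarify)
    fix q k
    have "A.ordered_product E (q(i := k)) xs u = A.ordered_product E q xs u"
      using i by (intro A.ordered_product_cong) auto
    moreover have "B.ordered_product E (p - q(i := k)) xs v = B.ordered_product E (p - q) xs v"
      using i by (intro B.ordered_product_cong) auto
    ultimately show "tensor (A.divided_power (E i) k (A.ordered_product E q xs u))
        (B.divided_power (E i) (p i - k) (B.ordered_product E (p - q) xs v)) =
      tensor (A.ordered_product E (q(i := k)) (i # xs) u) (B.ordered_product E (p - q(i := k)) (i # xs) v)"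
      by (simp add: A.ordered_product_simps B.ordered_product_simps)
  qed
  also have "\<dots> = (\<Sum>q\<in>splits (insert i (set xs)) p. tensor (A.ordered_product E q (i # xs) u)
      (B.ordered_product E (p - q) (i # xs) v))"
    by (rule sum.reindex_bij_betw[OF bij_betw_splits_insert[OF i]])
  finally show ?case unfolding list.set .
qed

text \<open>Evaluating at a functional dual to \<open>x i\<close> leaves the row of index
  \<open>i\<close>, a relation among the \<open>y j\<close>.\<close>

lemma tensor_sum_independent:
  assumes fin: "finite J1" "finite J2" and V: "\<And>i. i \<in> J1 \<Longrightarrow> x i \<in> V1"
    and ind1: "\<And>c. (\<Sum>i\<in>J1. c i *m x i) = 0 \<Longrightarrow> \<forall>i\<in>J1. c i = 0"
    and ind2: "\<And>c. (\<Sum>j\<in>J2. c j *m y j) = 0 \<Longrightarrow> \<forall>j\<in>J2. c j = 0"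
    and zero: "(\<Sum>i\<in>J1. \<Sum>j\<in>J2. tensor_scale (a i j) (tensor (x i) (y j))) = 0"
    and ij: "i \<in> J1" "j \<in> J2"
  shows "a i j = 0"
proof -
  obtain g where g: "\<And>u v. g (u + v) = g u + g v" "\<And>c u. g (c *m u) = c * g u"
    "\<And>k. k \<in> J1 \<Longrightarrow> g (x k) = (if k = i then 1 else 0)"
    using A.M.dual_functional_exists[OF fin(1) ind1 ij(1)] by blast
  \<comment> \<open>Cut off outside \<open>V1\<close>, as elements of \<open>functionals\<close>
    must be.\<close>
  define f where "f u = (if u \<in> V1 then g u else 0)" for u
  have f: "f \<in> functionals" by (auto simp: functionals_def f_def g V1_simps)
  have sum_apply: "(\<Sum>k\<in>K. \<phi> k) f = (\<Sum>k\<in>K. \<phi> k f)" for \<phi> :: "_ \<Rightarrow> ('v \<Rightarrow> complex) \<Rightarrow> 'v" and K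
    by (induction K rule: infinite_finite_induct) auto
  have "0 = (\<Sum>k\<in>J1. \<Sum>j\<in>J2. tensor_scale (a k j) (tensor (x k) (y j))) f" unfolding zero by simp
  also have "\<dots> = (\<Sum>k\<in>J1. \<Sum>j\<in>J2. a k j *m (f (x k) *m y j))"
    by (simp add: sum_apply tensor_scale_def tensor_def f)
  also have "\<dots> = (\<Sum>k\<in>J1. if k = i then \<Sum>j\<in>J2. a k j *m y j else 0)"
    using V by (intro sum.cong refl) (auto simp: f_def g(3))
  also have "\<dots> = (\<Sum>j\<in>J2. a i j *m y j)" using fin(1) ij(1) by simp
  finally show ?thesis using ind2[of "a i"] ij(2) by simp
qed

end


section \<open>The Cartan component of a tensor product\<close>

lemma exponents_split:
  assumes "p \<in> exponents N"
  shows "splits {1..N} p = {q\<in>exponents N. \<forall>i. q i \<le> p i}"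
proof (intro equalityI subsetI)
  fix q assume q: "q \<in> splits {1..N} p"
  have "q i \<le> p i" for i using q by (cases "i \<in> {1..N}") (auto simp: splits_def)
  then show "q \<in> {q\<in>exponents N. \<forall>i. q i \<le> p i}" using q by (auto simp: splits_def exponents_def)
qed (auto simp: splits_def exponents_def)

lemma split_exponents:
  assumes "p \<in> exponents N" "q \<in> splits {1..N} p"
  shows "q \<in> exponents N" "p - q \<in> exponents N" "q + (p - q) = p"
  using assms exponents_split[OF assms(1)] by (auto simp: exponents_def)

lemma exponents_add: "p \<in> exponents N \<Longrightarrow> q \<in> exponents N \<Longrightarrow> p + q \<in> exponents N"
  by (auto simp: exponents_def)

lemma splits_add: "p \<in> exponents N \<Longrightarrow> q \<in> exponents N \<Longrightarrow> q \<in> splits {1..N} (q + p)"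
  by (auto simp: splits_def exponents_def)

context essential_setting
begin

sublocale cartan_data scale bracket T P
  by unfold_locales (rule cartan positive)+

abbreviation "Dom \<equiv> dominant_weights T P"

lemma cartan_module_V: "\<nu> \<in> Dom \<Longrightarrow> cartan_module scale bracket T P mscale (V \<nu>) (act \<nu>)"
  by (intro cartan_module.intro module cartan_data_axioms)

lemma root_P: "i \<in> {1..N} \<Longrightarrow> \<alpha> i \<in> P"
  using numeration by (auto simp: bij_betw_def)

lemma root_vector_space: "i \<in> {1..N} \<Longrightarrow> e (- \<alpha> i) \<in> root_space T (- \<alpha> i)"
  using root_vectors roots_minus P_roots root_P by blast

definition vec :: "('g \<Rightarrow> complex) \<Rightarrow> (nat \<Rightarrow> nat) \<Rightarrow> 'v" where
  "vec \<nu> p = signature_vector (\<nu>, p)"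

lemma vec_eq:
  assumes "\<nu> \<in> Dom"
  shows "vec \<nu> p = lie_module.ordered_product mscale (act \<nu>) (\<lambda>i. e (- \<alpha> i)) p [1..<Suc N] (hv \<nu>)"
proof -
  interpret cartan_module scale bracket T P mscale "V \<nu>" "act \<nu>" by (rule cartan_module_V[OF assms])
  show ?thesis by (simp add: vec_def signature_vector_def ordered_product_def divided_power_def del: upt_Suc)
qed

lemma hv_facts:
  assumes "\<nu> \<in> Dom"
  shows "hv \<nu> \<in> V \<nu>" "hv \<nu> \<noteq> 0" "hv \<nu> \<in> cartan_module.weight_space T mscale (V \<nu>) (act \<nu>) \<nu>"
    "\<And>\<beta> x. \<beta> \<in> P \<Longrightarrow> x \<in> root_space T \<beta> \<Longrightarrow> act \<nu> x (hv \<nu>) = 0"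
proof -
  interpret cartan_module scale bracket T P mscale "V \<nu>" "act \<nu>" by (rule cartan_module_V[OF assms])
  show "hv \<nu> \<in> V \<nu>" "hv \<nu> \<noteq> 0" "hv \<nu> \<in> weight_space \<nu>"
    "\<And>\<beta> x. \<beta> \<in> P \<Longrightarrow> x \<in> root_space T \<beta> \<Longrightarrow> act \<nu> x (hv \<nu>) = 0"
    using module_highest_weight[OF assms] by (auto simp: highest_weight_vector_def weight_space_def)
qed

lemma hv_nilpotent:
  assumes \<nu>: "\<nu> \<in> Dom" and \<beta>: "simple_root \<beta>" and y: "y \<in> root_space T (- \<beta>)"
  shows "\<exists>n. (act \<nu> y ^^ n) (hv \<nu>) = 0"
proof -
  interpret cartan_module scale bracket T P mscale "V \<nu>" "act \<nu>" by (rule cartan_module_V[OF \<nu>])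
  obtain n :: nat where n: "\<nu> (tt \<beta>) = of_nat n * \<beta> (tt \<beta>) / 2"
    using dominant_weight_tt[OF \<nu>] \<beta> unfolding simple_root_def by blast
  have "(act \<nu> y ^^ Suc n) (hv \<nu>) = 0"
    by (rule simple_lowering_vanishes[OF module_irreducible[OF \<nu>] hv_facts(3)[OF \<nu>] dominant_weights_dual[OF \<nu>]
          hv_facts(2)[OF \<nu>] hv_facts(4)[OF \<nu>] \<beta> n y])
  then show ?thesis by blast
qed

lemma dominant_weight_nonneg:
  assumes "\<nu> \<in> Dom" "simple_root \<beta>"
  shows "\<exists>r\<ge>0. \<nu> (tt \<beta>) = complex_of_real r"
proof -
  have "\<beta> \<in> P" using assms(2) by (simp add: simple_root_def)
  then obtain n :: nat and r where "\<nu> (tt \<beta>) = of_nat n * \<beta> (tt \<beta>) / 2" "r > 0" "\<beta> (tt \<beta>) = complex_of_real r"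
    using dominant_weight_tt[OF assms(1)] root_norm_pos P_roots by blast
  then show ?thesis by (intro exI[of _ "real n * r / 2"]) auto
qed

text \<open>The vector \<open>(v\<^sub>\<kappa> \<otimes> v\<^sub>\<mu>, v\<^sub>\<kappa>\<^sub>+\<^sub>\<mu>)\<close> generates an irreducible submodule of
  \<open>(V(\<kappa>) \<otimes> V(\<mu>)) \<oplus> V(\<kappa> + \<mu>)\<close>, so both projections are injective on it.\<close>

lemma relation_transfer:
  assumes \<kappa>: "\<kappa> \<in> Dom" and \<mu>: "\<mu> \<in> Dom" and Q: "Q \<subseteq> exponents N"
  shows "(\<Sum>p\<in>Q. c p *m vec (\<kappa> + \<mu>) p) = 0 \<longleftrightarrow>
    (\<Sum>p\<in>Q. two_lie_modules.tensor_scale mscale (c p)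
       (\<Sum>q\<in>splits {1..N} p. two_lie_modules.tensor mscale (V \<kappa>) (vec \<kappa> q) (vec \<mu> (p - q)))) = 0"
proof -
  define \<nu> where "\<nu> = \<kappa> + \<mu>"
  have \<nu>: "\<nu> \<in> Dom" unfolding \<nu>_def by (rule dominant_weights_add[OF \<kappa> \<mu>])
  interpret A: cartan_module scale bracket T P mscale "V \<kappa>" "act \<kappa>" by (rule cartan_module_V[OF \<kappa>])
  interpret B: cartan_module scale bracket T P mscale "V \<mu>" "act \<mu>" by (rule cartan_module_V[OF \<mu>])
  interpret C: cartan_module scale bracket T P mscale "V \<nu>" "act \<nu>" by (rule cartan_module_V[OF \<nu>])
  interpret TM: two_lie_modules scale bracket mscale "V \<kappa>" "act \<kappa>" "V \<mu>" "act \<mu>" by unfold_locales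
  let ?ds = "\<lambda>c z. (TM.tensor_scale c (fst z), mscale c (snd z))"
  let ?da = "\<lambda>x z. (TM.tensor_act x (fst z), act \<nu> x (snd z))"
  let ?dV = "TM.tensor_space \<times> V \<nu>"
  interpret D: cartan_module scale bracket T P ?ds ?dV ?da
    by (intro cartan_module.intro cartan_data_axioms lie_module_direct_sum
        TM.tensor.lie_module_axioms C.lie_module_axioms)
  define w where "w = (TM.tensor (hv \<kappa>) (hv \<mu>), hv \<nu>)"
  note h\<kappa> = hv_facts[OF \<kappa>] and h\<mu> = hv_facts[OF \<mu>] and h\<nu> = hv_facts[OF \<nu>]
  have wV: "w \<in> ?dV" using h\<kappa> h\<mu> h\<nu> by (simp add: w_def TM.tensor_in_space)
  have w_wt: "w \<in> D.weight_space \<nu>"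
    unfolding D.weight_space_def
  proof (intro CollectI conjI ballI wV)
    fix h assume h: "h \<in> T"
    have "act \<mu> h (hv \<mu>) = \<mu> h *m hv \<mu>" "act \<kappa> h (hv \<kappa>) = \<kappa> h *m hv \<kappa>" "act \<nu> h (hv \<nu>) = \<nu> h *m hv \<nu>" "\<nu> h = \<kappa> h + \<mu> h"
      using \<nu>_def A.weight_spaceD[OF h\<kappa>(3) h] B.weight_spaceD[OF h\<mu>(3) h] C.weight_spaceD[OF h\<nu>(3) h] by auto
    then show "?da h w = ?ds (\<nu> h) w"
      by (simp add: w_def TM.tensor_act_tensor h\<kappa> h\<mu> TM.tensor_scale_left TM.tensor_scale_right
          TM.TS.scale_left_distrib add.commute)
  qed
  have sing: "?da x w = 0" if "\<beta> \<in> P" "x \<in> root_space T \<beta>" for \<beta> x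
    using h\<kappa>(1,4) h\<mu>(1,4) h\<nu>(4) that
    by (simp add: w_def TM.tensor_act_tensor TM.tensor_zero_left TM.tensor_zero_right zero_prod_def)
  have \<nu>d: "\<nu> \<in> dual_space T" by (rule dominant_weights_dual[OF \<nu>])
  have nilp: "\<exists>n. (?da y ^^ n) w = 0" if \<beta>: "simple_root \<beta>" and y: "y \<in> root_space T (- \<beta>)" for \<beta> y
  proof -
    obtain k l n where kln: "(act \<kappa> y ^^ k) (hv \<kappa>) = 0" "(act \<mu> y ^^ l) (hv \<mu>) = 0" "(act \<nu> y ^^ n) (hv \<nu>) = 0"
      using hv_nilpotent[OF \<kappa> \<beta> y] hv_nilpotent[OF \<mu> \<beta> y] hv_nilpotent[OF \<nu> \<beta> y] by blast
    have pow: "(?da y ^^ j) z = ((TM.tensor_act y ^^ j) (fst z), (act \<nu> y ^^ j) (snd z))" for j z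
      by (induction j) auto
    have "(TM.tensor_act y ^^ (k + l)) (TM.tensor (hv \<kappa>) (hv \<mu>)) = 0"
      by (rule TM.tensor_act_nilpotent[OF h\<kappa>(1) h\<mu>(1) kln(1,2)])
    moreover have "TM.tensor_act y 0 = 0"
      using TM.tensor.act_scale_right[OF TM.TS.subspace_0[OF TM.subspace_tensor_space], of y 0] by simp
    then have "(TM.tensor_act y ^^ n) 0 = 0" by (induction n) auto
    ultimately have "(TM.tensor_act y ^^ (n + (k + l))) (TM.tensor (hv \<kappa>) (hv \<mu>)) = 0"
      unfolding funpow_add[of n "k + l"] comp_apply by simp
    moreover have "(act \<nu> y ^^ (n + (k + l))) (hv \<nu>) = 0"
      by (rule C.act_funpow_zero_mono[OF kln(3)]) simp
    ultimately have "(?da y ^^ (n + (k + l))) w = 0" by (simp add: pow w_def zero_prod_def)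
    then show ?thesis by blast
  qed
  have sub: "D.M.subspace (D.lowering_span w)" by (rule D.subspace_lowering_span)
  have act_sub: "?da x z \<in> D.lowering_span w" if "z \<in> D.lowering_span w" for x z
    by (rule D.lowering_span_act[OF w_wt \<nu>d sing that])
  have subV: "D.lowering_span w \<subseteq> ?dV" by (rule D.lowering_span_V[OF w_wt \<nu>d sing])
  have irr: "K = {0}" if "D.submodule K" "K \<subseteq> D.lowering_span w" "w \<notin> K" for K
    by (rule D.integrable_lowering_span_irreducible[OF w_wt \<nu>d sing dominant_weight_nonneg[OF \<nu>] nilp that])
  \<comment> \<open>Independence of tensors for one-term families, tested on the coefficient
    1.\<close>
  have tn: "TM.tensor (hv \<kappa>) (hv \<mu>) \<noteq> 0"
  proof
    assume 0: "TM.tensor (hv \<kappa>) (hv \<mu>) = 0"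
    have "(\<lambda>_ _. 1 :: complex) 0 0 = (0::complex)"
      by (rule TM.tensor_sum_independent[where ?J1.0 = "{0::nat}" and ?J2.0 = "{0::nat}" and x = "\<lambda>_. hv \<kappa>" and y = "\<lambda>_. hv \<mu>"
            and a = "\<lambda>_ _. 1" and i = 0 and j = 0])
         (use h\<kappa> h\<mu> 0 in auto)
    then show False by simp
  qed
  have tact0: "TM.tensor_act x 0 = 0" for x
    using TM.tensor.act_scale_right[OF TM.TS.subspace_0[OF TM.subspace_tensor_space], of x 0] by simp
  \<comment> \<open>The kernels of the two projections miss \<open>w\<close>, because neither
    component of \<open>w\<close> is zero; irreducibility makes them trivial.\<close>
  have K1: "{z \<in> D.lowering_span w. snd z = 0} = {0}"
  proof (rule irr)
    show "D.submodule {z \<in> D.lowering_span w. snd z = 0}"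
      unfolding D.submodule_def D.M.subspace_def
    proof (intro conjI allI ballI)
      show "0 \<in> {z \<in> D.lowering_span w. snd z = 0}" using D.M.subspace_0[OF sub] by simp
      show "{z \<in> D.lowering_span w. snd z = 0} \<subseteq> ?dV" using subV by blast
      fix z assume z: "z \<in> {z \<in> D.lowering_span w. snd z = 0}"
      show "z + z' \<in> {z \<in> D.lowering_span w. snd z = 0}" if "z' \<in> {z \<in> D.lowering_span w. snd z = 0}" for z'
        using D.M.subspace_add[OF sub, of z z'] z that by simp
      show "?ds c z \<in> {z \<in> D.lowering_span w. snd z = 0}" for c
        using D.M.subspace_scale[OF sub, of z c] z by simp
      show "?da x z \<in> {z \<in> D.lowering_span w. snd z = 0}" for x
        using act_sub[of z x] z by (simp add: C.act_zero_right)
    qed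
    show "w \<notin> {z \<in> D.lowering_span w. snd z = 0}" using h\<nu> by (simp add: w_def)
  qed auto
  have K2: "{z \<in> D.lowering_span w. fst z = 0} = {0}"
  proof (rule irr)
    show "D.submodule {z \<in> D.lowering_span w. fst z = 0}"
      unfolding D.submodule_def D.M.subspace_def
    proof (intro conjI allI ballI)
      show "0 \<in> {z \<in> D.lowering_span w. fst z = 0}" using D.M.subspace_0[OF sub] by simp
      show "{z \<in> D.lowering_span w. fst z = 0} \<subseteq> ?dV" using subV by blast
      fix z assume z: "z \<in> {z \<in> D.lowering_span w. fst z = 0}"
      show "z + z' \<in> {z \<in> D.lowering_span w. fst z = 0}" if "z' \<in> {z \<in> D.lowering_span w. fst z = 0}" for z'
        using D.M.subspace_add[OF sub, of z z'] z that by simp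
      show "?ds c z \<in> {z \<in> D.lowering_span w. fst z = 0}" for c
        using D.M.subspace_scale[OF sub, of z c] z by simp
      show "?da x z \<in> {z \<in> D.lowering_span w. fst z = 0}" for x
        using act_sub[of z x] z by (simp add: tact0)
    qed
    show "w \<notin> {z \<in> D.lowering_span w. fst z = 0}" using tn by (simp add: w_def)
  qed auto
  have iff: "fst z = 0 \<longleftrightarrow> snd z = 0" if "z \<in> D.lowering_span w" for z
  proof
    assume "fst z = 0"
    then have "z \<in> {0}" unfolding K2[symmetric] using that by simp
    then show "snd z = 0" by simp
  next
    assume "snd z = 0"
    then have "z \<in> {0}" unfolding K1[symmetric] using that by simp
    then show "fst z = 0" by simp
  qed
  let ?E = "\<lambda>i. e (- \<alpha> i)" and ?xs = "[1..<Suc N]"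
  have pow: "(?da y ^^ j) z = ((TM.tensor_act y ^^ j) (fst z), (act \<nu> y ^^ j) (snd z))" for j y z
    by (induction j) auto
  have op: "D.ordered_product E p xs w = (TM.tensor.ordered_product E p xs (fst w), C.ordered_product E p xs (snd w))"
    for E :: "nat \<Rightarrow> 'g" and p xs
    by (induction xs) (auto simp: D.ordered_product_simps TM.tensor.ordered_product_simps C.ordered_product_simps
        D.divided_power_def TM.tensor.divided_power_def C.divided_power_def pow)
  have pow_in: "(?da y ^^ j) z \<in> D.lowering_span w" if "z \<in> D.lowering_span w" for j y z
    using that act_sub by (induction j) auto
  have op_in: "D.ordered_product E p xs w \<in> D.lowering_span w" for E :: "nat \<Rightarrow> 'g" and p xs
    by (induction xs) (auto simp: D.ordered_product_simps D.divided_power_def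
        intro!: D.M.subspace_scale[OF sub] pow_in D.generator_in_lowering_span)
  \<comment> \<open>One combination of ordered products applied to \<open>w\<close>; its two
    components are the two sums of the claim.\<close>
  define z where "z = (\<Sum>p\<in>Q. ?ds (c p) (D.ordered_product ?E p ?xs w))"
  have "z \<in> D.lowering_span w"
    unfolding z_def by (intro D.M.subspace_sum[OF sub] D.M.subspace_scale[OF sub] op_in)
  then have "fst z = 0 \<longleftrightarrow> snd z = 0" by (rule iff)
  moreover have "snd z = (\<Sum>p\<in>Q. c p *m vec \<nu> p)"
    unfolding z_def snd_sum op snd_conv vec_eq[OF \<nu>] unfolding w_def snd_conv ..
  moreover have "fst z = (\<Sum>p\<in>Q. TM.tensor_scale (c p) (\<Sum>q\<in>splits {1..N} p. TM.tensor (vec \<kappa> q) (vec \<mu> (p - q))))"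
  proof -
    have set: "set ?xs = {1..N}" by auto
    show ?thesis
      unfolding z_def fst_sum op fst_conv unfolding w_def fst_conv TM.tensor_ordered_product[OF h\<kappa>(1) h\<mu>(1) distinct_upt] set
        vec_eq[OF \<kappa>] vec_eq[OF \<mu>] ..
  qed
  ultimately show ?thesis unfolding \<nu>_def by simp
qed

end


section \<open>Essential bases\<close>

lemma (in vector_space) span_image_finite:
  assumes "x \<in> span (f ` J)" "finite J"
  obtains c where "x = (\<Sum>j\<in>J. scale (c j) (f j))"
proof -
  have "\<exists>c. x = (\<Sum>j\<in>J. scale (c j) (f j))"
    using assms(1)
  proof (induction x rule: span_induct_alt)
    case base
    show ?case by (intro exI[of _ "\<lambda>_. 0"]) simp
  next
    case (step a b y)
    then obtain c j where c: "y = (\<Sum>j\<in>J. scale (c j) (f j))" and j: "j \<in> J" "b = f j" by blast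
    have "(\<Sum>i\<in>J. scale ((if i = j then a else 0) + c i) (f i)) = (\<Sum>i\<in>J. (if i = j then scale a (f i) else 0) + scale (c i) (f i))"
      by (intro sum.cong refl) (simp add: scale_left_distrib)
    also have "\<dots> = scale a b + y" using j c assms(2) by (simp add: sum.distrib)
    finally show ?case by (intro exI[of _ "\<lambda>i. (if i = j then a else 0) + c i"]) simp
  qed
  with that show thesis by blast
qed

context two_lie_modules
begin

lemma tensor_sum_sum:
  assumes "\<And>i. i \<in> I \<Longrightarrow> x i \<in> V1"
  shows "tensor (\<Sum>i\<in>I. c i *m x i) (\<Sum>j\<in>J. d j *m y j) = (\<Sum>i\<in>I. \<Sum>j\<in>J. tensor_scale (c i * d j) (tensor (x i) (y j)))"
proof -
  have right: "tensor u (\<Sum>j\<in>J. d j *m y j) = (\<Sum>j\<in>J. tensor_scale (d j) (tensor u (y j)))" for u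
    by (induction J rule: infinite_finite_induct) (auto simp: tensor_zero_right tensor_add_right tensor_scale_right)
  have left: "tensor (\<Sum>i\<in>I. c i *m x i) v = (\<Sum>i\<in>I. tensor_scale (c i) (tensor (x i) v))" for v
    using assms
  proof (induction I rule: infinite_finite_induct)
    case (insert i I)
    have "(\<Sum>i\<in>I. c i *m x i) \<in> V1" using insert.prems A.subspace_V by (intro A.M.subspace_sum V1_simps) auto
    then show ?case using insert by (simp add: tensor_add_left tensor_scale_left V1_simps)
  qed (auto simp: tensor_zero_left)
  show ?thesis unfolding left by (simp only: right TS.scale_sum_right TS.scale_scale)
qed

end

context essential_setting
begin

section \<open>Monomial order and degree\<close>

lemma R_refl: "p \<in> exponents N \<Longrightarrow> (p, p) \<in> R"
  and R_field: "(p, q) \<in> R \<Longrightarrow> p \<in> exponents N \<and> q \<in> exponents N"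
  and R_trans: "(p, q) \<in> R \<Longrightarrow> (q, r) \<in> R \<Longrightarrow> (p, r) \<in> R"
  and R_antisym: "(p, q) \<in> R \<Longrightarrow> (q, p) \<in> R \<Longrightarrow> p = q"
  and R_total: "p \<in> exponents N \<Longrightarrow> q \<in> exponents N \<Longrightarrow> (p, q) \<in> R \<or> (q, p) \<in> R"
  and R_add: "(p, q) \<in> R \<Longrightarrow> r \<in> exponents N \<Longrightarrow> (p + r, q + r) \<in> R"
proof -
  have lin: "linear_order_on (exponents N) R" using order by (simp add: monomial_order_def)
  then have po: "partial_order_on (exponents N) R" and tot: "total_on (exponents N) R"
    by (auto simp: linear_order_on_def)
  note * = partial_order_onD[OF po]
  show refl: "p \<in> exponents N \<Longrightarrow> (p, p) \<in> R" for p using *(1) by (auto simp: refl_on_def)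
  show "(p, q) \<in> R \<Longrightarrow> p \<in> exponents N \<and> q \<in> exponents N" using *(4) by auto
  show "(p, q) \<in> R \<Longrightarrow> (q, r) \<in> R \<Longrightarrow> (p, r) \<in> R" using *(2) by (meson transD)
  show "(p, q) \<in> R \<Longrightarrow> (q, p) \<in> R \<Longrightarrow> p = q" using *(3) by (meson antisymD)
  show "p \<in> exponents N \<Longrightarrow> q \<in> exponents N \<Longrightarrow> (p, q) \<in> R \<or> (q, p) \<in> R"
    using tot refl by (cases "p = q") (auto simp: total_on_def)
  show "(p, q) \<in> R \<Longrightarrow> r \<in> exponents N \<Longrightarrow> (p + r, q + r) \<in> R"
    using order by (simp add: monomial_order_def)
qed

lemma finite_has_R_greatest:
  assumes "finite J" "J \<noteq> {}" "J \<subseteq> exponents N"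
  obtains m where "m \<in> J" "\<And>q. q \<in> J \<Longrightarrow> (q, m) \<in> R"
proof -
  have "\<exists>m\<in>J. \<forall>q\<in>J. (q, m) \<in> R"
    using assms
  proof (induction J rule: finite_ne_induct)
    case (singleton x)
    then show ?case using R_refl by auto
  next
    case (insert x J)
    then obtain m where m: "m \<in> J" "\<forall>q\<in>J. (q, m) \<in> R" by auto
    show ?case
    proof (cases "(x, m) \<in> R")
      case False
      then have "(m, x) \<in> R" using R_total insert.prems m(1) by auto
      then have "\<forall>q\<in>insert x J. (q, x) \<in> R" using m(2) R_trans R_refl insert.prems by blast
      then show ?thesis by blast
    qed (use m in blast)
  qed
  with that show thesis by blast
qed

text \<open>The drop of the weight of \<open>vec \<nu> p\<close> below \<open>\<nu>\<close>,
  measured at \<open>reg\<close>. Root heights are positive, so degrees bound all exponents; the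
  monomial order alone gives no such finiteness.\<close>

definition deg :: "(nat \<Rightarrow> nat) \<Rightarrow> real" where
  "deg p = (\<Sum>i\<in>{1..N}. real (p i) * ht (\<alpha> i))"

lemma deg_add: "deg (p + q) = deg p + deg q"
  by (simp add: deg_def sum.distrib[symmetric] distrib_right)

lemma root_ht: "i \<in> {1..N} \<Longrightarrow> ht (\<alpha> i) > 0"
  using root_P P_ht by blast

lemma deg_nonneg: "deg p \<ge> 0"
  unfolding deg_def by (intro sum_nonneg mult_nonneg_nonneg less_imp_le[OF root_ht]) auto

lemma finite_deg_le: "finite {p\<in>exponents N. deg p \<le> d}"
proof (rule finite_subset)
  show "finite (splits {1..N} (\<lambda>i. nat \<lceil>d / ht (\<alpha> i)\<rceil>))" by (rule finite_splits) simp
  show "{p\<in>exponents N. deg p \<le> d} \<subseteq> splits {1..N} (\<lambda>i. nat \<lceil>d / ht (\<alpha> i)\<rceil>)"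
  proof
    fix p assume p: "p \<in> {p\<in>exponents N. deg p \<le> d}"
    have "p i \<le> nat \<lceil>d / ht (\<alpha> i)\<rceil>" if i: "i \<in> {1..N}" for i
    proof -
      have "real (p i) * ht (\<alpha> i) \<le> deg p"
        unfolding deg_def using i by (intro member_le_sum mult_nonneg_nonneg less_imp_le[OF root_ht]) auto
      then have "real (p i) \<le> d / ht (\<alpha> i)" using p root_ht[OF i] by (simp add: field_simps)
      then show ?thesis by linarith
    qed
    then show "p \<in> splits {1..N} (\<lambda>i. nat \<lceil>d / ht (\<alpha> i)\<rceil>)" using p by (auto simp: splits_def exponents_def)
  qed
qed

definition deg_space :: "('g \<Rightarrow> complex) \<Rightarrow> real \<Rightarrow> 'v set" where
  "deg_space \<nu> d = {z\<in>V \<nu>. act \<nu> reg z = (\<nu> reg - of_real d) *m z}"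

lemma subspace_deg_space:
  assumes "\<nu> \<in> Dom"
  shows "M.subspace (deg_space \<nu> d)"
proof -
  interpret cartan_module scale bracket T P mscale "V \<nu>" "act \<nu>" by (rule cartan_module_V[OF assms])
  show ?thesis
    unfolding M.subspace_def deg_space_def
    by (auto simp: V_zero V_add V_scale act_zero_right act_add_right act_scale_right M.scale_right_distrib mult.commute)
qed

text \<open>Each factor \<open>e (- \<alpha> i)\<close> lowers the eigenvalue of \<open>reg\<close>
  by the height of \<open>\<alpha> i\<close>.\<close>

lemma vec_deg_space:
  assumes \<nu>: "\<nu> \<in> Dom"
  shows "vec \<nu> p \<in> deg_space \<nu> (deg p)"
proof -
  interpret cartan_module scale bracket T P mscale "V \<nu>" "act \<nu>" by (rule cartan_module_V[OF \<nu>])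
  have step: "act \<nu> y z \<in> deg_space \<nu> (d + ht \<beta>)"
    if z: "z \<in> deg_space \<nu> d" and \<beta>: "\<beta> \<in> P" and y: "y \<in> root_space T (- \<beta>)" for z d \<beta> y
  proof -
    have zV: "z \<in> V \<nu>" and zr: "act \<nu> reg z = (\<nu> reg - of_real d) *m z" using z by (auto simp: deg_space_def)
    have "bracket reg y = (- complex_of_real (ht \<beta>)) *s y"
      using y reg_T root_reg_eq_ht[OF P_roots[OF \<beta>]] by (simp add: root_space_def)
    then have "act \<nu> reg (act \<nu> y z) = (\<nu> reg - of_real d) *m act \<nu> y z + (- complex_of_real (ht \<beta>)) *m act \<nu> y z"
      unfolding act_swap[OF zV, of reg y] zr by (simp only: act_scale_right[OF zV] act_scale_left[OF zV])
    also have "\<dots> = (\<nu> reg - of_real (d + ht \<beta>)) *m act \<nu> y z"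
      unfolding M.scale_left_distrib[symmetric] by simp
    finally show ?thesis using act_closed[OF zV] by (simp add: deg_space_def)
  qed
  have pow: "(act \<nu> y ^^ k) z \<in> deg_space \<nu> (d + real k * ht \<beta>)"
    if "z \<in> deg_space \<nu> d" "\<beta> \<in> P" "y \<in> root_space T (- \<beta>)" for z d \<beta> y k
  proof (induction k)
    case (Suc k)
    have "d + real (Suc k) * ht \<beta> = (d + real k * ht \<beta>) + ht \<beta>" by (simp add: distrib_right)
    then show ?case using step[OF Suc that(2,3)] by (simp only: funpow.simps comp_apply)
  qed (use that in simp)
  have "ordered_product (\<lambda>i. e (- \<alpha> i)) p xs (hv \<nu>) \<in> deg_space \<nu> (\<Sum>i\<leftarrow>xs. real (p i) * ht (\<alpha> i))"
    if "set xs \<subseteq> {1..N}" for xs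
    using that
  proof (induction xs)
    case Nil
    then show ?case using hv_facts(1)[OF \<nu>] weight_spaceD[OF hv_facts(3)[OF \<nu>] reg_T]
      by (simp add: ordered_product_simps deg_space_def)
  next
    case (Cons i xs)
    then have i: "i \<in> {1..N}" by auto
    have "ordered_product (\<lambda>i. e (- \<alpha> i)) p (i # xs) (hv \<nu>) \<in> deg_space \<nu> ((\<Sum>i\<leftarrow>xs. real (p i) * ht (\<alpha> i)) + real (p i) * ht (\<alpha> i))"
      unfolding ordered_product_simps divided_power_def
      by (intro M.subspace_scale[OF subspace_deg_space[OF \<nu>]] pow root_P[OF i] root_vector_space[OF i] Cons.IH) (use Cons.prems in auto)
    then show ?case by (simp only: list.map sum_list.Cons add.commute)
  qed
  from this[of "[1..<Suc N]"] have "vec \<nu> p \<in> deg_space \<nu> (\<Sum>i\<leftarrow>[1..<Suc N]. real (p i) * ht (\<alpha> i))"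
    unfolding vec_eq[OF \<nu>] by fastforce
  also have "(\<Sum>i\<leftarrow>[1..<Suc N]. real (p i) * ht (\<alpha> i)) = deg p"
    unfolding deg_def by (subst sum_list_distinct_conv_sum_set) (auto intro: sum.cong)
  finally show ?thesis .
qed

lemma deg_space_independent:
  assumes \<nu>: "\<nu> \<in> Dom" and "finite X" "\<And>d. d \<in> X \<Longrightarrow> u d \<in> deg_space \<nu> d" "(\<Sum>d\<in>X. u d) = 0" "d \<in> X"
  shows "u d = 0"
proof -
  interpret cartan_module scale bracket T P mscale "V \<nu>" "act \<nu>" by (rule cartan_module_V[OF \<nu>])
  have "u d \<in> {0}"
    by (rule M.weight_components_in_subspace[where X = X and V = "V \<nu>" and I = "{reg}" and f = "act \<nu>"
          and wt = "\<lambda>d _. \<nu> reg - of_real d" and u = u])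
       (use assms subspace_V act_zero_right act_add_right act_scale_right in \<open>auto simp: deg_space_def\<close>)
  then show ?thesis by simp
qed

section \<open>Essential exponents as indices of a basis, and coordinates in it\<close>

definition ess :: "('g \<Rightarrow> complex) \<Rightarrow> (nat \<Rightarrow> nat) set" where
  "ess \<nu> = {p. (\<nu>, p) \<in> essential_signatures}"

lemma ess_iff:
  assumes "\<nu> \<in> Dom"
  shows "p \<in> ess \<nu> \<longleftrightarrow> p \<in> exponents N \<and> vec \<nu> p \<notin> M.span (vec \<nu> ` {q. (q, p) \<in> R \<and> q \<noteq> p})"
proof -
  have "signature_vector ` {\<tau>. signature_less \<tau> (\<nu>, p)} = vec \<nu> ` {q. (q, p) \<in> R \<and> q \<noteq> p}" if "p \<in> exponents N"
  proof -
    have "{\<tau>. signature_less \<tau> (\<nu>, p)} = Pair \<nu> ` {q. (q, p) \<in> R \<and> q \<noteq> p}"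
      using assms that R_field by (auto simp: signature_less_def signatures_def)
    then show ?thesis by (auto simp: vec_def image_image)
  qed
  then show ?thesis using assms by (auto simp: ess_def essential_signatures_def signatures_def vec_def)
qed

lemma ess_exponents: "\<nu> \<in> Dom \<Longrightarrow> p \<in> ess \<nu> \<Longrightarrow> p \<in> exponents N"
  using ess_iff by blast

text \<open>There may be infinitely many smaller exponents; fixing the degree makes the set
  finite.\<close>

definition ess_below :: "('g \<Rightarrow> complex) \<Rightarrow> (nat \<Rightarrow> nat) \<Rightarrow> (nat \<Rightarrow> nat) set" where
  "ess_below \<nu> p = {q\<in>ess \<nu>. deg q = deg p \<and> (q, p) \<in> R}"

lemma finite_ess_deg_le: "\<nu> \<in> Dom \<Longrightarrow> finite {q\<in>ess \<nu>. deg q \<le> d}"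
  by (rule finite_subset[OF _ finite_deg_le[of d]]) (auto dest: ess_exponents)

lemma finite_ess_below: "\<nu> \<in> Dom \<Longrightarrow> finite (ess_below \<nu> p)"
  by (rule finite_subset[OF _ finite_ess_deg_le[of \<nu> "deg p"]]) (auto simp: ess_below_def)

text \<open>Essentiality refers to smaller exponents of every degree. Vectors of different degree
  lie in independent eigenspaces of \<open>reg\<close>, so the part of a relation in the degree of
  \<open>p\<close> already expresses \<open>vec \<nu> p\<close>. Induction over the finitely many
  smaller exponents of bounded degree then replaces inessential vectors.\<close>

lemma vec_in_span_ess_below:
  assumes \<nu>: "\<nu> \<in> Dom" and "p \<in> exponents N"
  shows "vec \<nu> p \<in> M.span (vec \<nu> ` ess_below \<nu> p)"
  using assms(2)
proof (induction "card {q\<in>exponents N. deg q \<le> deg p \<and> (q, p) \<in> R}" arbitrary: p rule: less_induct)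
  case less
  show ?case
  proof (cases "p \<in> ess \<nu>")
    case True
    then show ?thesis using R_refl[OF less.prems] by (intro M.span_base) (auto simp: ess_below_def)
  next
    case False
    let ?L = "{q. (q, p) \<in> R \<and> q \<noteq> p}"
    define F where "F d = M.span (vec \<nu> ` {q\<in>?L. deg q = d})" for d
    have "vec \<nu> p \<in> M.span (vec \<nu> ` ?L)" using False ess_iff[OF \<nu>] less.prems by blast
    moreover have "vec \<nu> ` ?L \<subseteq> (\<Union>d\<in>UNIV. F d)" unfolding F_def by (auto intro: M.span_base)
    ultimately have "vec \<nu> p \<in> M.span (\<Union>d\<in>UNIV. F d)" using M.span_mono by blast
    then obtain X u where X: "finite X" "\<And>d. d \<in> X \<Longrightarrow> u d \<in> F d" "vec \<nu> p = (\<Sum>d\<in>X. u d)"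
      by (rule M.span_Union_subspaces_decompose) (auto simp: F_def)
    have FE: "F d \<subseteq> deg_space \<nu> d" for d
      unfolding F_def by (rule M.span_minimal[OF _ subspace_deg_space[OF \<nu>]]) (use vec_deg_space[OF \<nu>] in auto)
    define g where "g d = (if d \<in> X then u d else 0) - (if d = deg p then vec \<nu> p else 0)" for d
    have "g (deg p) = 0"
    proof (rule deg_space_independent[OF \<nu>, where X = "insert (deg p) X"])
      show "g d \<in> deg_space \<nu> d" for d
        unfolding g_def using X(2)[of d] FE[of d] vec_deg_space[OF \<nu>, of p] M.subspace_0[OF subspace_deg_space[OF \<nu>]]
        by (intro M.subspace_diff[OF subspace_deg_space[OF \<nu>]]) auto
      have "(\<Sum>d\<in>insert (deg p) X. g d) = (\<Sum>d\<in>insert (deg p) X. if d \<in> X then u d else 0) - (\<Sum>d\<in>insert (deg p) X. if d = deg p then vec \<nu> p else 0)"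
        unfolding g_def by (rule sum_subtractf)
      also have "(\<Sum>d\<in>insert (deg p) X. if d \<in> X then u d else 0) = (\<Sum>d\<in>X. u d)"
        using X(1) by (intro sum.mono_neutral_cong_right) auto
      also have "(\<Sum>d\<in>insert (deg p) X. if d = deg p then vec \<nu> p else 0) = vec \<nu> p" using X(1) by simp
      finally show "(\<Sum>d\<in>insert (deg p) X. g d) = 0" using X(3) by simp
    qed (use X(1) in auto)
    then have "vec \<nu> p = (if deg p \<in> X then u (deg p) else 0)" by (simp add: g_def)
    then have "vec \<nu> p \<in> F (deg p)" using X(2) by (auto simp: F_def M.span_zero)
    moreover have "vec \<nu> ` {q\<in>?L. deg q = deg p} \<subseteq> M.span (vec \<nu> ` ess_below \<nu> p)"
    proof (rule image_subsetI)
      fix q assume q: "q \<in> {q\<in>?L. deg q = deg p}"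
      then have qe: "q \<in> exponents N" using R_field by blast
      have "{r\<in>exponents N. deg r \<le> deg q \<and> (r, q) \<in> R} \<subset> {r\<in>exponents N. deg r \<le> deg p \<and> (r, p) \<in> R}"
      proof
        show "{r\<in>exponents N. deg r \<le> deg q \<and> (r, q) \<in> R} \<subseteq> {r\<in>exponents N. deg r \<le> deg p \<and> (r, p) \<in> R}"
          using q R_trans by auto
        have "p \<notin> {r\<in>exponents N. deg r \<le> deg q \<and> (r, q) \<in> R}" using q R_antisym by blast
        moreover have "p \<in> {r\<in>exponents N. deg r \<le> deg p \<and> (r, p) \<in> R}" using less.prems R_refl by simp
        ultimately show "{r\<in>exponents N. deg r \<le> deg q \<and> (r, q) \<in> R} \<noteq> {r\<in>exponents N. deg r \<le> deg p \<and> (r, p) \<in> R}" by blast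
      qed
      moreover have "finite {r\<in>exponents N. deg r \<le> deg p \<and> (r, p) \<in> R}"
        by (rule finite_subset[OF _ finite_deg_le[of "deg p"]]) auto
      ultimately have "vec \<nu> q \<in> M.span (vec \<nu> ` ess_below \<nu> q)"
        using less.hyps[OF psubset_card_mono qe] by blast
      moreover have "ess_below \<nu> q \<subseteq> ess_below \<nu> p" using q R_trans by (auto simp: ess_below_def)
      ultimately show "vec \<nu> q \<in> M.span (vec \<nu> ` ess_below \<nu> p)"
        using M.span_mono[OF image_mono] by blast
    qed
    then have "F (deg p) \<subseteq> M.span (vec \<nu> ` ess_below \<nu> p)"
      unfolding F_def by (rule M.span_minimal[OF _ M.subspace_span])
    ultimately show ?thesis by blast
  qed
qed

text \<open>In a nontrivial relation the greatest exponent with nonzero coefficient would index a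
  vector in the span of smaller ones.\<close>

lemma ess_independent:
  assumes \<nu>: "\<nu> \<in> Dom" and J: "finite J" "J \<subseteq> ess \<nu>" and zero: "(\<Sum>q\<in>J. c q *m vec \<nu> q) = 0"
  shows "\<forall>q\<in>J. c q = 0"
proof (rule ccontr)
  assume "\<not> ?thesis"
  then have ne: "{q\<in>J. c q \<noteq> 0} \<noteq> {}" by blast
  have sub: "{q\<in>J. c q \<noteq> 0} \<subseteq> exponents N" using J(2) ess_exponents[OF \<nu>] by auto
  from finite_has_R_greatest[OF _ ne sub] J(1)
  obtain m where m: "m \<in> {q\<in>J. c q \<noteq> 0}" "\<And>q. q \<in> {q\<in>J. c q \<noteq> 0} \<Longrightarrow> (q, m) \<in> R" by auto
  have "c m *m vec \<nu> m = - (\<Sum>q\<in>J - {m}. c q *m vec \<nu> q)"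
    using zero m(1) J(1) by (simp add: sum.remove[of J m] eq_neg_iff_add_eq_0)
  then have "vec \<nu> m = (1 / c m) *m (- (\<Sum>q\<in>J - {m}. c q *m vec \<nu> q))"
    using m(1) by (simp flip: \<open>c m *m vec \<nu> m = - (\<Sum>q\<in>J - {m}. c q *m vec \<nu> q)\<close>)
  also have "\<dots> \<in> M.span (vec \<nu> ` {q. (q, m) \<in> R \<and> q \<noteq> m})"
  proof (rule M.span_scale, rule M.span_neg, rule M.span_sum)
    fix q assume q: "q \<in> J - {m}"
    show "c q *m vec \<nu> q \<in> M.span (vec \<nu> ` {q. (q, m) \<in> R \<and> q \<noteq> m})"
    proof (cases "c q = 0")
      case False
      then show ?thesis using q m(2)[of q] by (intro M.span_scale M.span_base) auto
    qed (simp add: M.span_zero)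
  qed
  finally show False using m(1) J(2) ess_iff[OF \<nu>] by blast
qed

text \<open>For fixed \<open>p\<close> these are coordinates of \<open>vec \<nu> p\<close>; with
  \<open>q\<close> fixed and \<open>p\<close> varying they form the coordinate function attached to
  \<open>q\<close>.\<close>

definition coef :: "('g \<Rightarrow> complex) \<Rightarrow> (nat \<Rightarrow> nat) \<Rightarrow> (nat \<Rightarrow> nat) \<Rightarrow> complex" where
  "coef \<nu> p = (SOME c. (\<forall>q. q \<notin> ess_below \<nu> p \<longrightarrow> c q = 0) \<and> vec \<nu> p = (\<Sum>q\<in>ess_below \<nu> p. c q *m vec \<nu> q))"

lemma coef_zero: "q \<notin> ess_below \<nu> p \<Longrightarrow> coef \<nu> p q = 0"
  and coef_expand_below: "vec \<nu> p = (\<Sum>q\<in>ess_below \<nu> p. coef \<nu> p q *m vec \<nu> q)"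
  if \<nu>: "\<nu> \<in> Dom" and p: "p \<in> exponents N"
proof -
  obtain c where c: "vec \<nu> p = (\<Sum>q\<in>ess_below \<nu> p. c q *m vec \<nu> q)"
    using M.span_image_finite[OF vec_in_span_ess_below[OF \<nu> p] finite_ess_below[OF \<nu>]] .
  define c' where "c' q = (if q \<in> ess_below \<nu> p then c q else 0)" for q
  have "(\<Sum>q\<in>ess_below \<nu> p. c q *m vec \<nu> q) = (\<Sum>q\<in>ess_below \<nu> p. c' q *m vec \<nu> q)"
    by (intro sum.cong refl) (simp add: c'_def)
  then have "\<exists>c. (\<forall>q. q \<notin> ess_below \<nu> p \<longrightarrow> c q = 0) \<and> vec \<nu> p = (\<Sum>q\<in>ess_below \<nu> p. c q *m vec \<nu> q)"
    using c by (intro exI[of _ c']) (auto simp: c'_def)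
  from someI_ex[OF this, folded coef_def]
  show "q \<notin> ess_below \<nu> p \<Longrightarrow> coef \<nu> p q = 0" "vec \<nu> p = (\<Sum>q\<in>ess_below \<nu> p. coef \<nu> p q *m vec \<nu> q)"
    by blast+
qed

lemma coef_expand:
  assumes "\<nu> \<in> Dom" "p \<in> exponents N" "finite J" "ess_below \<nu> p \<subseteq> J"
  shows "vec \<nu> p = (\<Sum>q\<in>J. coef \<nu> p q *m vec \<nu> q)"
proof -
  have "(\<Sum>q\<in>ess_below \<nu> p. coef \<nu> p q *m vec \<nu> q) = (\<Sum>q\<in>J. coef \<nu> p q *m vec \<nu> q)"
    using assms coef_zero by (intro sum.mono_neutral_left) auto
  then show ?thesis using coef_expand_below[OF assms(1,2)] by simp
qed

lemma coef_nonzeroD: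
  assumes "\<nu> \<in> Dom" "p \<in> exponents N" "coef \<nu> p q \<noteq> 0"
  shows "q \<in> ess \<nu>" "deg q = deg p" "(q, p) \<in> R"
  using coef_zero[OF assms(1,2), of q] assms(3) by (auto simp: ess_below_def)

lemma coef_self:
  assumes \<nu>: "\<nu> \<in> Dom" and p: "p \<in> ess \<nu>"
  shows "coef \<nu> p p = 1"
proof -
  have pe: "p \<in> exponents N" using ess_exponents assms .
  have pb: "p \<in> ess_below \<nu> p" using p R_refl[OF pe] by (simp add: ess_below_def)
  have "(\<Sum>q\<in>ess_below \<nu> p. (coef \<nu> p q - (if q = p then 1 else 0)) *m vec \<nu> q) =
     (\<Sum>q\<in>ess_below \<nu> p. coef \<nu> p q *m vec \<nu> q) - (\<Sum>q\<in>ess_below \<nu> p. if q = p then vec \<nu> q else 0)"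
    unfolding sum_subtractf[symmetric] by (intro sum.cong refl) (simp add: M.scale_left_diff_distrib)
  also have "\<dots> = 0" using pb finite_ess_below[OF \<nu>] coef_expand_below[OF \<nu> pe] by simp
  finally have "\<forall>q\<in>ess_below \<nu> p. coef \<nu> p q - (if q = p then 1 else 0) = 0"
    by (intro ess_independent[OF \<nu> finite_ess_below[OF \<nu>]]) (auto simp: ess_below_def)
  then show ?thesis using pb by auto
qed

text \<open>The coefficient of the tensor of \<open>vec \<kappa> q\<close> and
  \<open>vec \<mu> r\<close> in the vector obtained by applying the ordered monomial with exponents
  \<open>p\<close> to the tensor of the highest weight vectors.\<close>

definition conv :: "('g \<Rightarrow> complex) \<Rightarrow> ('g \<Rightarrow> complex) \<Rightarrow> (nat \<Rightarrow> nat) \<Rightarrow> (nat \<Rightarrow> nat) \<Rightarrow> (nat \<Rightarrow> nat) \<Rightarrow> complex" where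
  "conv \<kappa> \<mu> q r p = (\<Sum>s\<in>splits {1..N} p. coef \<kappa> s q * coef \<mu> (p - s) r)"

lemma conv_deg:
  assumes "\<kappa> \<in> Dom" "\<mu> \<in> Dom" "p \<in> exponents N" "conv \<kappa> \<mu> q r p \<noteq> 0"
  shows "deg q + deg r = deg p"
proof -
  obtain s where s: "s \<in> splits {1..N} p" "coef \<kappa> s q * coef \<mu> (p - s) r \<noteq> 0"
    using assms(4) unfolding conv_def by (meson sum.not_neutral_contains_not_neutral)
  note s' = split_exponents[OF assms(3) s(1)]
  have "deg q = deg s" "deg r = deg (p - s)"
    using coef_nonzeroD(2)[OF assms(1) s'(1)] coef_nonzeroD(2)[OF assms(2) s'(2)] s(2) by auto
  then show ?thesis using deg_add[of s "p - s"] s'(3) by simp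
qed

section \<open>Comparing V(kappa + mu) with the tensor product\<close>

context
  fixes \<kappa> \<mu> assumes \<kappa>: "\<kappa> \<in> Dom" and \<mu>: "\<mu> \<in> Dom"
begin

interpretation A: cartan_module scale bracket T P mscale "V \<kappa>" "act \<kappa>" by (rule cartan_module_V[OF \<kappa>])
interpretation B: cartan_module scale bracket T P mscale "V \<mu>" "act \<mu>" by (rule cartan_module_V[OF \<mu>])
interpretation TM: two_lie_modules scale bracket mscale "V \<kappa>" "act \<kappa>" "V \<mu>" "act \<mu>" by unfold_locales

text \<open>The ordered monomial with exponents \<open>p\<close> applied to the tensor of the two
  highest weight vectors, in the form given by \<open>tensor_ordered_product\<close>.\<close>

definition tvec :: "(nat \<Rightarrow> nat) \<Rightarrow> ('v \<Rightarrow> complex) \<Rightarrow> 'v" where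
  "tvec p = (\<Sum>s\<in>splits {1..N} p. TM.tensor (vec \<kappa> s) (vec \<mu> (p - s)))"

lemma relation_tvec:
  "Q \<subseteq> exponents N \<Longrightarrow> (\<Sum>p\<in>Q. c p *m vec (\<kappa> + \<mu>) p) = 0 \<longleftrightarrow> (\<Sum>p\<in>Q. TM.tensor_scale (c p) (tvec p)) = 0"
  unfolding tvec_def by (rule relation_transfer[OF \<kappa> \<mu>])

lemma vec_V: "vec \<kappa> p \<in> V \<kappa>"
  using vec_deg_space[OF \<kappa>] by (auto simp: deg_space_def)

lemma tvec_expand:
  assumes p: "p \<in> exponents N" "deg p \<le> d"
  shows "tvec p = (\<Sum>q\<in>{q\<in>ess \<kappa>. deg q \<le> d}. \<Sum>r\<in>{r\<in>ess \<mu>. deg r \<le> d}.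
     TM.tensor_scale (conv \<kappa> \<mu> q r p) (TM.tensor (vec \<kappa> q) (vec \<mu> r)))"
proof -
  let ?J1 = "{q\<in>ess \<kappa>. deg q \<le> d}" and ?J2 = "{r\<in>ess \<mu>. deg r \<le> d}"
  have "TM.tensor (vec \<kappa> s) (vec \<mu> (p - s)) = (\<Sum>q\<in>?J1. \<Sum>r\<in>?J2.
      TM.tensor_scale (coef \<kappa> s q * coef \<mu> (p - s) r) (TM.tensor (vec \<kappa> q) (vec \<mu> r)))"
    if s: "s \<in> splits {1..N} p" for s
  proof -
    note s' = split_exponents[OF p(1) s]
    have "deg s + deg (p - s) = deg p" using s'(3) deg_add by metis
    then have le: "deg s \<le> d" "deg (p - s) \<le> d" using deg_nonneg[of s] deg_nonneg[of "p - s"] p(2) by auto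
    have 1: "vec \<kappa> s = (\<Sum>q\<in>?J1. coef \<kappa> s q *m vec \<kappa> q)"
      using le by (intro coef_expand[OF \<kappa> s'(1) finite_ess_deg_le[OF \<kappa>]]) (auto simp: ess_below_def)
    have 2: "vec \<mu> (p - s) = (\<Sum>r\<in>?J2. coef \<mu> (p - s) r *m vec \<mu> r)"
      using le by (intro coef_expand[OF \<mu> s'(2) finite_ess_deg_le[OF \<mu>]]) (auto simp: ess_below_def)
    show ?thesis by (subst 1, subst 2) (rule TM.tensor_sum_sum, rule vec_V)
  qed
  then have "tvec p = (\<Sum>s\<in>splits {1..N} p. \<Sum>q\<in>?J1. \<Sum>r\<in>?J2.
      TM.tensor_scale (coef \<kappa> s q * coef \<mu> (p - s) r) (TM.tensor (vec \<kappa> q) (vec \<mu> r)))"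
    unfolding tvec_def by (rule sum.cong[OF refl])
  also have "\<dots> = (\<Sum>q\<in>?J1. \<Sum>s\<in>splits {1..N} p. \<Sum>r\<in>?J2.
      TM.tensor_scale (coef \<kappa> s q * coef \<mu> (p - s) r) (TM.tensor (vec \<kappa> q) (vec \<mu> r)))"
    by (rule sum.swap)
  also have "\<dots> = (\<Sum>q\<in>?J1. \<Sum>r\<in>?J2. \<Sum>s\<in>splits {1..N} p.
      TM.tensor_scale (coef \<kappa> s q * coef \<mu> (p - s) r) (TM.tensor (vec \<kappa> q) (vec \<mu> r)))"
    by (rule sum.cong[OF refl], rule sum.swap)
  also have "\<dots> = (\<Sum>q\<in>?J1. \<Sum>r\<in>?J2. TM.tensor_scale (conv \<kappa> \<mu> q r p) (TM.tensor (vec \<kappa> q) (vec \<mu> r)))"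
    unfolding conv_def TM.TS.scale_sum_left ..
  finally show ?thesis .
qed

text \<open>The expansion of \<open>vec (\<kappa> + \<mu>) p\<close> in essential vectors is a
  linear relation, hence holds for \<open>tvec\<close> as well. Comparing the coefficients of
  tensors of essential vectors gives the formula.\<close>

lemma conv_in_coef_span:
  assumes q: "q \<in> ess \<kappa>" and r: "r \<in> ess \<mu>" and p: "p \<in> exponents N"
  shows "conv \<kappa> \<mu> q r p = (\<Sum>s\<in>ess_below (\<kappa> + \<mu>) p. coef (\<kappa> + \<mu>) p s * conv \<kappa> \<mu> q r s)"
proof -
  define \<nu> where "\<nu> = \<kappa> + \<mu>"
  have \<nu>: "\<nu> \<in> Dom" unfolding \<nu>_def by (rule dominant_weights_add[OF \<kappa> \<mu>])
  let ?Q = "insert p (ess_below \<nu> p)"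
  define c where "c x = coef \<nu> p x - (if x = p then 1 else 0)" for x
  have finQ: "finite ?Q" using finite_ess_below[OF \<nu>] by simp
  have Qe: "?Q \<subseteq> exponents N" using p R_field by (auto simp: ess_below_def)
  have Qd: "deg x = deg p" if "x \<in> ?Q" for x using that by (auto simp: ess_below_def)
  have "(\<Sum>x\<in>?Q. c x *m vec \<nu> x) = (\<Sum>x\<in>?Q. coef \<nu> p x *m vec \<nu> x) - (\<Sum>x\<in>?Q. if x = p then vec \<nu> x else 0)"
    unfolding sum_subtractf[symmetric] c_def by (intro sum.cong refl) (simp add: M.scale_left_diff_distrib)
  also have "(\<Sum>x\<in>?Q. coef \<nu> p x *m vec \<nu> x) = vec \<nu> p"
    by (rule coef_expand[OF \<nu> p finQ, symmetric]) auto
  also have "(\<Sum>x\<in>?Q. if x = p then vec \<nu> x else 0) = vec \<nu> p" using finQ by (simp add: sum.delta)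
  finally have "(\<Sum>x\<in>?Q. c x *m vec \<nu> x) = 0" by simp
  then have 0: "(\<Sum>x\<in>?Q. TM.tensor_scale (c x) (tvec x)) = 0"
    unfolding \<nu>_def by (rule iffD1[OF relation_tvec[OF Qe[unfolded \<nu>_def]]])
  \<comment> \<open>Large enough to include \<open>q\<close>, \<open>r\<close> and the degree of
    every exponent in the relation.\<close>
  define d where "d = deg p + deg q + deg r"
  let ?J1 = "{q\<in>ess \<kappa>. deg q \<le> d}" and ?J2 = "{r\<in>ess \<mu>. deg r \<le> d}"
  have "(\<Sum>x\<in>?Q. TM.tensor_scale (c x) (tvec x)) = (\<Sum>x\<in>?Q. \<Sum>q\<in>?J1. \<Sum>r\<in>?J2.
      TM.tensor_scale (c x * conv \<kappa> \<mu> q r x) (TM.tensor (vec \<kappa> q) (vec \<mu> r)))"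
  proof (intro sum.cong refl)
    fix x assume x: "x \<in> ?Q"
    then have "x \<in> exponents N" "deg x \<le> d" using Qe Qd[OF x] deg_nonneg[of q] deg_nonneg[of r] by (auto simp: d_def)
    then show "TM.tensor_scale (c x) (tvec x) = (\<Sum>q\<in>?J1. \<Sum>r\<in>?J2. TM.tensor_scale (c x * conv \<kappa> \<mu> q r x) (TM.tensor (vec \<kappa> q) (vec \<mu> r)))"
      by (simp only: tvec_expand TM.TS.scale_sum_right TM.TS.scale_scale)
  qed
  also have "\<dots> = (\<Sum>q\<in>?J1. \<Sum>x\<in>?Q. \<Sum>r\<in>?J2. TM.tensor_scale (c x * conv \<kappa> \<mu> q r x) (TM.tensor (vec \<kappa> q) (vec \<mu> r)))"
    by (rule sum.swap)
  also have "\<dots> = (\<Sum>q\<in>?J1. \<Sum>r\<in>?J2. \<Sum>x\<in>?Q. TM.tensor_scale (c x * conv \<kappa> \<mu> q r x) (TM.tensor (vec \<kappa> q) (vec \<mu> r)))"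
    by (rule sum.cong[OF refl], rule sum.swap)
  also have "\<dots> = (\<Sum>q\<in>?J1. \<Sum>r\<in>?J2. TM.tensor_scale (\<Sum>x\<in>?Q. c x * conv \<kappa> \<mu> q r x) (TM.tensor (vec \<kappa> q) (vec \<mu> r)))"
    unfolding TM.TS.scale_sum_left ..
  finally have zero: "(\<Sum>q\<in>?J1. \<Sum>r\<in>?J2. TM.tensor_scale (\<Sum>x\<in>?Q. c x * conv \<kappa> \<mu> q r x) (TM.tensor (vec \<kappa> q) (vec \<mu> r))) = 0"
    using 0 by simp
  have "(\<Sum>x\<in>?Q. c x * conv \<kappa> \<mu> q r x) = 0"
  proof (rule TM.tensor_sum_independent[where x = "vec \<kappa>" and y = "vec \<mu>" and a = "\<lambda>q r. \<Sum>x\<in>?Q. c x * conv \<kappa> \<mu> q r x",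
          OF finite_ess_deg_le[OF \<kappa>] finite_ess_deg_le[OF \<mu>] vec_V _ _ zero])
    show "\<forall>i\<in>?J1. c i = 0" if "(\<Sum>i\<in>?J1. c i *m vec \<kappa> i) = 0" for c
      by (rule ess_independent[OF \<kappa> finite_ess_deg_le[OF \<kappa>] _ that]) auto
    show "\<forall>i\<in>?J2. c i = 0" if "(\<Sum>i\<in>?J2. c i *m vec \<mu> i) = 0" for c
      by (rule ess_independent[OF \<mu> finite_ess_deg_le[OF \<mu>] _ that]) auto
  qed (use q r deg_nonneg in \<open>auto simp: d_def add_nonneg_nonneg\<close>)
  moreover have "(\<Sum>x\<in>?Q. c x * conv \<kappa> \<mu> q r x) = (\<Sum>x\<in>?Q. coef \<nu> p x * conv \<kappa> \<mu> q r x) - (\<Sum>x\<in>?Q. if x = p then conv \<kappa> \<mu> q r x else 0)"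
    unfolding sum_subtractf[symmetric] c_def by (intro sum.cong refl) (simp add: left_diff_distrib)
  moreover have "(\<Sum>x\<in>?Q. if x = p then conv \<kappa> \<mu> q r x else 0) = conv \<kappa> \<mu> q r p" using finQ by (simp add: sum.delta)
  moreover have "(\<Sum>x\<in>?Q. coef \<nu> p x * conv \<kappa> \<mu> q r x) = (\<Sum>x\<in>ess_below \<nu> p. coef \<nu> p x * conv \<kappa> \<mu> q r x)"
    using finQ coef_zero[OF \<nu> p] by (intro sum.mono_neutral_right) auto
  ultimately show ?thesis unfolding \<nu>_def by simp
qed

text \<open>Transferring relations in the other direction keeps the vectors \<open>tvec x\<close>,
  for essential \<open>x\<close> of one degree, independent. A functional dual to
  \<open>tvec s\<close> among them recovers \<open>coef (\<kappa> + \<mu>) p s\<close> from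
  \<open>tvec p\<close>, and its values on tensors of essential vectors are the coefficients
  \<open>X\<close>.\<close>

lemma coef_in_conv_span:
  assumes s: "s \<in> ess (\<kappa> + \<mu>)"
  obtains X where "\<And>p. p \<in> exponents N \<Longrightarrow> coef (\<kappa> + \<mu>) p s =
    (\<Sum>(q, r)\<in>{(q, r). q \<in> ess \<kappa> \<and> r \<in> ess \<mu> \<and> deg q + deg r = deg s}. X q r * conv \<kappa> \<mu> q r p)"
proof -
  define \<nu> where "\<nu> = \<kappa> + \<mu>"
  have \<nu>: "\<nu> \<in> Dom" unfolding \<nu>_def by (rule dominant_weights_add[OF \<kappa> \<mu>])
  define d where "d = deg s"
  let ?J1 = "{q\<in>ess \<kappa>. deg q \<le> d}" and ?J2 = "{r\<in>ess \<mu>. deg r \<le> d}"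
  let ?Z = "{(q, r). q \<in> ess \<kappa> \<and> r \<in> ess \<mu> \<and> deg q + deg r = d}"
  define J where "J = {x\<in>ess \<nu>. deg x = d}"
  have finJ: "finite J" by (rule finite_subset[OF _ finite_ess_deg_le[OF \<nu>, of d]]) (auto simp: J_def)
  have Je: "J \<subseteq> exponents N" using ess_exponents[OF \<nu>] by (auto simp: J_def)
  have ind: "\<forall>x\<in>J. c x = 0" if "(\<Sum>x\<in>J. TM.tensor_scale (c x) (tvec x)) = 0" for c
  proof (rule ess_independent[OF \<nu> finJ])
    show "(\<Sum>x\<in>J. c x *m vec \<nu> x) = 0" unfolding \<nu>_def using relation_tvec[OF Je, of c] that by (simp only:)
  qed (auto simp: J_def)
  have sJ: "s \<in> J" using s by (simp add: J_def d_def \<nu>_def)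
  obtain h where h: "\<And>u v. h (u + v) = h u + h v" "\<And>c u. h (TM.tensor_scale c u) = c * h u"
    "\<And>x. x \<in> J \<Longrightarrow> h (tvec x) = (if x = s then 1 else 0)"
    using TM.TS.dual_functional_exists[OF finJ ind sJ] by blast
  have h0: "h 0 = 0" using h(2)[of 0 0] by simp
  have hsum: "h (sum g I) = (\<Sum>i\<in>I. h (g i))" for g and I :: "'z set"
    by (induction I rule: infinite_finite_induct) (simp_all only: sum.infinite sum.empty sum.insert not_False_eq_True h0 h(1))
  define X where "X q r = h (TM.tensor (vec \<kappa> q) (vec \<mu> r))" for q r
  have "coef \<nu> p s = (\<Sum>(q, r)\<in>?Z. X q r * conv \<kappa> \<mu> q r p)" if p: "p \<in> exponents N" for p
  proof (cases "deg p = d")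
    case False
    have "coef \<nu> p s = 0" using coef_nonzeroD(2)[OF \<nu> p, of s] False by (auto simp: d_def)
    moreover have "(\<Sum>(q, r)\<in>?Z. X q r * conv \<kappa> \<mu> q r p) = 0"
      using conv_deg[OF \<kappa> \<mu> p] False by (intro sum.neutral) auto
    ultimately show ?thesis by simp
  next
    case True
    have below: "ess_below \<nu> p \<subseteq> J" using True by (auto simp: ess_below_def J_def)
    define c where "c x = (if x \<in> J then coef \<nu> p x else 0) - (if x = p then 1 else 0)" for x
    let ?Q = "insert p J"
    have finQ: "finite ?Q" using finJ by simp
    have Qe: "?Q \<subseteq> exponents N" using p Je by simp
    have "(\<Sum>x\<in>?Q. c x *m vec \<nu> x) = (\<Sum>x\<in>?Q. if x \<in> J then coef \<nu> p x *m vec \<nu> x else 0) - (\<Sum>x\<in>?Q. if x = p then vec \<nu> x else 0)"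
      unfolding sum_subtractf[symmetric] c_def by (intro sum.cong refl) (simp add: M.scale_left_diff_distrib)
    also have "(\<Sum>x\<in>?Q. if x \<in> J then coef \<nu> p x *m vec \<nu> x else 0) = (\<Sum>x\<in>J. coef \<nu> p x *m vec \<nu> x)"
      using finQ by (intro sum.mono_neutral_cong_right) auto
    also have "\<dots> = vec \<nu> p" by (rule coef_expand[OF \<nu> p finJ below, symmetric])
    also have "(\<Sum>x\<in>?Q. if x = p then vec \<nu> x else 0) = vec \<nu> p" using finQ by (simp add: sum.delta)
    finally have "(\<Sum>x\<in>?Q. c x *m vec \<nu> x) = 0" by simp
    then have "(\<Sum>x\<in>?Q. TM.tensor_scale (c x) (tvec x)) = 0"
      unfolding \<nu>_def by (rule iffD1[OF relation_tvec[OF Qe]])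
    also have "(\<Sum>x\<in>?Q. TM.tensor_scale (c x) (tvec x)) =
        (\<Sum>x\<in>?Q. if x \<in> J then TM.tensor_scale (coef \<nu> p x) (tvec x) else 0) - (\<Sum>x\<in>?Q. if x = p then tvec x else 0)"
      unfolding sum_subtractf[symmetric] c_def by (intro sum.cong refl) (simp add: TM.TS.scale_left_diff_distrib)
    also have "(\<Sum>x\<in>?Q. if x \<in> J then TM.tensor_scale (coef \<nu> p x) (tvec x) else 0) = (\<Sum>x\<in>J. TM.tensor_scale (coef \<nu> p x) (tvec x))"
      using finQ by (intro sum.mono_neutral_cong_right) auto
    also have "(\<Sum>x\<in>?Q. if x = p then tvec x else 0) = tvec p" using finQ by (simp add: sum.delta)
    finally have tp: "tvec p = (\<Sum>x\<in>J. TM.tensor_scale (coef \<nu> p x) (tvec x))"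
      unfolding right_minus_eq by (rule sym)
    have "h (tvec p) = (\<Sum>x\<in>J. if x = s then coef \<nu> p x else 0)"
      unfolding tp hsum h(2) by (intro sum.cong refl) (simp add: h(3))
    then have hp: "h (tvec p) = coef \<nu> p s" using finJ sJ by simp
    have "h (tvec p) = (\<Sum>q\<in>?J1. \<Sum>r\<in>?J2. conv \<kappa> \<mu> q r p * X q r)"
      unfolding tvec_expand[OF p eq_refl[OF True]] hsum h(2) X_def ..
    also have "\<dots> = (\<Sum>(q, r)\<in>?J1 \<times> ?J2. conv \<kappa> \<mu> q r p * X q r)" by (rule sum.cartesian_product)
    also have "\<dots> = (\<Sum>(q, r)\<in>?Z. X q r * conv \<kappa> \<mu> q r p)"
    proof (rule sum.mono_neutral_cong_right)
      show "finite (?J1 \<times> ?J2)" using finite_ess_deg_le \<kappa> \<mu> by blast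
      show "?Z \<subseteq> ?J1 \<times> ?J2"
      proof -
        have "deg q \<le> d \<and> deg r \<le> d" if "deg q + deg r = d" for q r
          using that deg_nonneg[of q] deg_nonneg[of r] by linarith
        then show ?thesis by blast
      qed
      show "\<forall>i\<in>?J1 \<times> ?J2 - ?Z. (case i of (q, r) \<Rightarrow> conv \<kappa> \<mu> q r p * X q r) = 0"
        using conv_deg[OF \<kappa> \<mu> p] True by auto
    qed (auto simp: mult.commute)
    finally show ?thesis unfolding hp .
  qed
  then show thesis using that[of X] unfolding \<nu>_def d_def by blast
qed

end

end


section \<open>The algebra of coordinate functions\<close>

abbreviation lookup :: "('a \<Rightarrow>\<^sub>0 'b::zero) \<Rightarrow> 'a \<Rightarrow> 'b" where
  "lookup \<equiv> Poly_Mapping.lookup"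

abbreviation keys :: "('a \<Rightarrow>\<^sub>0 'b::zero) \<Rightarrow> 'a set" where
  "keys \<equiv> Poly_Mapping.keys"

lemma poly_mapping_expand:
  assumes "finite A" "keys f \<subseteq> A"
  shows "f = (\<Sum>a\<in>A. Poly_Mapping.single a (lookup f a))"
proof (rule poly_mapping_eqI)
  fix k
  have "lookup (\<Sum>a\<in>A. Poly_Mapping.single a (lookup f a)) k = (\<Sum>a\<in>A. if a = k then lookup f a else 0)"
    unfolding lookup_sum by (intro sum.cong refl) (simp add: lookup_single when_def)
  then show "lookup f k = lookup (\<Sum>a\<in>A. Poly_Mapping.single a (lookup f a)) k"
    using assms by (auto simp: in_keys_iff)
qed

lemma lookup_mult_sum:
  fixes f g :: "'a::monoid_add \<Rightarrow>\<^sub>0 'b::semiring_0"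
  assumes "finite A" "keys f \<subseteq> A" "finite B" "keys g \<subseteq> B"
  shows "lookup (f * g) k = (\<Sum>a\<in>A. \<Sum>b\<in>B. if a + b = k then lookup f a * lookup g b else 0)"
proof -
  have "f * g = (\<Sum>a\<in>A. \<Sum>b\<in>B. Poly_Mapping.single (a + b) (lookup f a * lookup g b))"
    by (subst poly_mapping_expand[OF assms(1,2)], subst poly_mapping_expand[OF assms(3,4)])
       (simp add: sum_product mult_single)
  then show ?thesis by (simp add: lookup_sum lookup_single when_def)
qed

definition pscale :: "complex \<Rightarrow> ('a::comm_monoid_add \<Rightarrow>\<^sub>0 complex) \<Rightarrow> ('a \<Rightarrow>\<^sub>0 complex)" where
  "pscale c f = Poly_Mapping.single 0 c * f"

lemma lookup_pscale: "lookup (pscale c f) k = c * lookup f k"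
proof -
  have "lookup (pscale c f) k = (\<Sum>a\<in>{0}. \<Sum>b\<in>keys f. if a + b = k then lookup (Poly_Mapping.single 0 c) a * lookup f b else 0)"
    unfolding pscale_def by (rule lookup_mult_sum) auto
  then show ?thesis by (auto simp: in_keys_iff)
qed

lemma pscale_mult_left: "pscale c f * g = pscale c (f * g)"
  and pscale_mult_right: "f * pscale c g = pscale c (f * g)"
  by (simp_all add: pscale_def mult_ac)

interpretation PS: vector_space pscale
  by unfold_locales
     (simp_all add: pscale_def distrib_left distrib_right single_add mult.assoc[symmetric] mult_single)

section \<open>Coordinate functions in the monoid algebra of signatures\<close>

context essential_setting
begin

text \<open>Placed in the monoid algebra, coordinate functions multiply by the convolution
  \<open>conv\<close>, and the weight stored in every key grades the product. The support is finite
  for essential \<open>\<sigma>\<close> because the degree is fixed.\<close>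

definition essential_poly :: "'g signature \<Rightarrow> 'g signature \<Rightarrow>\<^sub>0 complex" where
  "essential_poly \<sigma> = Abs_poly_mapping
     (\<lambda>\<tau>. if fst \<tau> = fst \<sigma> \<and> snd \<tau> \<in> exponents N then coef (fst \<sigma>) (snd \<tau>) (snd \<sigma>) else 0)"

definition level :: "('g \<Rightarrow> complex) \<Rightarrow> real \<Rightarrow> 'g signature set" where
  "level \<nu> d = {\<tau>. fst \<tau> = \<nu> \<and> snd \<tau> \<in> exponents N \<and> deg (snd \<tau>) = d}"

lemma finite_level: "finite (level \<nu> d)"
proof (rule finite_subset)
  show "level \<nu> d \<subseteq> {\<nu>} \<times> {p\<in>exponents N. deg p \<le> d}" by (auto simp: level_def)
qed (simp add: finite_deg_le)

lemma essential_iff: "\<sigma> \<in> essential_signatures \<longleftrightarrow> fst \<sigma> \<in> Dom \<and> snd \<sigma> \<in> ess (fst \<sigma>)"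
  by (cases \<sigma>) (auto simp: ess_def essential_signatures_def signatures_def)

lemma essential_exponents: "\<sigma> \<in> essential_signatures \<Longrightarrow> snd \<sigma> \<in> exponents N"
  using essential_iff ess_exponents by blast

lemma lookup_essential_poly:
  assumes "\<sigma> \<in> essential_signatures"
  shows "lookup (essential_poly \<sigma>) \<tau> =
    (if fst \<tau> = fst \<sigma> \<and> snd \<tau> \<in> exponents N then coef (fst \<sigma>) (snd \<tau>) (snd \<sigma>) else 0)"
proof -
  have "{\<tau>. (if fst \<tau> = fst \<sigma> \<and> snd \<tau> \<in> exponents N then coef (fst \<sigma>) (snd \<tau>) (snd \<sigma>) else 0) \<noteq> 0}
      \<subseteq> level (fst \<sigma>) (deg (snd \<sigma>))"
    using assms coef_nonzeroD(2) by (auto simp: level_def essential_iff split: if_splits)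
  then have "finite {\<tau>. (if fst \<tau> = fst \<sigma> \<and> snd \<tau> \<in> exponents N then coef (fst \<sigma>) (snd \<tau>) (snd \<sigma>) else 0) \<noteq> 0}"
    using finite_level finite_subset by blast
  then show ?thesis by (simp add: essential_poly_def)
qed

definition sig_le :: "'g signature \<Rightarrow> 'g signature \<Rightarrow> bool" where
  "sig_le \<sigma> \<tau> \<longleftrightarrow> fst \<sigma> = fst \<tau> \<and> (snd \<sigma>, snd \<tau>) \<in> R"

lemma sig_le_trans: "sig_le \<rho> \<sigma> \<Longrightarrow> sig_le \<sigma> \<tau> \<Longrightarrow> sig_le \<rho> \<tau>"
  and sig_le_antisym: "sig_le \<sigma> \<tau> \<Longrightarrow> sig_le \<tau> \<sigma> \<Longrightarrow> \<sigma> = \<tau>"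
  and sig_le_refl: "snd \<sigma> \<in> exponents N \<Longrightarrow> sig_le \<sigma> \<sigma>"
  using R_trans R_antisym R_refl by (auto simp: sig_le_def prod_eq_iff)

lemma sig_le_add_right: "sig_le \<sigma> \<tau> \<Longrightarrow> snd \<rho> \<in> exponents N \<Longrightarrow> sig_le (\<sigma> + \<rho>) (\<tau> + \<rho>)"
  unfolding sig_le_def fst_add snd_add using R_add by metis

lemma sig_le_add:
  assumes "sig_le \<sigma> \<sigma>'" "sig_le \<tau> \<tau>'"
  shows "sig_le (\<sigma> + \<tau>) (\<sigma>' + \<tau>')"
proof -
  have "sig_le (\<sigma> + \<tau>) (\<sigma>' + \<tau>)" by (rule sig_le_add_right[OF assms(1)]) (use assms(2) R_field in \<open>auto simp: sig_le_def\<close>)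
  moreover have "sig_le (\<tau> + \<sigma>') (\<tau>' + \<sigma>')" by (rule sig_le_add_right[OF assms(2)]) (use assms(1) R_field in \<open>auto simp: sig_le_def\<close>)
  ultimately show ?thesis using sig_le_trans by (metis add.commute)
qed

text \<open>Strict inequalities survive addition, so a sum of two least terms arises in only one
  way. This makes leading signatures multiplicative.\<close>

lemma sig_le_add_eq:
  assumes "sig_le \<sigma> \<sigma>'" "sig_le \<tau> \<tau>'" "\<sigma>' + \<tau>' = \<sigma> + \<tau>"
  shows "\<sigma>' = \<sigma> \<and> \<tau>' = \<tau>"
proof -
  have 1: "sig_le (\<sigma> + \<tau>) (\<sigma>' + \<tau>)" by (rule sig_le_add_right[OF assms(1)]) (use assms(2) R_field in \<open>auto simp: sig_le_def\<close>)
  have "sig_le (\<tau> + \<sigma>') (\<tau>' + \<sigma>')" by (rule sig_le_add_right[OF assms(2)]) (use assms(1) R_field in \<open>auto simp: sig_le_def\<close>)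
  then have "sig_le (\<sigma>' + \<tau>) (\<sigma> + \<tau>)" using assms(3) by (metis add.commute)
  from sig_le_antisym[OF this 1] have "\<sigma>' = \<sigma>" by (rule add_right_imp_eq)
  then show ?thesis using assms(3) add_left_imp_eq by blast
qed

lemma sig_total: "\<sigma> \<in> level \<nu> d \<Longrightarrow> \<tau> \<in> level \<nu> d \<Longrightarrow> sig_le \<sigma> \<tau> \<or> sig_le \<tau> \<sigma>"
  using R_total by (auto simp: level_def sig_le_def)

lemma finite_has_least:
  assumes "finite J" "J \<noteq> {}" "J \<subseteq> level \<nu> d"
  obtains \<mu> where "\<mu> \<in> J" "\<And>\<tau>. \<tau> \<in> J \<Longrightarrow> sig_le \<mu> \<tau>"
proof -
  have "\<exists>\<mu>\<in>J. \<forall>\<tau>\<in>J. sig_le \<mu> \<tau>"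
    using assms
  proof (induction J rule: finite_ne_induct)
    case (singleton x)
    then show ?case using sig_le_refl by (auto simp: level_def)
  next
    case (insert x J)
    then obtain \<mu> where \<mu>: "\<mu> \<in> J" "\<forall>\<tau>\<in>J. sig_le \<mu> \<tau>" by auto
    show ?case
    proof (cases "sig_le \<mu> x")
      case False
      then have x: "sig_le x \<mu>" using sig_total insert.prems \<mu>(1) by blast
      have "sig_le x x" using sig_le_refl insert.prems by (auto simp: level_def)
      then have "\<forall>\<tau>\<in>insert x J. sig_le x \<tau>" using x \<mu>(2) sig_le_trans by blast
      then show ?thesis by blast
    qed (use \<mu> in blast)
  qed
  with that show thesis by blast
qed

text \<open>The least term leads, because \<open>coef \<nu> p q\<close> vanishes unless
  \<open>q\<close> is at most \<open>p\<close>.\<close>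

definition leads :: "('g signature \<Rightarrow>\<^sub>0 complex) \<Rightarrow> 'g signature \<Rightarrow> bool" where
  "leads f \<sigma> \<longleftrightarrow> lookup f \<sigma> = 1 \<and> (\<forall>\<tau>\<in>keys f. sig_le \<sigma> \<tau>)"

lemma leads_essential_poly: "\<sigma> \<in> essential_signatures \<Longrightarrow> leads (essential_poly \<sigma>) \<sigma>"
  using coef_self coef_nonzeroD(3) essential_exponents
  by (auto simp: leads_def lookup_essential_poly in_keys_iff sig_le_def essential_iff split: if_splits)

lemma leads_mult:
  assumes "leads f \<sigma>" "leads g \<tau>"
  shows "leads (f * g) (\<sigma> + \<tau>)"
proof -
  have keys: "\<sigma> \<in> keys f" "\<tau> \<in> keys g" using assms by (auto simp: leads_def in_keys_iff)
  have "lookup (f * g) (\<sigma> + \<tau>) = (\<Sum>a\<in>keys f. \<Sum>b\<in>keys g. if a + b = \<sigma> + \<tau> then lookup f a * lookup g b else 0)"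
    by (rule lookup_mult_sum) auto
  also have "\<dots> = (\<Sum>a\<in>keys f. \<Sum>b\<in>keys g. if a = \<sigma> then if b = \<tau> then lookup f \<sigma> * lookup g \<tau> else 0 else 0)"
  proof (intro sum.cong refl)
    fix a b assume "a \<in> keys f" "b \<in> keys g"
    then have "a + b = \<sigma> + \<tau> \<longleftrightarrow> a = \<sigma> \<and> b = \<tau>" using assms sig_le_add_eq unfolding leads_def by blast
    then show "(if a + b = \<sigma> + \<tau> then lookup f a * lookup g b else 0) =
        (if a = \<sigma> then if b = \<tau> then lookup f \<sigma> * lookup g \<tau> else 0 else 0)" by simp
  qed
  also have "\<dots> = (\<Sum>a\<in>keys f. if a = \<sigma> then \<Sum>b\<in>keys g. if b = \<tau> then lookup f \<sigma> * lookup g \<tau> else 0 else 0)"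
    by (intro sum.cong refl) auto
  also have "\<dots> = 1" using keys assms by (simp add: leads_def)
  finally show ?thesis
    using keys_mult[of f g] assms sig_le_add unfolding leads_def by blast
qed

definition essential_space :: "('g \<Rightarrow> complex) \<Rightarrow> real \<Rightarrow> ('g signature \<Rightarrow>\<^sub>0 complex) set" where
  "essential_space \<nu> d = PS.span (essential_poly ` {\<sigma>\<in>essential_signatures. \<sigma> \<in> level \<nu> d})"

lemma essential_level: "\<sigma> \<in> essential_signatures \<Longrightarrow> \<sigma> \<in> level (fst \<sigma>) (deg (snd \<sigma>))"
  using essential_exponents by (simp add: level_def)

lemma essential_poly_in_space:
  "\<sigma> \<in> essential_signatures \<Longrightarrow> essential_poly \<sigma> \<in> essential_space (fst \<sigma>) (deg (snd \<sigma>))"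
  unfolding essential_space_def using essential_level by (intro PS.span_base) auto

lemma keys_essential_poly: "\<sigma> \<in> essential_signatures \<Longrightarrow> keys (essential_poly \<sigma>) \<subseteq> level (fst \<sigma>) (deg (snd \<sigma>))"
  using coef_nonzeroD(2)
  by (auto simp: in_keys_iff lookup_essential_poly level_def essential_iff split: if_splits)

lemma subspace_keys: "PS.subspace {f. keys f \<subseteq> U}"
  unfolding PS.subspace_def
  by (auto simp: in_keys_iff lookup_add lookup_pscale) (metis add_0 subsetD in_keys_iff)+

lemma keys_essential_space: "f \<in> essential_space \<nu> d \<Longrightarrow> keys f \<subseteq> level \<nu> d"
proof -
  have "essential_poly ` {\<sigma>\<in>essential_signatures. \<sigma> \<in> level \<nu> d} \<subseteq> {f. keys f \<subseteq> level \<nu> d}"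
    using keys_essential_poly by (fastforce simp: level_def)
  from PS.span_minimal[OF this subspace_keys] show "f \<in> essential_space \<nu> d \<Longrightarrow> keys f \<subseteq> level \<nu> d"
    by (auto simp: essential_space_def)
qed

text \<open>The spanning functions have distinct leading signatures, so the least one occurring with
  nonzero coefficient cannot be cancelled.\<close>

lemma essential_space_lead:
  assumes f: "f \<in> essential_space \<nu> d" "f \<noteq> 0"
  obtains \<sigma> where "\<sigma> \<in> essential_signatures" "\<sigma> \<in> keys f" "\<And>\<tau>. \<tau> \<in> keys f \<Longrightarrow> sig_le \<sigma> \<tau>"
proof -
  let ?J = "{\<sigma>\<in>essential_signatures. \<sigma> \<in> level \<nu> d}"
  have finJ: "finite ?J" by (rule finite_subset[OF _ finite_level[of \<nu> d]]) auto
  obtain c where c: "f = (\<Sum>\<sigma>\<in>?J. pscale (c \<sigma>) (essential_poly \<sigma>))"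
    using PS.span_image_finite[OF f(1)[unfolded essential_space_def] finJ] .
  let ?J' = "{\<sigma>\<in>?J. c \<sigma> \<noteq> 0}"
  have "finite ?J'" by (rule finite_subset[OF _ finJ]) auto
  moreover have "?J' \<noteq> {}"
  proof
    assume "?J' = {}"
    then have "f = 0" unfolding c by (intro sum.neutral) auto
    then show False using f(2) by simp
  qed
  moreover have "?J' \<subseteq> level \<nu> d" by auto
  ultimately obtain \<sigma> where \<sigma>: "\<sigma> \<in> ?J'" "\<And>\<tau>. \<tau> \<in> ?J' \<Longrightarrow> sig_le \<sigma> \<tau>"
    by (rule finite_has_least) (rule that)
  have lookup_f: "lookup f \<tau> = (\<Sum>\<rho>\<in>?J. c \<rho> * lookup (essential_poly \<rho>) \<tau>)" for \<tau>
    by (subst c) (simp add: lookup_sum lookup_pscale)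
  have lower: "sig_le \<rho> \<tau>" if "\<rho> \<in> ?J" "lookup (essential_poly \<rho>) \<tau> \<noteq> 0" for \<rho> \<tau>
    using leads_essential_poly[of \<rho>] that by (auto simp: leads_def in_keys_iff)
  have "lookup f \<sigma> = (\<Sum>\<rho>\<in>?J. if \<rho> = \<sigma> then c \<sigma> else 0)"
    unfolding lookup_f
  proof (intro sum.cong refl)
    fix \<rho> assume \<rho>: "\<rho> \<in> ?J"
    show "c \<rho> * lookup (essential_poly \<rho>) \<sigma> = (if \<rho> = \<sigma> then c \<sigma> else 0)"
    proof (cases "\<rho> = \<sigma>")
      case True
      then show ?thesis using leads_essential_poly[of \<sigma>] \<sigma>(1) by (auto simp: leads_def)
    next
      case False
      have "c \<rho> = 0 \<or> lookup (essential_poly \<rho>) \<sigma> = 0"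
        using \<sigma>(2)[of \<rho>] lower[OF \<rho>, of \<sigma>] \<rho> sig_le_antisym False by blast
      then show ?thesis using False by auto
    qed
  qed
  then have "lookup f \<sigma> \<noteq> 0" using \<sigma>(1) finJ by simp
  moreover have "sig_le \<sigma> \<tau>" if "\<tau> \<in> keys f" for \<tau>
  proof -
    have "(\<Sum>\<rho>\<in>?J. c \<rho> * lookup (essential_poly \<rho>) \<tau>) \<noteq> 0" using that lookup_f by (simp add: in_keys_iff)
    then obtain \<rho> where \<rho>: "\<rho> \<in> ?J" "c \<rho> * lookup (essential_poly \<rho>) \<tau> \<noteq> 0"
      by (meson sum.not_neutral_contains_not_neutral)
    then show ?thesis using \<sigma>(2)[of \<rho>] lower[of \<rho> \<tau>] sig_le_trans by auto
  qed
  moreover have "\<sigma> \<in> essential_signatures" using \<sigma>(1) by simp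
  ultimately show thesis by (intro that[of \<sigma>]) (simp_all add: in_keys_iff)
qed

text \<open>Pairs of keys with sum \<open>\<rho>\<close> correspond to splits of its exponent;
  splits of the wrong degrees contribute zero to \<open>conv\<close>.\<close>

lemma lookup_essential_poly_mult:
  assumes \<sigma>: "\<sigma> \<in> essential_signatures" and \<tau>: "\<tau> \<in> essential_signatures"
  shows "lookup (essential_poly \<sigma> * essential_poly \<tau>) \<rho> =
    (if fst \<rho> = fst \<sigma> + fst \<tau> \<and> snd \<rho> \<in> exponents N then conv (fst \<sigma>) (fst \<tau>) (snd \<sigma>) (snd \<tau>) (snd \<rho>) else 0)"
proof -
  let ?A = "level (fst \<sigma>) (deg (snd \<sigma>))" and ?B = "level (fst \<tau>) (deg (snd \<tau>))"
  have d: "fst \<sigma> \<in> Dom" "fst \<tau> \<in> Dom" using \<sigma> \<tau> essential_iff by auto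
  have "lookup (essential_poly \<sigma> * essential_poly \<tau>) \<rho> = (\<Sum>a\<in>?A. \<Sum>b\<in>?B.
     if a + b = \<rho> then lookup (essential_poly \<sigma>) a * lookup (essential_poly \<tau>) b else 0)"
    by (rule lookup_mult_sum[OF finite_level keys_essential_poly[OF \<sigma>] finite_level keys_essential_poly[OF \<tau>]])
  also have "\<dots> = (\<Sum>(a, b)\<in>?A \<times> ?B. if a + b = \<rho> then lookup (essential_poly \<sigma>) a * lookup (essential_poly \<tau>) b else 0)"
    by (rule sum.cartesian_product)
  finally have eq: "lookup (essential_poly \<sigma> * essential_poly \<tau>) \<rho> = \<dots>" .
  show ?thesis
  proof (cases "fst \<rho> = fst \<sigma> + fst \<tau> \<and> snd \<rho> \<in> exponents N")
    case False
    have "a + b \<noteq> \<rho>" if "a \<in> ?A" "b \<in> ?B" for a b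
      using that False exponents_add by (auto simp: level_def)
    then have "lookup (essential_poly \<sigma> * essential_poly \<tau>) \<rho> = 0"
      unfolding eq by (intro sum.neutral) auto
    then show ?thesis unfolding if_not_P[OF False] .
  next
    case True
    let ?p = "snd \<rho>"
    let ?S = "{s\<in>splits {1..N} ?p. deg s = deg (snd \<sigma>) \<and> deg (?p - s) = deg (snd \<tau>)}"
    have "(\<Sum>(a, b)\<in>?A \<times> ?B. if a + b = \<rho> then lookup (essential_poly \<sigma>) a * lookup (essential_poly \<tau>) b else 0)
        = (\<Sum>(a, b)\<in>{(a, b)\<in>?A \<times> ?B. a + b = \<rho>}. lookup (essential_poly \<sigma>) a * lookup (essential_poly \<tau>) b)"
      by (intro sum.mono_neutral_cong_right) (auto simp: finite_level split: if_splits)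
    also have "\<dots> = (\<Sum>s\<in>?S. coef (fst \<sigma>) s (snd \<sigma>) * coef (fst \<tau>) (?p - s) (snd \<tau>))"
    proof (rule sum.reindex_bij_witness[where i = "\<lambda>s. ((fst \<sigma>, s), (fst \<tau>, ?p - s))" and j = "\<lambda>(a, b). snd a"])
      fix z assume z: "z \<in> {(a, b)\<in>?A \<times> ?B. a + b = \<rho>}"
      then obtain a b where ab: "z = (a, b)" "a \<in> ?A" "b \<in> ?B" "a + b = \<rho>" by blast
      have p: "?p = snd a + snd b" using ab(4) by auto
      then have diff: "?p - snd a = snd b" by (auto simp: fun_eq_iff)
      show "(case z of (a, b) \<Rightarrow> snd a) \<in> ?S"
        using ab(2,3) diff splits_add[of "snd b" N "snd a"] p by (auto simp: ab(1) level_def)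
      show "((fst \<sigma>, case z of (a, b) \<Rightarrow> snd a), fst \<tau>, ?p - (case z of (a, b) \<Rightarrow> snd a)) = z"
        using ab(2,3) diff by (auto simp: ab(1) level_def prod_eq_iff)
      show "coef (fst \<sigma>) (case z of (a, b) \<Rightarrow> snd a) (snd \<sigma>) * coef (fst \<tau>) (?p - (case z of (a, b) \<Rightarrow> snd a)) (snd \<tau>)
          = (case z of (a, b) \<Rightarrow> lookup (essential_poly \<sigma>) a * lookup (essential_poly \<tau>) b)"
        using ab(2,3) diff by (auto simp: ab(1) level_def lookup_essential_poly \<sigma> \<tau>)
    next
      fix s assume s: "s \<in> ?S"
      then have s': "s \<in> exponents N" "?p - s \<in> exponents N" "s + (?p - s) = ?p"
        using split_exponents[of ?p N s] True by auto
      show "((fst \<sigma>, s), fst \<tau>, ?p - s) \<in> {(a, b)\<in>?A \<times> ?B. a + b = \<rho>}"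
        using s s' True by (auto simp: level_def prod_eq_iff)
    qed auto
    also have "\<dots> = conv (fst \<sigma>) (fst \<tau>) (snd \<sigma>) (snd \<tau>) ?p"
      unfolding conv_def
    proof (rule sum.mono_neutral_left)
      show "finite (splits {1..N} ?p)" by (rule finite_splits) simp
      show "\<forall>s\<in>splits {1..N} ?p - ?S. coef (fst \<sigma>) s (snd \<sigma>) * coef (fst \<tau>) (?p - s) (snd \<tau>) = 0"
      proof
        fix s assume s: "s \<in> splits {1..N} ?p - ?S"
        then have "deg (snd \<sigma>) \<noteq> deg s \<or> deg (snd \<tau>) \<noteq> deg (?p - s)" by auto
        moreover from s have "s \<in> exponents N" "?p - s \<in> exponents N" using split_exponents[of ?p N s] True by auto
        ultimately have "coef (fst \<sigma>) s (snd \<sigma>) = 0 \<or> coef (fst \<tau>) (?p - s) (snd \<tau>) = 0"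
          using coef_nonzeroD(2)[OF d(1), of s "snd \<sigma>"] coef_nonzeroD(2)[OF d(2), of "?p - s" "snd \<tau>"] by blast
        then show "coef (fst \<sigma>) s (snd \<sigma>) * coef (fst \<tau>) (?p - s) (snd \<tau>) = 0" by auto
      qed
    qed auto
    finally show ?thesis using True eq by simp
  qed
qed

text \<open>By \<open>conv_in_coef_span\<close> the product is a combination of coordinate
  functions, the coefficients being its own values at essential exponents.\<close>

lemma essential_poly_mult_in_space:
  assumes \<sigma>: "\<sigma> \<in> essential_signatures" and \<tau>: "\<tau> \<in> essential_signatures"
  shows "essential_poly \<sigma> * essential_poly \<tau> \<in> essential_space (fst \<sigma> + fst \<tau>) (deg (snd \<sigma>) + deg (snd \<tau>))"
proof -
  define \<nu> where "\<nu> = fst \<sigma> + fst \<tau>"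
  define d where "d = deg (snd \<sigma>) + deg (snd \<tau>)"
  have dom: "fst \<sigma> \<in> Dom" "fst \<tau> \<in> Dom" and e: "snd \<sigma> \<in> ess (fst \<sigma>)" "snd \<tau> \<in> ess (fst \<tau>)"
    using \<sigma> \<tau> essential_iff by auto
  have \<nu>: "\<nu> \<in> Dom" unfolding \<nu>_def by (rule dominant_weights_add[OF dom])
  let ?J = "{x\<in>ess \<nu>. deg x = d}"
  have finJ: "finite ?J" by (rule finite_subset[OF _ finite_ess_deg_le[OF \<nu>, of d]]) auto
  let ?c = "\<lambda>x. conv (fst \<sigma>) (fst \<tau>) (snd \<sigma>) (snd \<tau>) x"
  have es: "(\<nu>, x) \<in> essential_signatures" if "x \<in> ess \<nu>" for x using that by (simp add: ess_def)
  have "essential_poly \<sigma> * essential_poly \<tau> = (\<Sum>x\<in>?J. pscale (?c x) (essential_poly (\<nu>, x)))"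
  proof (rule poly_mapping_eqI)
    fix \<rho>
    have rhs: "lookup (\<Sum>x\<in>?J. pscale (?c x) (essential_poly (\<nu>, x))) \<rho> =
        (if fst \<rho> = \<nu> \<and> snd \<rho> \<in> exponents N then \<Sum>x\<in>?J. coef \<nu> (snd \<rho>) x * ?c x else 0)"
      by (auto simp: lookup_sum lookup_pscale lookup_essential_poly[OF es] mult.commute)
    have "?c p = (\<Sum>x\<in>?J. coef \<nu> p x * ?c x)" if p: "p \<in> exponents N" for p
    proof (cases "deg p = d")
      case True
      have "?c p = (\<Sum>x\<in>ess_below \<nu> p. coef \<nu> p x * ?c x)"
        unfolding \<nu>_def by (rule conv_in_coef_span[OF dom e p])
      also have "\<dots> = (\<Sum>x\<in>?J. coef \<nu> p x * ?c x)"
        using finJ True coef_zero[OF \<nu> p] by (intro sum.mono_neutral_left) (auto simp: ess_below_def)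
      finally show ?thesis .
    next
      case False
      have "?c p = 0" using conv_deg[OF dom p, of "snd \<sigma>" "snd \<tau>"] False unfolding d_def by (cases "?c p = 0") auto
      moreover have "(\<Sum>x\<in>?J. coef \<nu> p x * ?c x) = 0"
      proof (intro sum.neutral ballI)
        fix x assume "x \<in> ?J"
        then have "coef \<nu> p x = 0" using coef_nonzeroD(2)[OF \<nu> p, of x] False by auto
        then show "coef \<nu> p x * ?c x = 0" by simp
      qed
      ultimately show ?thesis by simp
    qed
    then show "lookup (essential_poly \<sigma> * essential_poly \<tau>) \<rho> = lookup (\<Sum>x\<in>?J. pscale (?c x) (essential_poly (\<nu>, x))) \<rho>"
      unfolding rhs lookup_essential_poly_mult[OF \<sigma> \<tau>] \<nu>_def[symmetric] by (auto intro!: if_cong)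
  qed
  moreover have "essential_poly (\<nu>, x) \<in> essential_space \<nu> d" if "x \<in> ?J" for x
    using essential_poly_in_space[OF es[of x]] that by simp
  ultimately have "essential_poly \<sigma> * essential_poly \<tau> \<in> essential_space \<nu> d"
    by (simp only: essential_space_def) (intro PS.span_sum PS.span_scale)
  then show ?thesis by (simp only: \<nu>_def d_def)
qed

text \<open>This is \<open>coef_in_conv_span\<close> read in the algebra; it drives the induction
  over the semigroup of weights.\<close>

lemma essential_poly_from_products:
  assumes \<rho>: "\<rho> \<in> essential_signatures" "fst \<rho> = \<kappa> + \<mu>" and \<kappa>: "\<kappa> \<in> Dom" and \<mu>: "\<mu> \<in> Dom"
  shows "essential_poly \<rho> \<in> PS.span {essential_poly \<sigma> * essential_poly \<tau> | \<sigma> \<tau>.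
     \<sigma> \<in> essential_signatures \<and> \<tau> \<in> essential_signatures \<and> fst \<sigma> = \<kappa> \<and> fst \<tau> = \<mu> \<and>
     deg (snd \<sigma>) + deg (snd \<tau>) = deg (snd \<rho>)}"
proof -
  define \<nu> where "\<nu> = \<kappa> + \<mu>"
  have "snd \<rho> \<in> ess (\<kappa> + \<mu>)" using \<rho> essential_iff by metis
  from coef_in_conv_span[OF \<kappa> \<mu> this] obtain X where X: "\<And>p. p \<in> exponents N \<Longrightarrow> coef \<nu> p (snd \<rho>) =
    (\<Sum>(q, r)\<in>{(q, r). q \<in> ess \<kappa> \<and> r \<in> ess \<mu> \<and> deg q + deg r = deg (snd \<rho>)}. X q r * conv \<kappa> \<mu> q r p)"
    unfolding \<nu>_def by blast
  let ?Z = "{(q, r). q \<in> ess \<kappa> \<and> r \<in> ess \<mu> \<and> deg q + deg r = deg (snd \<rho>)}"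
  have es: "(\<kappa>, q) \<in> essential_signatures" if "q \<in> ess \<kappa>" for q using that by (simp add: ess_def)
  have es': "(\<mu>, r) \<in> essential_signatures" if "r \<in> ess \<mu>" for r using that by (simp add: ess_def)
  have fst_\<rho>: "fst \<rho> = \<nu>" using \<rho>(2) by (simp only: \<nu>_def)
  have "essential_poly \<rho> = (\<Sum>(q, r)\<in>?Z. pscale (X q r) (essential_poly (\<kappa>, q) * essential_poly (\<mu>, r)))"
  proof (rule poly_mapping_eqI)
    fix \<tau>
    have "lookup (\<Sum>(q, r)\<in>?Z. pscale (X q r) (essential_poly (\<kappa>, q) * essential_poly (\<mu>, r))) \<tau> =
       (\<Sum>(q, r)\<in>?Z. X q r * lookup (essential_poly (\<kappa>, q) * essential_poly (\<mu>, r)) \<tau>)"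
      unfolding lookup_sum by (intro sum.cong refl) (auto simp: lookup_pscale)
    also have "\<dots> = (\<Sum>(q, r)\<in>?Z. if fst \<tau> = \<nu> \<and> snd \<tau> \<in> exponents N then X q r * conv \<kappa> \<mu> q r (snd \<tau>) else 0)"
    proof (intro sum.cong refl, clarify)
      fix q r assume "q \<in> ess \<kappa>" "r \<in> ess \<mu>"
      from lookup_essential_poly_mult[OF es[OF this(1)] es'[OF this(2)], of \<tau>]
      show "X q r * lookup (essential_poly (\<kappa>, q) * essential_poly (\<mu>, r)) \<tau> =
        (if fst \<tau> = \<nu> \<and> snd \<tau> \<in> exponents N then X q r * conv \<kappa> \<mu> q r (snd \<tau>) else 0)"
        unfolding fst_conv snd_conv \<nu>_def[symmetric] by simp
    qed
    also have "\<dots> = lookup (essential_poly \<rho>) \<tau>"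
      unfolding lookup_essential_poly[OF \<rho>(1)] fst_\<rho> by (auto simp: X)
    finally show "lookup (essential_poly \<rho>) \<tau> = lookup (\<Sum>(q, r)\<in>?Z. pscale (X q r) (essential_poly (\<kappa>, q) * essential_poly (\<mu>, r))) \<tau>"
      by simp
  qed
  also have "\<dots> \<in> PS.span {essential_poly \<sigma> * essential_poly \<tau> | \<sigma> \<tau>.
     \<sigma> \<in> essential_signatures \<and> \<tau> \<in> essential_signatures \<and> fst \<sigma> = \<kappa> \<and> fst \<tau> = \<mu> \<and>
     deg (snd \<sigma>) + deg (snd \<tau>) = deg (snd \<rho>)}"
  proof (rule PS.span_sum)
    fix z assume "z \<in> ?Z"
    then obtain q r where z: "z = (q, r)" "q \<in> ess \<kappa>" "r \<in> ess \<mu>" "deg q + deg r = deg (snd \<rho>)" by blast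
    then show "(case z of (q, r) \<Rightarrow> pscale (X q r) (essential_poly (\<kappa>, q) * essential_poly (\<mu>, r))) \<in> PS.span {essential_poly \<sigma> * essential_poly \<tau> | \<sigma> \<tau>.
       \<sigma> \<in> essential_signatures \<and> \<tau> \<in> essential_signatures \<and> fst \<sigma> = \<kappa> \<and> fst \<tau> = \<mu> \<and>
       deg (snd \<sigma>) + deg (snd \<tau>) = deg (snd \<rho>)}"
      unfolding z(1) prod.case using es[OF z(2)] es'[OF z(3)]
      by (intro PS.span_scale PS.span_base) (force simp: z(4))
  qed
  finally show ?thesis .
qed

text \<open>The product of the two coordinate functions lies in the essential space, so its least
  key is essential, and this key is \<open>\<sigma> + \<tau>\<close>.\<close>

lemma essential_add:
  assumes \<sigma>: "\<sigma> \<in> essential_signatures" and \<tau>: "\<tau> \<in> essential_signatures"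
  shows "\<sigma> + \<tau> \<in> essential_signatures"
proof -
  let ?f = "essential_poly \<sigma> * essential_poly \<tau>"
  have lead: "leads ?f (\<sigma> + \<tau>)" by (rule leads_mult[OF leads_essential_poly[OF \<sigma>] leads_essential_poly[OF \<tau>]])
  then have key: "\<sigma> + \<tau> \<in> keys ?f" by (simp add: leads_def in_keys_iff)
  then have "?f \<noteq> 0" by auto
  from essential_space_lead[OF essential_poly_mult_in_space[OF \<sigma> \<tau>] this]
  obtain \<rho> where \<rho>: "\<rho> \<in> essential_signatures" "\<rho> \<in> keys ?f" "\<And>\<tau>. \<tau> \<in> keys ?f \<Longrightarrow> sig_le \<rho> \<tau>" by blast
  have "\<rho> = \<sigma> + \<tau>" using \<rho>(3)[OF key] lead \<rho>(2) sig_le_antisym unfolding leads_def by blast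
  then show ?thesis using \<rho>(1) by simp
qed

end


section \<open>Subduction\<close>

context essential_setting
begin

context
  fixes \<Lambda> :: "('g \<Rightarrow> complex) set" and B :: "'g signature set"
  assumes \<Lambda>: "\<Lambda> \<subseteq> Dom" and B: "B = with_highest_weight_in essential_signatures \<Lambda>"
    and star: "\<And>\<sigma> D D'. \<sigma> \<in> semigroup_generated B \<Longrightarrow> decomposition B \<sigma> D \<Longrightarrow> decomposition B \<sigma> D' \<Longrightarrow>
           (admissible_operation B)\<^sup>*\<^sup>* D' D"
    and double_star: "\<And>\<kappa> \<mu> \<sigma>. \<kappa> \<in> \<Lambda> \<Longrightarrow> \<mu> \<in> \<Lambda> \<Longrightarrow> \<sigma> \<in> essential_signatures \<Longrightarrow> fst \<sigma> = \<kappa> + \<mu> \<Longrightarrow>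
           \<exists>D. decomposition B \<sigma> D"
begin

lemma B_iff: "\<sigma> \<in> B \<longleftrightarrow> \<sigma> \<in> essential_signatures \<and> fst \<sigma> \<in> \<Lambda>"
  by (auto simp: B with_highest_weight_in_def)

section \<open>Monomials in the coordinate functions of the given weights\<close>

definition monomial :: "'g signature multiset \<Rightarrow> 'g signature \<Rightarrow>\<^sub>0 complex" where
  "monomial D = prod_mset (image_mset essential_poly D)"

lemma monomial_add: "monomial (D + D') = monomial D * monomial D'"
  and monomial_single: "monomial {#\<sigma>#} = essential_poly \<sigma>"
  and monomial_pair: "monomial {#\<sigma>, \<tau>#} = essential_poly \<sigma> * essential_poly \<tau>"
  by (simp_all add: monomial_def)

lemma leads_one: "leads 1 0"
proof -
  have "(0 :: nat \<Rightarrow> nat) \<in> exponents N" by (simp add: exponents_def)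
  then show ?thesis using R_refl by (auto simp: leads_def in_keys_iff lookup_one when_def sig_le_def)
qed

lemma leads_monomial: "set_mset D \<subseteq> essential_signatures \<Longrightarrow> leads (monomial D) (\<Sum>\<^sub># D)"
proof (induction D)
  case empty
  then show ?case using leads_one by (simp add: monomial_def)
next
  case (add \<sigma> D)
  then show ?case using leads_mult[OF leads_essential_poly[of \<sigma>]] by (simp add: monomial_def)
qed

lemma essential_poly_mult_space:
  assumes "\<sigma> \<in> essential_signatures" "f \<in> essential_space \<nu> d"
  shows "essential_poly \<sigma> * f \<in> essential_space (fst \<sigma> + \<nu>) (deg (snd \<sigma>) + d)"
  using assms(2) unfolding essential_space_def[of \<nu> d]
proof (induction f rule: PS.span_induct_alt)
  case base
  show ?case by (simp add: essential_space_def PS.span_zero)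
next
  case (step c x y)
  then obtain \<tau> where \<tau>: "x = essential_poly \<tau>" "\<tau> \<in> essential_signatures" "fst \<tau> = \<nu>" "deg (snd \<tau>) = d"
    by (auto simp: level_def)
  have "essential_poly \<sigma> * x \<in> essential_space (fst \<sigma> + \<nu>) (deg (snd \<sigma>) + d)"
    using essential_poly_mult_in_space[OF assms(1) \<tau>(2)] unfolding \<tau> .
  then show ?case using step.IH unfolding distrib_left pscale_mult_right essential_space_def
    by (intro PS.span_add PS.span_scale)
qed

lemma monomial_in_space:
  assumes "set_mset D \<subseteq> essential_signatures" "D \<noteq> {#}"
  shows "monomial D \<in> essential_space (fst (\<Sum>\<^sub># D)) (deg (snd (\<Sum>\<^sub># D)))"
  using assms
proof (induction D)
  case (add \<sigma> D)
  show ?case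
  proof (cases "D = {#}")
    case True
    then show ?thesis using add.prems essential_poly_in_space[of \<sigma>] by (simp add: monomial_single)
  next
    case False
    have "monomial (add_mset \<sigma> D) = essential_poly \<sigma> * monomial D" by (simp add: monomial_def)
    moreover have "fst (\<Sum>\<^sub># (add_mset \<sigma> D)) = fst \<sigma> + fst (\<Sum>\<^sub># D)"
      "deg (snd (\<Sum>\<^sub># (add_mset \<sigma> D))) = deg (snd \<sigma>) + deg (snd (\<Sum>\<^sub># D))"
      unfolding sum_mset.add_mset fst_add snd_add deg_add by (rule refl)+
    moreover have "essential_poly \<sigma> * monomial D \<in> essential_space (fst \<sigma> + fst (\<Sum>\<^sub># D)) (deg (snd \<sigma>) + deg (snd (\<Sum>\<^sub># D)))"
      using add False by (intro essential_poly_mult_space) auto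
    ultimately show ?thesis by (simp only:)
  qed
qed simp

text \<open>Every monomial used must itself lead in \<open>U\<close>. A bound on the keys of the
  total alone would not see leading terms that cancel between monomials.\<close>

definition mono_span :: "'g signature set \<Rightarrow> ('g signature \<Rightarrow>\<^sub>0 complex) set" where
  "mono_span U = PS.span {monomial D | D. D \<noteq> {#} \<and> set_mset D \<subseteq> B \<and> \<Sum>\<^sub># D \<in> U}"

lemma mono_span_mono: "U \<subseteq> U' \<Longrightarrow> mono_span U \<subseteq> mono_span U'"
  unfolding mono_span_def by (rule PS.span_mono) blast

lemma subspace_mono_span: "PS.subspace (mono_span U)"
  by (simp add: mono_span_def PS.subspace_span)

lemma monomial_in_mono_span: "decomposition B \<sigma> D \<Longrightarrow> \<sigma> \<in> U \<Longrightarrow> monomial D \<in> mono_span U"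
  unfolding mono_span_def decomposition_def by (rule PS.span_base) blast

lemma mono_span_mult:
  assumes f: "f \<in> mono_span U" and g: "g \<in> mono_span U'" and UU: "\<And>\<sigma> \<tau>. \<sigma> \<in> U \<Longrightarrow> \<tau> \<in> U' \<Longrightarrow> \<sigma> + \<tau> \<in> U''"
  shows "f * g \<in> mono_span U''"
proof -
  have gen: "monomial D * g \<in> mono_span U''" if D: "D \<noteq> {#}" "set_mset D \<subseteq> B" "\<Sum>\<^sub># D \<in> U" for D
    using g unfolding mono_span_def[of U']
  proof (induction g rule: PS.span_induct_alt)
    case base
    show ?case using PS.subspace_0[OF subspace_mono_span] by simp
  next
    case (step c x y)
    then obtain D' where D': "x = monomial D'" "D' \<noteq> {#}" "set_mset D' \<subseteq> B" "\<Sum>\<^sub># D' \<in> U'" by blast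
    have "monomial D * x \<in> mono_span U''"
      unfolding D'(1) monomial_add[symmetric] using D D' UU
      by (intro monomial_in_mono_span[where \<sigma> = "\<Sum>\<^sub># D + \<Sum>\<^sub># D'"]) (auto simp: decomposition_def)
    then show ?case unfolding distrib_left pscale_mult_right
      using step.IH by (intro PS.subspace_add[OF subspace_mono_span] PS.subspace_scale[OF subspace_mono_span])
  qed
  show ?thesis
    using f unfolding mono_span_def[of U]
  proof (induction f rule: PS.span_induct_alt)
    case base
    show ?case using PS.subspace_0[OF subspace_mono_span] by simp
  next
    case (step c x y)
    then have "x * g \<in> mono_span U''" using gen by blast
    then show ?case unfolding distrib_right pscale_mult_left
      using step.IH by (intro PS.subspace_add[OF subspace_mono_span] PS.subspace_scale[OF subspace_mono_span])
  qed
qed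

section \<open>Larger signatures and subduction of quadratic differences\<close>

definition above :: "'g signature \<Rightarrow> 'g signature set" where
  "above \<sigma> = {\<tau>\<in>level (fst \<sigma>) (deg (snd \<sigma>)). sig_le \<sigma> \<tau>}"

definition strictly_above :: "'g signature \<Rightarrow> 'g signature set" where
  "strictly_above \<sigma> = above \<sigma> - {\<sigma>}"

lemma finite_above: "finite (above \<sigma>)"
  by (rule finite_subset[OF _ finite_level]) (auto simp: above_def)

lemma above_mono:
  assumes "\<tau> \<in> above \<sigma>"
  shows "above \<tau> \<subseteq> above \<sigma>"
proof
  fix \<rho> assume \<rho>: "\<rho> \<in> above \<tau>"
  then have "sig_le \<sigma> \<rho>" using assms sig_le_trans unfolding above_def by blast
  then show "\<rho> \<in> above \<sigma>" using \<rho> assms unfolding above_def level_def by simp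
qed

lemma strictly_above_mono: "\<tau> \<in> above \<sigma> \<Longrightarrow> strictly_above \<tau> \<subseteq> strictly_above \<sigma>"
  using above_mono[of \<tau> \<sigma>] sig_le_antisym[of \<sigma> \<tau>] unfolding strictly_above_def above_def by blast

lemma strictly_above_add:
  assumes "\<tau> \<in> strictly_above \<sigma>" "snd \<rho> \<in> exponents N"
  shows "\<rho> + \<tau> \<in> strictly_above (\<rho> + \<sigma>)"
proof -
  have \<tau>: "fst \<tau> = fst \<sigma>" "snd \<tau> \<in> exponents N" "deg (snd \<tau>) = deg (snd \<sigma>)" "sig_le \<sigma> \<tau>" "\<tau> \<noteq> \<sigma>"
    using assms(1) by (auto simp: strictly_above_def above_def level_def)
  have "sig_le (\<rho> + \<sigma>) (\<rho> + \<tau>)" by (rule sig_le_add[OF sig_le_refl[OF assms(2)] \<tau>(4)])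
  moreover have "\<rho> + \<tau> \<noteq> \<rho> + \<sigma>" using \<tau>(5) by (metis add_left_imp_eq)
  moreover have "\<rho> + \<tau> \<in> level (fst (\<rho> + \<sigma>)) (deg (snd (\<rho> + \<sigma>)))"
    unfolding level_def mem_Collect_eq fst_add snd_add deg_add using \<tau>(1,2,3) assms(2) exponents_add by metis
  ultimately show ?thesis unfolding strictly_above_def above_def by blast
qed

text \<open>The least signature \<open>\<rho>\<close> of \<open>f\<close> is essential of weight
  \<open>\<kappa> + \<mu>\<close>, so \<open>double_star\<close> gives it a decomposition
  \<open>D\<close>, and subtracting a multiple of \<open>monomial D\<close> pushes the least
  signature up. This ends because a level has only finitely many signatures.\<close>

lemma subduction:
  assumes \<kappa>\<mu>: "\<kappa> \<in> \<Lambda>" "\<mu> \<in> \<Lambda>"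
    and "f \<in> essential_space (\<kappa> + \<mu>) d" "fst \<sigma> = \<kappa> + \<mu>" "deg (snd \<sigma>) = d" "keys f \<subseteq> strictly_above \<sigma>"
  shows "f \<in> mono_span (strictly_above \<sigma>)"
  using assms(3-)
proof (induction "card (strictly_above \<sigma>)" arbitrary: f \<sigma> rule: less_induct)
  case less
  show ?case
  proof (cases "f = 0")
    case True
    then show ?thesis using PS.subspace_0[OF subspace_mono_span] by simp
  next
    case False
    obtain \<rho> where \<rho>: "\<rho> \<in> essential_signatures" "\<rho> \<in> keys f" "\<And>\<tau>. \<tau> \<in> keys f \<Longrightarrow> sig_le \<rho> \<tau>"
      using essential_space_lead[OF less.prems(1) False] by blast
    have \<rho>s: "\<rho> \<in> strictly_above \<sigma>" using \<rho>(2) less.prems(4) by blast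
    have \<rho>l: "fst \<rho> = \<kappa> + \<mu>" "deg (snd \<rho>) = d"
      using \<rho>s less.prems(2,3) unfolding strictly_above_def above_def level_def by auto
    obtain D where D: "decomposition B \<rho> D" using double_star[OF \<kappa>\<mu> \<rho>(1) \<rho>l(1)] by blast
    have DE: "set_mset D \<subseteq> essential_signatures" "D \<noteq> {#}" "\<Sum>\<^sub># D = \<rho>"
      using D B_iff by (auto simp: decomposition_def)
    have lead: "leads (monomial D) \<rho>" using leads_monomial[OF DE(1)] DE(3) by simp
    have Dspace: "monomial D \<in> essential_space (\<kappa> + \<mu>) d"
      using monomial_in_space[OF DE(1,2)] unfolding DE(3) \<rho>l .
    let ?c = "lookup f \<rho>"
    let ?g = "f - pscale ?c (monomial D)"
    have gspace: "?g \<in> essential_space (\<kappa> + \<mu>) d"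
      using less.prems(1) Dspace unfolding essential_space_def by (intro PS.span_diff PS.span_scale)
    have "keys ?g \<subseteq> strictly_above \<rho>"
    proof
      fix \<tau> assume \<tau>: "\<tau> \<in> keys ?g"
      have "\<tau> \<in> level (\<kappa> + \<mu>) d" using \<tau> keys_essential_space[OF gspace] by blast
      moreover have "\<tau> \<in> keys f \<or> \<tau> \<in> keys (monomial D)"
        using \<tau> by (auto simp: in_keys_iff lookup_minus lookup_pscale)
      then have "sig_le \<rho> \<tau>" using \<rho>(3) lead unfolding leads_def by blast
      moreover have "\<tau> \<noteq> \<rho>" using \<tau> lead by (auto simp: in_keys_iff lookup_minus lookup_pscale leads_def)
      ultimately show "\<tau> \<in> strictly_above \<rho>" unfolding strictly_above_def above_def \<rho>l by blast
    qed
    moreover have "strictly_above \<rho> \<subset> strictly_above \<sigma>"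
    proof -
      have "\<rho> \<in> above \<sigma>" using \<rho>s by (simp add: strictly_above_def)
      then have "strictly_above \<rho> \<subseteq> strictly_above \<sigma>" by (rule strictly_above_mono)
      moreover have "\<rho> \<notin> strictly_above \<rho>" by (simp add: strictly_above_def)
      ultimately show ?thesis using \<rho>s by blast
    qed
    ultimately have "?g \<in> mono_span (strictly_above \<rho>)"
      using less.hyps[OF psubset_card_mono gspace \<rho>l] finite_above by (auto simp: strictly_above_def)
    then have "?g \<in> mono_span (strictly_above \<sigma>)"
      using mono_span_mono \<open>strictly_above \<rho> \<subset> strictly_above \<sigma>\<close> by blast
    moreover have "pscale ?c (monomial D) \<in> mono_span (strictly_above \<sigma>)"
      by (rule PS.subspace_scale[OF subspace_mono_span monomial_in_mono_span[OF D \<rho>s]])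
    ultimately have "?g + pscale ?c (monomial D) \<in> mono_span (strictly_above \<sigma>)"
      by (rule PS.subspace_add[OF subspace_mono_span])
    then show ?thesis by simp
  qed
qed

text \<open>Equal leading terms cancel, and subduction rewrites the rest. Besides products of two
  generators this covers a single generator whose weight is a sum of two given weights, as merging
  and splitting require.\<close>

lemma quadratic_difference:
  assumes \<kappa>\<mu>: "\<kappa> \<in> \<Lambda>" "\<mu> \<in> \<Lambda>" and "fst \<sigma> = \<kappa> + \<mu>"
    and f: "f \<in> essential_space (fst \<sigma>) (deg (snd \<sigma>))" "leads f \<sigma>"
    and g: "g \<in> essential_space (fst \<sigma>) (deg (snd \<sigma>))" "leads g \<sigma>"
  shows "f - g \<in> mono_span (strictly_above \<sigma>)"
proof (rule subduction[OF \<kappa>\<mu> _ assms(3) refl])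
  have sp: "f - g \<in> essential_space (fst \<sigma>) (deg (snd \<sigma>))"
    using f g unfolding essential_space_def by (intro PS.span_diff)
  then show "f - g \<in> essential_space (\<kappa> + \<mu>) (deg (snd \<sigma>))" unfolding assms(3) .
  show "keys (f - g) \<subseteq> strictly_above \<sigma>"
  proof
    fix \<tau> assume \<tau>: "\<tau> \<in> keys (f - g)"
    have "\<tau> \<in> level (fst \<sigma>) (deg (snd \<sigma>))" using \<tau> keys_essential_space[OF sp] by blast
    moreover have "\<tau> \<in> keys f \<or> \<tau> \<in> keys g" using \<tau> by (auto simp: in_keys_iff lookup_minus)
    then have "sig_le \<sigma> \<tau>" using f g unfolding leads_def by blast
    moreover have "\<tau> \<noteq> \<sigma>" using \<tau> f g by (auto simp: in_keys_iff lookup_minus leads_def)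
    ultimately show "\<tau> \<in> strictly_above \<sigma>" unfolding strictly_above_def above_def by blast
  qed
qed

text \<open>Multiplying by a fixed monomial shifts all leading signatures equally, and addition
  preserves strictness.\<close>

lemma monomial_mult_strictly_above:
  assumes "set_mset D \<subseteq> B" "f \<in> mono_span (strictly_above \<sigma>)"
  shows "monomial D * f \<in> mono_span (strictly_above (\<Sum>\<^sub># D + \<sigma>))"
proof (cases "D = {#}")
  case True
  then show ?thesis using assms(2) by (simp add: monomial_def)
next
  case False
  have "snd (\<Sum>\<^sub># D) \<in> exponents N"
    using assms(1) 
  proof (induction D)
    case (add \<rho> D)
    then show ?case using B_iff essential_exponents exponents_add by (simp only: sum_mset.add_mset snd_add set_mset_add_mset_insert) blast
  qed (simp add: exponents_def)
  then show ?thesis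
    using strictly_above_add False assms
    by (intro mono_span_mult[of "monomial D" "{\<Sum>\<^sub># D}" f "strictly_above \<sigma>"] monomial_in_mono_span[of "\<Sum>\<^sub># D"])
       (auto simp: decomposition_def)
qed

lemma pair_facts:
  assumes "a \<in> B" "b \<in> B"
  shows "essential_poly a * essential_poly b \<in> essential_space (fst (a + b)) (deg (snd (a + b)))"
    "leads (essential_poly a * essential_poly b) (a + b)" "fst (a + b) = fst a + fst b" "fst a \<in> \<Lambda>" "fst b \<in> \<Lambda>"
proof -
  show "essential_poly a * essential_poly b \<in> essential_space (fst (a + b)) (deg (snd (a + b)))"
    unfolding fst_add snd_add deg_add using assms B_iff by (intro essential_poly_mult_in_space) auto
qed (use assms B_iff in \<open>auto intro!: leads_mult leads_essential_poly simp: fst_add\<close>)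

lemma single_facts:
  assumes "a \<in> B"
  shows "essential_poly a \<in> essential_space (fst a) (deg (snd a))" "leads (essential_poly a) a"
  using assms B_iff essential_poly_in_space leads_essential_poly by auto

text \<open>An operation touches at most two summands, so the difference of monomials is a quadratic
  difference times the monomial of the untouched summands.\<close>

lemma admissible_operation_monomial:
  assumes "admissible_operation B D D'" "decomposition B \<sigma> D"
  shows "decomposition B \<sigma> D' \<and> monomial D - monomial D' \<in> mono_span (strictly_above \<sigma>)"
  using assms
proof cases
  case (replace_pair a' b' a b D0)
  have D0: "set_mset D0 \<subseteq> B" and ab: "a \<in> B" "b \<in> B" and \<sigma>: "\<sigma> = \<Sum>\<^sub># D0 + (a + b)"
    using assms(2) replace_pair(1) by (auto simp: decomposition_def add_ac)
  have "essential_poly a * essential_poly b - essential_poly a' * essential_poly b' \<in> mono_span (strictly_above (a + b))"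
    using pair_facts[OF ab] pair_facts[OF replace_pair(3,4)] replace_pair(5) by (intro quadratic_difference[of "fst a" "fst b"]) auto
  from monomial_mult_strictly_above[OF D0 this]
  have "monomial D - monomial D' \<in> mono_span (strictly_above \<sigma>)"
    unfolding replace_pair(1,2) monomial_add monomial_pair \<sigma> right_diff_distrib .
  moreover have "decomposition B \<sigma> D'"
    using D0 replace_pair \<sigma> by (auto simp: decomposition_def add_ac)
  ultimately show ?thesis by blast
next
  case (merge_pair c' a b D0)
  have D0: "set_mset D0 \<subseteq> B" and ab: "a \<in> B" "b \<in> B" and \<sigma>: "\<sigma> = \<Sum>\<^sub># D0 + (a + b)"
    using assms(2) merge_pair(1) by (auto simp: decomposition_def add_ac)
  have "essential_poly a * essential_poly b - essential_poly c' \<in> mono_span (strictly_above (a + b))"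
    using pair_facts[OF ab] single_facts[OF merge_pair(3)] merge_pair(4) by (intro quadratic_difference[of "fst a" "fst b"]) auto
  from monomial_mult_strictly_above[OF D0 this]
  have "monomial D - monomial D' \<in> mono_span (strictly_above \<sigma>)"
    unfolding merge_pair(1,2) monomial_add monomial_pair monomial_single \<sigma> right_diff_distrib .
  moreover have "decomposition B \<sigma> D'"
    using D0 merge_pair \<sigma> by (auto simp: decomposition_def add_ac)
  ultimately show ?thesis by blast
next
  case (split_summand a' b' c D0)
  have D0: "set_mset D0 \<subseteq> B" and c: "c \<in> B" and \<sigma>: "\<sigma> = \<Sum>\<^sub># D0 + c"
    using assms(2) split_summand(1) by (auto simp: decomposition_def add_ac)
  have "essential_poly c - essential_poly a' * essential_poly b' \<in> mono_span (strictly_above c)"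
    using single_facts[OF c] pair_facts[OF split_summand(3,4)] split_summand(5) by (intro quadratic_difference[of "fst a'" "fst b'"]) auto
  from monomial_mult_strictly_above[OF D0 this]
  have "monomial D - monomial D' \<in> mono_span (strictly_above \<sigma>)"
    unfolding split_summand(1,2) monomial_add monomial_pair monomial_single \<sigma> right_diff_distrib .
  moreover have "decomposition B \<sigma> D'"
    using D0 split_summand \<sigma> by (auto simp: decomposition_def add_ac)
  ultimately show ?thesis by blast
qed

lemma sum_mset_in_semigroup: "D \<noteq> {#} \<Longrightarrow> set_mset D \<subseteq> B \<Longrightarrow> \<Sum>\<^sub># D \<in> semigroup_generated B"
proof (induction D)
  case (add \<sigma> D)
  then show ?case
    by (cases "D = {#}") (auto intro: semigroup_generated.intros)
qed simp

text \<open>The differences along a chain of admissible operations telescope.\<close>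

lemma decompositions_monomial:
  assumes "decomposition B \<sigma> D" "decomposition B \<sigma> D'"
  shows "monomial D - monomial D' \<in> mono_span (strictly_above \<sigma>)"
proof -
  have "\<sigma> \<in> semigroup_generated B"
    using assms(1) sum_mset_in_semigroup by (auto simp: decomposition_def)
  from star[OF this assms(2,1)] have "(admissible_operation B)\<^sup>*\<^sup>* D D'" .
  then have "decomposition B \<sigma> D' \<and> monomial D - monomial D' \<in> mono_span (strictly_above \<sigma>)"
  proof (induction rule: rtranclp_induct)
    case base
    then show ?case using assms(1) PS.subspace_0[OF subspace_mono_span] by simp
  next
    case (step D1 D2)
    from admissible_operation_monomial[OF step(2)] step(3)
    have "decomposition B \<sigma> D2" "monomial D1 - monomial D2 \<in> mono_span (strictly_above \<sigma>)" by blast+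
    moreover from this step(3) have "(monomial D - monomial D1) + (monomial D1 - monomial D2) \<in> mono_span (strictly_above \<sigma>)"
      by (intro PS.subspace_add[OF subspace_mono_span]) auto
    ultimately show ?case by simp
  qed
  then show ?thesis by blast
qed

text \<open>The keys of a monomial lie above its leading signature and in the same level, so an
  upward closed \<open>U\<close> contains them.\<close>

lemma keys_mono_span:
  assumes U: "\<And>\<tau>. \<tau> \<in> U \<Longrightarrow> above \<tau> \<subseteq> U" and f: "f \<in> mono_span U"
  shows "keys f \<subseteq> U"
proof -
  have "{monomial D | D. D \<noteq> {#} \<and> set_mset D \<subseteq> B \<and> \<Sum>\<^sub># D \<in> U} \<subseteq> {f. keys f \<subseteq> U}"
  proof clarify
    fix D \<rho> assume D: "D \<noteq> {#}" "set_mset D \<subseteq> B" "\<Sum>\<^sub># D \<in> U" and \<rho>: "\<rho> \<in> keys (monomial D)"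
    have DE: "set_mset D \<subseteq> essential_signatures" using D(2) B_iff by auto
    have "sig_le (\<Sum>\<^sub># D) \<rho>" using leads_monomial[OF DE] \<rho> by (simp add: leads_def)
    moreover have "\<rho> \<in> level (fst (\<Sum>\<^sub># D)) (deg (snd (\<Sum>\<^sub># D)))"
      using keys_essential_space[OF monomial_in_space[OF DE D(1)]] \<rho> by blast
    ultimately have "\<rho> \<in> above (\<Sum>\<^sub># D)" by (simp add: above_def)
    then show "\<rho> \<in> U" using U[OF D(3)] by blast
  qed
  then show ?thesis using PS.span_minimal[OF _ subspace_keys] f unfolding mono_span_def by blast
qed

lemma keys_mono_span_above: "f \<in> mono_span (above \<tau>) \<Longrightarrow> keys f \<subseteq> above \<tau>"
  by (rule keys_mono_span[OF above_mono])

lemma keys_mono_span_strictly_above: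
  assumes "f \<in> mono_span (strictly_above \<tau>)"
  shows "keys f \<subseteq> strictly_above \<tau>"
proof (rule keys_mono_span[OF _ assms])
  fix \<rho> assume "\<rho> \<in> strictly_above \<tau>"
  then show "above \<rho> \<subseteq> strictly_above \<tau>"
    using above_mono[of \<rho> \<tau>] sig_le_antisym[of \<tau> \<rho>] unfolding strictly_above_def above_def by blast
qed

text \<open>Modulo monomials leading strictly above \<open>\<tau>\<close>, all monomials leading at
  \<open>\<tau>\<close> agree with one \<open>monomial D0\<close>. So \<open>f\<close> is congruent
  to a multiple of it, and the factor is the coefficient of \<open>f\<close> at
  \<open>\<tau>\<close>, which is zero. If \<open>\<tau>\<close> has no decomposition, no monomial
  leads there at all.\<close>

lemma mono_span_above_reduce:
  assumes f: "f \<in> mono_span (above \<tau>)" and "lookup f \<tau> = 0 \<or> (\<nexists>D. decomposition B \<tau> D)"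
  shows "f \<in> mono_span (strictly_above \<tau>)"
proof (cases "\<exists>D. decomposition B \<tau> D")
  case False
  then have "{monomial D | D. D \<noteq> {#} \<and> set_mset D \<subseteq> B \<and> \<Sum>\<^sub># D \<in> above \<tau>} \<subseteq>
      {monomial D | D. D \<noteq> {#} \<and> set_mset D \<subseteq> B \<and> \<Sum>\<^sub># D \<in> strictly_above \<tau>}"
    by (auto simp: decomposition_def strictly_above_def)
  then show ?thesis using f PS.span_mono unfolding mono_span_def by blast
next
  case True
  then obtain D0 where D0: "decomposition B \<tau> D0" by blast
  have "\<exists>c. f - pscale c (monomial D0) \<in> mono_span (strictly_above \<tau>)"
    using f unfolding mono_span_def[of "above \<tau>"]
  proof (induction f rule: PS.span_induct_alt)
    case base
    show ?case using PS.subspace_0[OF subspace_mono_span] by (intro exI[of _ 0]) (simp add: pscale_def)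
  next
    case (step a x y)
    then obtain c where c: "y - pscale c (monomial D0) \<in> mono_span (strictly_above \<tau>)" by blast
    obtain D where D: "x = monomial D" "D \<noteq> {#}" "set_mset D \<subseteq> B" "\<Sum>\<^sub># D \<in> above \<tau>" using step by blast
    obtain b where b: "x - pscale b (monomial D0) \<in> mono_span (strictly_above \<tau>)"
    proof (cases "\<Sum>\<^sub># D = \<tau>")
      case True
      then have "decomposition B \<tau> D" using D by (simp add: decomposition_def)
      from decompositions_monomial[OF this D0] show ?thesis using that[of 1] D(1) by (simp add: pscale_def)
    next
      case False
      then have "x \<in> mono_span (strictly_above \<tau>)"
        unfolding D(1) using D by (intro monomial_in_mono_span[of "\<Sum>\<^sub># D"]) (auto simp: decomposition_def strictly_above_def)
      then show ?thesis using that[of 0] by (simp add: pscale_def)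
    qed
    have "pscale a (x - pscale b (monomial D0)) + (y - pscale c (monomial D0)) \<in> mono_span (strictly_above \<tau>)"
      using b c by (intro PS.subspace_add[OF subspace_mono_span] PS.subspace_scale[OF subspace_mono_span])
    also have "pscale a (x - pscale b (monomial D0)) + (y - pscale c (monomial D0)) =
        (pscale a x + y) - pscale (a * b + c) (monomial D0)"
      by (simp add: PS.scale_right_diff_distrib PS.scale_left_distrib)
    finally show ?case by blast
  qed
  then obtain c where c: "f - pscale c (monomial D0) \<in> mono_span (strictly_above \<tau>)" by blast
  have "lookup (f - pscale c (monomial D0)) \<tau> = 0"
    using keys_mono_span_strictly_above[OF c] by (auto simp: strictly_above_def in_keys_iff)
  moreover have "lookup f \<tau> = 0" using assms(2) True by blast
  moreover have "lookup (monomial D0) \<tau> = 1"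
  proof -
    have "set_mset D0 \<subseteq> essential_signatures" using D0 B_iff unfolding decomposition_def by blast
    from leads_monomial[OF this] show ?thesis using D0 by (simp add: decomposition_def leads_def)
  qed
  ultimately have "c = 0" by (simp add: lookup_minus lookup_pscale)
  then show ?thesis using c by (simp add: pscale_def)
qed

section \<open>Decomposition of essential signatures of all weights in the semigroup\<close>

lemma semigroup_weights_dominant: "\<nu> \<in> semigroup_generated \<Lambda> \<Longrightarrow> \<nu> \<in> Dom"
proof (induction rule: semigroup_generated.induct)
  case (add a b)
  show ?case by (rule dominant_weights_add[OF add.IH])
qed (use \<Lambda> in blast)

text \<open>Products of coordinate functions span those of a sum of weights, so induction on the
  weight expresses them in monomials. At this stage the leading signatures are confined only to a
  level.\<close>

lemma essential_poly_in_mono_span: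
  assumes "\<nu> \<in> semigroup_generated \<Lambda>" "\<sigma> \<in> essential_signatures" "fst \<sigma> = \<nu>"
  shows "essential_poly \<sigma> \<in> mono_span (level \<nu> (deg (snd \<sigma>)))"
  using assms
proof (induction arbitrary: \<sigma> rule: semigroup_generated.induct)
  case (generator \<nu>)
  then have "decomposition B \<sigma> {#\<sigma>#}" using B_iff by (simp add: decomposition_def)
  then show ?case
    using monomial_in_mono_span[of \<sigma> "{#\<sigma>#}"] essential_level[OF generator(2)] generator(3) by (simp add: monomial_single)
next
  case (add \<kappa> \<mu>)
  have dom: "\<kappa> \<in> Dom" "\<mu> \<in> Dom" using add.hyps semigroup_weights_dominant by auto
  let ?U = "level (\<kappa> + \<mu>) (deg (snd \<sigma>))"
  have "{essential_poly \<rho> * essential_poly \<tau> | \<rho> \<tau>.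
     \<rho> \<in> essential_signatures \<and> \<tau> \<in> essential_signatures \<and> fst \<rho> = \<kappa> \<and> fst \<tau> = \<mu> \<and>
     deg (snd \<rho>) + deg (snd \<tau>) = deg (snd \<sigma>)} \<subseteq> mono_span ?U"
  proof clarify
    fix \<rho> \<tau> assume *: "\<rho> \<in> essential_signatures" "\<tau> \<in> essential_signatures" "\<kappa> = fst \<rho>" "\<mu> = fst \<tau>"
      "deg (snd \<rho>) + deg (snd \<tau>) = deg (snd \<sigma>)"
    show "essential_poly \<rho> * essential_poly \<tau> \<in> mono_span (level (fst \<rho> + fst \<tau>) (deg (snd \<sigma>)))"
    proof (rule mono_span_mult)
      show "essential_poly \<rho> \<in> mono_span (level (fst \<rho>) (deg (snd \<rho>)))" using add.IH(1)[OF *(1)] *(3) by simp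
      show "essential_poly \<tau> \<in> mono_span (level (fst \<tau>) (deg (snd \<tau>)))" using add.IH(2)[OF *(2)] *(4) by simp
      fix a b assume "a \<in> level (fst \<rho>) (deg (snd \<rho>))" "b \<in> level (fst \<tau>) (deg (snd \<tau>))"
      then show "a + b \<in> level (fst \<rho> + fst \<tau>) (deg (snd \<sigma>))"
        unfolding level_def mem_Collect_eq fst_add snd_add deg_add using exponents_add *(5) by metis
    qed
  qed
  from PS.span_minimal[OF this subspace_mono_span] essential_poly_from_products[OF add.prems dom]
  show ?case by blast
qed

text \<open>A lower bound \<open>\<tau>\<close> on the leading signatures in an expression of
  \<open>essential_poly \<sigma>\<close> is raised step by step. Below \<open>\<sigma>\<close> the
  coefficient at \<open>\<tau>\<close> is zero; at \<open>\<sigma>\<close> itself, if it had no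
  decomposition, no monomial would lead there. The bound would thus pass \<open>\<sigma>\<close>,
  although \<open>\<sigma>\<close> is a key.\<close>

lemma essential_decomposes:
  assumes \<sigma>: "\<sigma> \<in> essential_signatures" and S: "fst \<sigma> \<in> semigroup_generated \<Lambda>"
  shows "\<exists>D. decomposition B \<sigma> D"
proof -
  let ?L = "level (fst \<sigma>) (deg (snd \<sigma>))"
  have lead: "leads (essential_poly \<sigma>) \<sigma>" by (rule leads_essential_poly[OF \<sigma>])
  have \<sigma>L: "\<sigma> \<in> ?L" by (rule essential_level[OF \<sigma>])
  have *: "\<exists>D. decomposition B \<sigma> D" if "\<tau> \<in> ?L" "essential_poly \<sigma> \<in> mono_span (above \<tau>)" for \<tau>
    using that
  proof (induction "card (above \<tau>)" arbitrary: \<tau> rule: less_induct)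
    case less
    show ?case
    proof (rule ccontr)
      assume no: "\<not> ?case"
      have "\<sigma> \<in> keys (essential_poly \<sigma>)" using lead by (simp add: leads_def in_keys_iff)
      then have \<sigma>above: "\<sigma> \<in> above \<tau>" using keys_mono_span_above[OF less.prems(2)] by blast
      have "lookup (essential_poly \<sigma>) \<tau> = 0 \<or> (\<nexists>D. decomposition B \<tau> D)"
      proof (cases "\<tau> = \<sigma>")
        case False
        have "\<tau> \<notin> keys (essential_poly \<sigma>)"
          using lead \<sigma>above sig_le_antisym False unfolding leads_def above_def by blast
        then show ?thesis by (simp add: in_keys_iff)
      qed (use no in simp)
      from mono_span_above_reduce[OF less.prems(2) this]
      have in_strict: "essential_poly \<sigma> \<in> mono_span (strictly_above \<tau>)" .
      have "strictly_above \<tau> \<noteq> {}"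
      proof
        assume "strictly_above \<tau> = {}"
        then have "essential_poly \<sigma> = 0" using in_strict by (simp add: mono_span_def)
        then show False using lead by (simp add: leads_def)
      qed
      moreover have "finite (strictly_above \<tau>)" using finite_above by (simp add: strictly_above_def)
      moreover have "strictly_above \<tau> \<subseteq> ?L"
        using less.prems(1) unfolding strictly_above_def above_def level_def by auto
      ultimately obtain \<rho> where \<rho>: "\<rho> \<in> strictly_above \<tau>" "\<And>x. x \<in> strictly_above \<tau> \<Longrightarrow> sig_le \<rho> x"
        using finite_has_least by blast
      have "strictly_above \<tau> \<subseteq> above \<rho>"
        using \<rho> unfolding strictly_above_def above_def level_def by auto
      then have "essential_poly \<sigma> \<in> mono_span (above \<rho>)" using in_strict mono_span_mono by blast
      moreover have "above \<rho> \<subset> above \<tau>"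
      proof -
        have "\<tau> \<notin> above \<rho>" using \<rho>(1) sig_le_antisym unfolding strictly_above_def above_def by blast
        moreover have "\<tau> \<in> above \<tau>"
          using less.prems(1) sig_le_refl unfolding above_def level_def by simp
        ultimately show ?thesis using above_mono[of \<rho> \<tau>] \<rho>(1) unfolding strictly_above_def by blast
      qed
      ultimately have "\<exists>D. decomposition B \<sigma> D"
        using less.hyps[OF psubset_card_mono[OF finite_above]] \<open>strictly_above \<tau> \<subseteq> ?L\<close> \<rho>(1) by blast
      then show False using no by blast
    qed
  qed
  \<comment> \<open>The least signature of the level excludes nothing, so it serves as the first
    bound.\<close>
  obtain \<mu> where \<mu>: "\<mu> \<in> ?L" "\<And>\<tau>. \<tau> \<in> ?L \<Longrightarrow> sig_le \<mu> \<tau>"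
    using finite_has_least[OF finite_level _ order_refl] \<sigma>L by blast
  have "?L \<subseteq> above \<mu>" using \<mu> unfolding above_def level_def by auto
  then have "essential_poly \<sigma> \<in> mono_span (above \<mu>)"
    using essential_poly_in_mono_span[OF S \<sigma> refl] mono_span_mono by blast
  then show ?thesis using * \<mu>(1) by blast
qed

text \<open>One inclusion is the decomposition just found, the other is closure of essential
  signatures under addition.\<close>

lemma essential_semigroup_eq:
  "with_highest_weight_in essential_signatures (semigroup_generated \<Lambda>) = semigroup_generated B"
proof (intro equalityI subsetI)
  fix \<sigma> assume "\<sigma> \<in> with_highest_weight_in essential_signatures (semigroup_generated \<Lambda>)"
  then obtain D where "decomposition B \<sigma> D"
    using essential_decomposes unfolding with_highest_weight_in_def by blast
  then show "\<sigma> \<in> semigroup_generated B" using sum_mset_in_semigroup by (auto simp: decomposition_def)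
next
  fix \<sigma> assume "\<sigma> \<in> semigroup_generated B"
  then show "\<sigma> \<in> with_highest_weight_in essential_signatures (semigroup_generated \<Lambda>)"
  proof (induction rule: semigroup_generated.induct)
    case (generator a)
    then show ?case using B_iff semigroup_generated.generator by (auto simp: with_highest_weight_in_def)
  next
    case (add a b)
    then show ?case unfolding with_highest_weight_in_def mem_Collect_eq fst_add
      using essential_add semigroup_generated.add by blast
  qed
qed

end

end

theorem theorem1:
  fixes scale :: "complex \<Rightarrow> 'g::ab_group_add \<Rightarrow> 'g"
    and bracket :: "'g \<Rightarrow> 'g \<Rightarrow> 'g"
    and mscale :: "complex \<Rightarrow> 'v::ab_group_add \<Rightarrow> 'v"
    and T :: "'g set"
    and P :: "('g \<Rightarrow> complex) set"
    and N :: nat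
    and \<alpha> :: "nat \<Rightarrow> 'g \<Rightarrow> complex"
    and e :: "('g \<Rightarrow> complex) \<Rightarrow> 'g"
    and R :: "((nat \<Rightarrow> nat) \<times> (nat \<Rightarrow> nat)) set"
    and V :: "('g \<Rightarrow> complex) \<Rightarrow> 'v set"
    and act :: "('g \<Rightarrow> complex) \<Rightarrow> 'g \<Rightarrow> 'v \<Rightarrow> 'v"
    and hv :: "('g \<Rightarrow> complex) \<Rightarrow> 'v"
    and lam :: "nat \<Rightarrow> 'g \<Rightarrow> complex"
    and m :: nat
    and E B :: "'g signature set"
    and S :: "('g \<Rightarrow> complex) set"
  assumes setting: "essential_setting scale bracket mscale T P N \<alpha> e R V act hv"
    and dominant: "\<And>i. i \<in> {1..m} \<Longrightarrow> lam i \<in> complex_lie_algebra.dominant_weights scale bracket T P"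
    and S: "S = semigroup_generated (lam ` {1..m})"
    and E: "E = essential_setting.essential_signatures scale bracket mscale T P N \<alpha> e R act hv"
    and B: "B = with_highest_weight_in E (lam ` {1..m})"
    and star: "\<And>\<sigma> D D'. \<sigma> \<in> semigroup_generated B \<Longrightarrow> decomposition B \<sigma> D \<Longrightarrow> decomposition B \<sigma> D' \<Longrightarrow>
           (admissible_operation B)\<^sup>*\<^sup>* D' D"
    and double_star: "\<And>i j \<sigma>. i \<in> {1..m} \<Longrightarrow> j \<in> {1..m} \<Longrightarrow> \<sigma> \<in> E \<Longrightarrow> fst \<sigma> = lam i + lam j \<Longrightarrow>
           \<exists>D. decomposition B \<sigma> D"
  shows "with_highest_weight_in E S = semigroup_generated B"
proof -
  interpret essential_setting scale bracket mscale T P N \<alpha> e R V act hv by (rule setting)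
  show ?thesis
    unfolding S E
  proof (rule essential_semigroup_eq)
    show "lam ` {1..m} \<subseteq> Dom" using dominant by blast
    show "B = with_highest_weight_in essential_signatures (lam ` {1..m})" using B E by simp
    show "\<exists>D. decomposition B \<sigma> D"
      if "\<kappa> \<in> lam ` {1..m}" "\<mu> \<in> lam ` {1..m}" "\<sigma> \<in> essential_signatures" "fst \<sigma> = \<kappa> + \<mu>" for \<kappa> \<mu> \<sigma>
      using double_star that E by blast
  qed (rule star)
qed

end
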